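(* Let $(G,o)$ be a unimodular random rooted graph with maximum degree at most $D$. Assume there is $h>0$ such that $i(G)\ge h$ with probability $1$. Then $\mathbb{E}\nu_{G,o}$ has only finitely many atoms.
   Context: The isoperimetric constant is $i(G)=\inf\{|\partial S|/|S| : \emptyset\ne S\subseteq V(G), |S|<\infty\}$, where $\partial S$ is the set of vertices not in $S$ having a neighbor in $S$. Matching measure: $\nu_{G,u}$ is the spectral measure at the one-vertex path $u$ of the adjacency operator of the path tree $T(G,u)$ (vertices: finite paths in $G$ starting at $u$; two paths adjacent iff one is obtained from the other by deleting its last vertex); $\mathbb{E}\nu_{G,o}$ is $E\mapsto\mathbb{E}[\nu_{G,o}(E)]$. A random rooted graph $(G,o)$ is unimodular if $\mathbb{E}\sum_v f(G,o,v)=\mathbb{E}\sum_v f(G,v,o)$ for all non-negative measurable $f$ on bi-rooted graphs. *)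

theory Defs
  imports "HOL-Probability.Probability"
begin

text \<open>Graphs on countable vertex sets: a graph is a pair (V, E) with V a set of
  vertices (natural numbers) and E an edge relation.\<close>

type_synonym graph = "nat set \<times> (nat \<Rightarrow> nat \<Rightarrow> bool)"

definition verts :: "graph \<Rightarrow> nat set" where "verts G = fst G"
definition adj :: "graph \<Rightarrow> nat \<Rightarrow> nat \<Rightarrow> bool" where "adj G = snd G"

text \<open>Simple undirected graph, edges only between vertices.\<close>
definition simple_graph :: "graph \<Rightarrow> bool" where
  "simple_graph G \<longleftrightarrow>
     (\<forall>x y. adj G x y \<longrightarrow> x \<in> verts G \<and> y \<in> verts G) \<and>
     (\<forall>x y. adj G x y \<longrightarrow> adj G y x) \<and> (\<forall>x. \<not> adj G x x)"

text \<open>Connected rooted graph (G, o).\<close>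
definition rooted_graph :: "graph \<Rightarrow> nat \<Rightarrow> bool" where
  "rooted_graph G r \<longleftrightarrow> simple_graph G \<and> r \<in> verts G \<and>
     (\<forall>v \<in> verts G. (r, v) \<in> {(x, y). adj G x y}\<^sup>*)"

definition max_degree_le :: "graph \<Rightarrow> nat \<Rightarrow> bool" where
  "max_degree_le G D \<longleftrightarrow>
     (\<forall>x \<in> verts G. finite {y. adj G x y} \<and> card {y. adj G x y} \<le> D)"

text \<open>Vertex boundary: vertices not in S having a neighbour in S.\<close>
definition vboundary :: "graph \<Rightarrow> nat set \<Rightarrow> nat set" where
  "vboundary G S = {v \<in> verts G. v \<notin> S \<and> (\<exists>u \<in> S. adj G u v)}"

definition isoperimetric_const :: "graph \<Rightarrow> real" where
  "isoperimetric_const G =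
     (INF S \<in> {S. S \<noteq> {} \<and> S \<subseteq> verts G \<and> finite S}.
        real (card (vboundary G S)) / real (card S))"

text \<open>Path tree T(G,u): vertices are the finite (self-avoiding) paths in G starting at u,
  represented as lists; two paths are adjacent iff one arises from the other by deleting
  its last vertex.\<close>
definition path_tree_verts :: "graph \<Rightarrow> nat \<Rightarrow> nat list set" where
  "path_tree_verts G u = {p. p \<noteq> [] \<and> hd p = u \<and> distinct p \<and> set p \<subseteq> verts G \<and>
       (\<forall>i. Suc i < length p \<longrightarrow> adj G (p ! i) (p ! Suc i))}"

definition path_tree_adj :: "nat list \<Rightarrow> nat list \<Rightarrow> bool" where
  "path_tree_adj p q \<longleftrightarrow> (\<exists>x. q = p @ [x]) \<or> (\<exists>x. p = q @ [x])"

text \<open>Number of closed walks of length k at the root [u] of T(G,u); this is the k-th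
  moment of the spectral measure at [u] of the adjacency operator of T(G,u).\<close>
definition path_tree_closed_walks :: "graph \<Rightarrow> nat \<Rightarrow> nat \<Rightarrow> nat" where
  "path_tree_closed_walks G u k = card {ws. length ws = Suc k \<and> hd ws = [u] \<and> last ws = [u] \<and>
      set ws \<subseteq> path_tree_verts G u \<and>
      (\<forall>i<k. path_tree_adj (ws ! i) (ws ! Suc i))}"

text \<open>Matching measure nu_{G,u}: the spectral measure at [u] of the (bounded, self-adjoint,
  for bounded degree) adjacency operator of T(G,u), i.e. the unique compactly supported Borel
  probability measure on the reals whose k-th moment is the number of closed walks of
  length k at [u] in T(G,u).\<close>
definition matching_measure :: "graph \<Rightarrow> nat \<Rightarrow> real measure" where
  "matching_measure G u = (THE \<mu>. prob_space \<mu> \<and> sets \<mu> = sets borel \<and>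
      (\<exists>C. AE x in \<mu>. \<bar>x\<bar> \<le> C) \<and>
      (\<forall>k. (\<integral>x. x ^ k \<partial>\<mu>) = real (path_tree_closed_walks G u k)))"

text \<open>Sigma algebra on graphs: generated by the events "x is a vertex" and "x ~ y".\<close>
definition graph_space :: "graph measure" where
  "graph_space = sigma UNIV
     ({{G. x \<in> verts G} | x. True} \<union> {{G. adj G x y} | x y. True})"

definition birooted_space :: "(graph \<times> nat \<times> nat) measure" where
  "birooted_space = graph_space \<Otimes>\<^sub>M (count_space UNIV \<Otimes>\<^sub>M count_space UNIV)"

text \<open>Isomorphisms of graphs and invariance of functions of bi-rooted graphs.\<close>
definition graph_iso :: "(nat \<Rightarrow> nat) \<Rightarrow> graph \<Rightarrow> graph \<Rightarrow> bool" where
  "graph_iso \<phi> G H \<longleftrightarrow> bij_betw \<phi> (verts G) (verts H) \<and>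
     (\<forall>x \<in> verts G. \<forall>y \<in> verts G. adj H (\<phi> x) (\<phi> y) \<longleftrightarrow> adj G x y)"

definition iso_invariant :: "(graph \<times> nat \<times> nat \<Rightarrow> ennreal) \<Rightarrow> bool" where
  "iso_invariant f \<longleftrightarrow> (\<forall>G H \<phi> a b. simple_graph G \<and> simple_graph H \<and> graph_iso \<phi> G H \<and>
       a \<in> verts G \<and> b \<in> verts G \<longrightarrow> f (H, \<phi> a, \<phi> b) = f (G, a, b))"

text \<open>A random rooted graph (G, o) on a probability space M is unimodular
  (mass transport principle).\<close>
definition unimodular :: "'w measure \<Rightarrow> ('w \<Rightarrow> graph) \<Rightarrow> ('w \<Rightarrow> nat) \<Rightarrow> bool" where
  "unimodular M G rt \<longleftrightarrow>
     (\<forall>f. f \<in> borel_measurable birooted_space \<and> iso_invariant f \<longrightarrow>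
        (\<integral>\<^sup>+ \<omega>. (\<integral>\<^sup>+ v. f (G \<omega>, rt \<omega>, v) \<partial>count_space (verts (G \<omega>))) \<partial>M) =
        (\<integral>\<^sup>+ \<omega>. (\<integral>\<^sup>+ v. f (G \<omega>, v, rt \<omega>) \<partial>count_space (verts (G \<omega>))) \<partial>M))"

end

theory Submission
  imports Defs "HOL-Computational_Algebra.Fundamental_Theorem_Algebra"
begin

text \<open>The Green function of \<open>T(G,u)\<close> at its root obeys the same recursion as the quotient
  \<open>\<mu>(G - u) / \<mu>(G)\<close> of matching polynomials, hence equals it for finite \<open>G\<close> and is a limit of such
  quotients for infinite \<open>G\<close>. Fix \<open>\<theta>\<close> and call \<open>u\<close> essential if its matching measure has an atom at \<open>\<theta>\<close>. As in the
  Gallai--Edmonds theorem, deleting the neighbours of a component \<open>S\<close> of the essential vertices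
  only increases the atoms on \<open>S\<close>, and these sum to at most 1 over \<open>S\<close>; if \<open>S\<close> is finite,
  \<open>\<theta>\<close> is a simple root of \<open>\<mu>(S)\<close>. By mass transport almost surely all components are finite.

  A vertex \<open>a\<close> that is not essential but has essential neighbours spreads a unit of mass over these
  neighbours, in proportion to their atoms after deletion of \<open>a\<close>, and a finite component receives
  at most 1 in total because \<open>\<theta>\<close> is a simple root. Since a component \<open>S\<close> has at least \<open>h |S|\<close>
  boundary vertices, mass transport forces some component to have at most \<open>D / h\<close> vertices. Hence
  \<open>\<theta>\<close> is a root of one of the finitely many matching polynomials of graphs of bounded size.\<close>

section \<open>Matching polynomials\<close>

text \<open>An infinite graph has no matching polynomial. So every identity is first turned into an
  inequality for the finite truncations \<open>V \<inter> {..n}\<close> at a fixed \<open>z\<close>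
  with \<open>Im z > 0\<close>, with constants independent of \<open>n\<close>. Then
  \<open>n\<close> tends to infinity, and only afterwards does \<open>z = \<theta> + i t\<close>
  descend to \<open>\<theta>\<close>; multiplying the Green function by \<open>i t\<close> extracts
  the atom in that limit. The bounds are uniform because of Cauchy--Schwarz over paths: the squared
  Green functions along all paths from \<open>u\<close> add up to \<open>- Im g(u) / Im z\<close>.

  The origin of \<open>D / h\<close>: let each essential vertex send \<open>1 / |S|\<close> to every
  boundary vertex of its component \<open>S\<close>, hence at least \<open>h\<close> in total. A
  boundary vertex touches at most \<open>D\<close> components and receives at most 1 from each. The
  unit it spreads in turn is shared evenly among the vertices of the components that it reaches, so
  an essential vertex receives at most \<open>1 / |S|\<close>. By unimodularity
  \<open>h P(o essential) <= D E[1 / |S|; o essential]\<close>, which fails if the probability is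
  positive and all components have more than \<open>D / h\<close> vertices.\<close>

function matching_poly :: "(nat \<Rightarrow> nat \<Rightarrow> bool) \<Rightarrow> nat set \<Rightarrow> int poly" where
  "matching_poly E X = (if finite X \<and> X \<noteq> {} then
     [:0, 1:] * matching_poly E (X - {Min X}) -
       (\<Sum>v\<in>{v\<in>X. E (Min X) v}. matching_poly E (X - {Min X} - {v})) else 1)"
  by pat_completeness auto
termination
proof (relation "Wellfounded.measure (\<lambda>(E, X). card X)", goal_cases)
  case (2 E X)
  then show ?case
    using card_Diff1_less[of X "Min X"] Min_in[of X] by simp
next
  case (3 E X v)
  have "card (X - {Min X} - {v}) \<le> card (X - {Min X})"
    using 3 by (intro card_mono) auto
  also have "\<dots> < card X"
    using 3 by (metis Min_in card_Diff1_less)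
  finally show ?case by simp
qed auto

declare matching_poly.simps [simp del]

lemma matching_poly_empty [simp]: "matching_poly E {} = 1"
  by (simp add: matching_poly.simps)

lemma matching_poly_Min:
  "finite X \<Longrightarrow> X \<noteq> {} \<Longrightarrow> matching_poly E X = [:0, 1:] * matching_poly E (X - {Min X}) -
       (\<Sum>v\<in>{v\<in>X. E (Min X) v}. matching_poly E (X - {Min X} - {v}))"
  by (subst matching_poly.simps) simp

lemma matching_poly_cong:
  assumes "\<And>x y. x \<in> X \<Longrightarrow> y \<in> X \<Longrightarrow> E x y = E' x y"
  shows "matching_poly E X = matching_poly E' X"
  using assms
proof (induction "card X" arbitrary: X rule: less_induct)
  case less
  show ?case
  proof (cases "finite X \<and> X \<noteq> {}")
    case True
    then have m: "Min X \<in> X" by simp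
    have c1: "card (X - {Min X}) < card X"
      using True m by (metis card_Diff1_less)
    have c2: "card (X - {Min X} - {v}) < card X" for v
      using c1 True by (meson card_mono finite_Diff Diff_subset le_less_trans)
    have s: "{v \<in> X. E (Min X) v} = {v \<in> X. E' (Min X) v}"
      using less.prems m by blast
    have "matching_poly E (X - {Min X}) = matching_poly E' (X - {Min X})"
      using less.prems by (intro less.hyps c1) auto
    moreover have "matching_poly E (X - {Min X} - {v}) = matching_poly E' (X - {Min X} - {v})" for v
      using less.prems by (intro less.hyps c2) auto
    ultimately show ?thesis
      using True by (simp add: matching_poly_Min s)
  next
    case False
    then show ?thesis by (subst (1 2) matching_poly.simps) auto
  qed
qed

text \<open>The edge relation stays fixed on all of \<open>nat\<close> and the vertex set is a
  separate argument of everything below, so deleting vertices only shrinks a set.\<close>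

locale bounded_graph =
  fixes E :: "nat \<Rightarrow> nat \<Rightarrow> bool" and D :: nat
  assumes sym: "E x y \<Longrightarrow> E y x"
    and irrefl: "\<not> E x x"
    and finite_nbrs: "finite {y. E x y}"
    and card_nbrs: "card {y. E x y} \<le> D"
begin

lemma E_commute: "E x y \<longleftrightarrow> E y x"
  using sym by blast

lemma E_neq: "E x y \<Longrightarrow> x \<noteq> y"
  using irrefl by blast

lemma finite_nbrs_in [simp, intro]: "finite {y \<in> X. E x y}"
  by (rule finite_subset[OF _ finite_nbrs[of x]]) auto

lemma card_nbrs_in: "card {y \<in> X. E x y} \<le> D"
  by (rule order.trans[OF card_mono[OF finite_nbrs] card_nbrs[of x]]) auto

text \<open>This is the recursion of sum_k (-1)^k m_k x^(|X|-2k), where m_k counts the matchings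
  with k edges. The definition expands at the least vertex only to avoid a choice (infinite sets get
  the placeholder 1). Expanding at \<open>m\<close> and then at \<open>u\<close> gives the same
  terms as the opposite order, so both one-step expansions agree.\<close>

lemma matching_poly_rec:
  assumes "finite X" "u \<in> X"
  shows "matching_poly E X = [:0, 1:] * matching_poly E (X - {u}) -
       (\<Sum>v\<in>{v\<in>X - {u}. E u v}. matching_poly E (X - {u, v}))"
  using assms
proof (induction "card X" arbitrary: X u rule: less_induct)
  case less
  define m where "m = Min X"
  have mX: "m \<in> X" unfolding m_def using less.prems by (intro Min_in) auto
  let ?P = "matching_poly E"
  have Min_rec: "?P X = [:0, 1:] * ?P (X - {m}) - (\<Sum>v\<in>{v\<in>X - {m}. E m v}. ?P (X - {m, v}))"
  proof -
    have "{v\<in>X. E m v} = {v\<in>X - {m}. E m v}" using irrefl by auto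
    then show ?thesis
      using matching_poly_Min[of X E] less.prems by (auto simp: m_def Diff_insert2[symmetric])
  qed
  show ?case
  proof (cases "u = m")
    case True
    then show ?thesis using Min_rec by simp
  next
    case False
    have c: "card (X - {x}) < card X" if "x \<in> X" for x
      using that less.prems by (metis card_Diff1_less)
    have c2: "card (X - {x, v}) < card X" if "x \<in> X" for x v
    proof -
      have "card (X - {x, v}) \<le> card (X - {x})" using less.prems by (intro card_mono) auto
      then show ?thesis using c[OF that] by simp
    qed
    \<comment> \<open>Up to the last double sum the right side is visibly symmetric in
      \<open>a\<close> and \<open>b\<close>. That sum runs over ordered pairs of distinct vertices;
      its summations are exchanged in \<open>swap\<close>.\<close>
    have sym_step: "[:0, 1:] * ?P (X - {a}) - (\<Sum>v\<in>{v\<in>X - {a}. E a v}. ?P (X - {a, v})) =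
        [:0, 1:] * ([:0, 1:] * ?P (X - {a, b})) - [:0, 1:] * (\<Sum>v\<in>{v\<in>X - {a, b}. E b v}. ?P (X - {a, b, v}))
        - (if E a b then ?P (X - {a, b}) else 0)
        - [:0, 1:] * (\<Sum>v\<in>{v\<in>X - {a, b}. E a v}. ?P (X - {a, b, v}))
        + (\<Sum>v\<in>{v\<in>X - {a, b}. E a v}. \<Sum>w\<in>{w\<in>X - {a, b, v}. E b w}. ?P (X - {a, b, v, w}))"
      if ab: "a \<in> X" "b \<in> X" "a \<noteq> b" for a b
    proof -
      have 1: "?P (X - {a}) = [:0, 1:] * ?P (X - {a, b}) - (\<Sum>v\<in>{v\<in>X - {a, b}. E b v}. ?P (X - {a, b, v}))"
      proof -
        have e: "X - {a} - {b} = X - {a, b}" "\<And>v. X - {a} - {b, v} = X - {a, b, v}" by auto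
        show ?thesis
          using less.hyps[OF c[OF ab(1)], of b] ab less.prems by (simp add: e)
      qed
      have 2: "?P (X - {a, v}) = [:0, 1:] * ?P (X - {a, b, v}) - (\<Sum>w\<in>{w\<in>X - {a, b, v}. E b w}. ?P (X - {a, b, v, w}))"
        if "v \<in> X - {a, b}" for v
      proof -
        have e: "X - {a, v} - {b} = X - {a, b, v}" "\<And>w. X - {a, v} - {b, w} = X - {a, b, v, w}" by auto
        show ?thesis
          using less.hyps[OF c2[OF ab(1), of v], of b] that ab less.prems by (simp add: e)
      qed
      have split: "{v\<in>X - {a}. E a v} = (if E a b then insert b {v\<in>X - {a, b}. E a v} else {v\<in>X - {a, b}. E a v})"
        using ab by auto
      have 3: "(\<Sum>v\<in>{v\<in>X - {a}. E a v}. ?P (X - {a, v})) =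
          (if E a b then ?P (X - {a, b}) else 0) + (\<Sum>v\<in>{v\<in>X - {a, b}. E a v}. ?P (X - {a, v}))"
        unfolding split using less.prems by auto
      have 4: "(\<Sum>v\<in>{v\<in>X - {a, b}. E a v}. ?P (X - {a, v})) =
          [:0, 1:] * (\<Sum>v\<in>{v\<in>X - {a, b}. E a v}. ?P (X - {a, b, v}))
          - (\<Sum>v\<in>{v\<in>X - {a, b}. E a v}. \<Sum>w\<in>{w\<in>X - {a, b, v}. E b w}. ?P (X - {a, b, v, w}))"
        unfolding sum_distrib_left sum_subtractf[symmetric]
        by (rule sum.cong[OF refl], rule 2) auto
      show ?thesis
        unfolding 1 3 4 by (simp only: right_diff_distrib)
    qed
    have fin: "finite {v\<in>X - {u, m}. E m v}" "finite {v\<in>X - {u, m}. E u v}" by (rule finite_nbrs_in)+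
    have swap: "(\<Sum>v\<in>{v\<in>X - {m, u}. E m v}. \<Sum>w\<in>{w\<in>X - {m, u, v}. E u w}. ?P (X - {m, u, v, w})) =
      (\<Sum>v\<in>{v\<in>X - {u, m}. E u v}. \<Sum>w\<in>{w\<in>X - {u, m, v}. E m w}. ?P (X - {u, m, v, w}))"
    proof -
      have "(\<Sum>v\<in>{v\<in>X - {m, u}. E m v}. \<Sum>w\<in>{w\<in>X - {m, u, v}. E u w}. ?P (X - {m, u, v, w})) =
        (\<Sum>v\<in>{v\<in>X - {u, m}. E m v}. \<Sum>w\<in>{w. w \<in> {w\<in>X - {u, m}. E u w} \<and> v \<noteq> w}. ?P (X - {u, m, v, w}))"
        by (rule sum.cong) (auto intro!: sum.cong arg_cong[where f = ?P])
      also have "\<dots> = (\<Sum>w\<in>{w\<in>X - {u, m}. E u w}. \<Sum>v\<in>{v. v \<in> {v\<in>X - {u, m}. E m v} \<and> v \<noteq> w}. ?P (X - {u, m, v, w}))"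
        using sum.swap_restrict[OF fin, of "\<lambda>v w. ?P (X - {u, m, v, w})" "\<lambda>v w. v \<noteq> w"] .
      also have "\<dots> = (\<Sum>v\<in>{v\<in>X - {u, m}. E u v}. \<Sum>w\<in>{w\<in>X - {u, m, v}. E m w}. ?P (X - {u, m, v, w}))"
        by (rule sum.cong) (auto intro!: sum.cong arg_cong[where f = ?P])
      finally show ?thesis .
    qed
    have e: "X - {m, u} = X - {u, m}" "\<And>v. X - {m, u, v} = X - {u, m, v}" by auto
    show ?thesis
      unfolding Min_rec sym_step[OF mX less.prems(2) False[symmetric]] sym_step[OF less.prems(2) mX False] swap
      unfolding e using E_commute[of m u] by simp
  qed
qed

end

section \<open>Green functions of the path tree\<close>

definition matching_val :: "(nat \<Rightarrow> nat \<Rightarrow> bool) \<Rightarrow> nat set \<Rightarrow> complex \<Rightarrow> complex" where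
  "matching_val E X z = poly (map_poly of_int (matching_poly E X)) z"

text \<open>When \<open>L\<close> is the vertex set of a path \<open>p\<close> from
  \<open>u\<close>, this is the resolvent entry between the root and \<open>p\<close> in the path
  tree of \<open>X\<close> at \<open>u\<close> (Godsil's correspondence);
  \<open>green_tree_eq\<close> below is the reason.\<close>

definition green :: "(nat \<Rightarrow> nat \<Rightarrow> bool) \<Rightarrow> nat set \<Rightarrow> nat set \<Rightarrow> complex \<Rightarrow> complex" where
  "green E X L z = matching_val E (X - L) z / matching_val E X z"

lemma map_poly_of_int_diff:
  "map_poly of_int (p - q) = (map_poly of_int p - map_poly of_int q :: 'a::ring_1 poly)"
  by (rule poly_eqI) (simp add: coeff_map_poly)

lemma map_poly_of_int_sum:
  "map_poly of_int (sum f A) = (\<Sum>x\<in>A. map_poly of_int (f x) :: 'a::ring_1 poly)"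
  by (rule poly_eqI) (simp add: coeff_map_poly coeff_sum)

lemma matching_val_empty [simp]: "matching_val E {} z = 1"
  by (simp add: matching_val_def)

lemma matching_val_cong:
  "(\<And>x y. x \<in> X \<Longrightarrow> y \<in> X \<Longrightarrow> E x y = E' x y) \<Longrightarrow> matching_val E X z = matching_val E' X z"
  unfolding matching_val_def by (subst matching_poly_cong[of X E E']) auto

lemma green_empty_set [simp]: "matching_val E X z \<noteq> 0 \<Longrightarrow> green E X {} z = 1"
  by (simp add: green_def)

lemma sqrt_sum_Cauchy_Schwarz:
  fixes f g :: "'a \<Rightarrow> complex"
  shows "norm (\<Sum>x\<in>A. f x * g x) \<le> sqrt (\<Sum>x\<in>A. (norm (f x))\<^sup>2) * sqrt (\<Sum>x\<in>A. (norm (g x))\<^sup>2)"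
proof -
  have "norm (\<Sum>x\<in>A. f x * g x) \<le> (\<Sum>x\<in>A. \<bar>norm (f x)\<bar> * \<bar>norm (g x)\<bar>)"
    using norm_sum[of "\<lambda>x. f x * g x" A] by (simp add: norm_mult)
  also have "\<dots> \<le> L2_set (\<lambda>x. norm (f x)) A * L2_set (\<lambda>x. norm (g x)) A"
    by (rule L2_set_mult_ineq)
  finally show ?thesis by (simp add: L2_set_def)
qed

context bounded_graph
begin

lemma matching_val_rec:
  assumes "finite X" "u \<in> X"
  shows "matching_val E X z = z * matching_val E (X - {u}) z -
       (\<Sum>v\<in>{v\<in>X - {u}. E u v}. matching_val E (X - {u, v}) z)"
  unfolding matching_val_def
  by (subst matching_poly_rec[OF assms])
     (simp add: map_poly_of_int_diff map_poly_of_int_sum map_poly_pCons poly_sum)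

text \<open>The quotients telescope, so the Green function of a path is a product of one-vertex
  Green functions in successively smaller graphs.\<close>

lemma green_mult:
  assumes "matching_val E (X - K) z \<noteq> 0"
  shows "green E X K z * green E (X - K) L z = green E X (K \<union> L) z"
proof -
  have "X - K - L = X - (K \<union> L)" by blast
  then show ?thesis using assms by (simp add: green_def)
qed

lemma green_rec:
  assumes "finite X" "u \<in> X" "matching_val E (X - {u}) z \<noteq> 0"
  shows "matching_val E X z = matching_val E (X - {u}) z *
     (z - (\<Sum>v\<in>{v\<in>X - {u}. E u v}. green E (X - {u}) {v} z))"
proof -
  have "X - {u} - {v} = X - {u, v}" for v by blast
  then show ?thesis
    unfolding matching_val_rec[OF assms(1,2)] green_def using assms(3)
    by (simp add: right_diff_distrib sum_distrib_left mult.commute)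
qed

lemma inverse_green:
  assumes "finite X" "u \<in> X" "matching_val E (X - {u}) z \<noteq> 0"
  shows "inverse (green E X {u} z) = z - (\<Sum>v\<in>{v\<in>X - {u}. E u v}. green E (X - {u}) {v} z)"
  using green_rec[OF assms] assms(3) by (simp add: green_def)

text \<open>The recursion is a continued fraction: if the Green functions of \<open>X - {u}\<close>
  lie in the lower half-plane, then \<open>Im (1 / g) \<ge> Im z\<close> at \<open>u\<close>. This
  gives the absence of zeros and both bounds for \<open>X\<close> at once.\<close>

lemma green_upper_aux:
  assumes "finite X" "Im z > 0"
  shows "matching_val E X z \<noteq> 0 \<and> (\<forall>u\<in>X. Im (green E X {u} z) < 0 \<and> norm (green E X {u} z) \<le> 1 / Im z)"
  using assms(1)
proof (induction "card X" arbitrary: X rule: less_induct)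
  case less
  have step: "Im (inverse (green E X {u} z)) \<ge> Im z \<and> matching_val E X z \<noteq> 0" if "u \<in> X" for u
  proof -
    have IH: "matching_val E (X - {u}) z \<noteq> 0" "\<And>v. v \<in> X - {u} \<Longrightarrow> Im (green E (X - {u}) {v} z) < 0"
      using less.hyps[of "X - {u}"] less.prems that by (auto simp del: card_Diff_insert intro: card_Diff1_less)
    have "(\<Sum>v\<in>{v\<in>X - {u}. E u v}. Im (green E (X - {u}) {v} z)) \<le> 0"
      using IH(2) by (intro sum_nonpos) (auto simp: less_imp_le)
    then have *: "Im (z - (\<Sum>v\<in>{v\<in>X - {u}. E u v}. green E (X - {u}) {v} z)) \<ge> Im z"
      by simp
    then have "z - (\<Sum>v\<in>{v\<in>X - {u}. E u v}. green E (X - {u}) {v} z) \<noteq> 0"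
      using assms(2) by (metis not_le zero_complex.simps(2))
    then have "matching_val E X z \<noteq> 0"
      using green_rec[OF less.prems that IH(1)] IH(1) by (metis mult_eq_0_iff)
    then show ?thesis
      using * inverse_green[OF less.prems that IH(1)] by simp
  qed
  have nz: "matching_val E X z \<noteq> 0"
    using step by (cases "X = {}") auto
  have "Im (green E X {u} z) < 0 \<and> norm (green E X {u} z) \<le> 1 / Im z" if "u \<in> X" for u
  proof -
    define w where "w = inverse (green E X {u} z)"
    have w: "Im w \<ge> Im z" using step[OF that] by (simp add: w_def)
    have g: "green E X {u} z = inverse w" by (simp add: w_def)
    have "Im w > 0" using w assms(2) by simp
    moreover have "norm w \<ge> Im z" using w abs_Im_le_cmod[of w] by simp
    ultimately show ?thesis
      unfolding g using assms(2)
      by (auto simp: norm_inverse intro!: divide_pos_pos add_nonneg_pos le_imp_inverse_le simp flip: inverse_eq_divide)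
  qed
  then show ?case using nz by blast
qed

lemma matching_val_nonzero: "finite X \<Longrightarrow> Im z > 0 \<Longrightarrow> matching_val E X z \<noteq> 0"
  and Im_green_neg: "finite X \<Longrightarrow> Im z > 0 \<Longrightarrow> u \<in> X \<Longrightarrow> Im (green E X {u} z) < 0"
  and norm_green_le: "finite X \<Longrightarrow> Im z > 0 \<Longrightarrow> u \<in> X \<Longrightarrow> norm (green E X {u} z) \<le> 1 / Im z"
  using green_upper_aux by blast+

text \<open>At most \<open>D\<close> terms of norm at most 1 are subtracted from a \<open>z\<close>
  of norm at least \<open>D + 1\<close>, so \<open>1 / g\<close> has norm at least 1. This is cruder
  than the Heilmann--Lieb root bound, but only its uniformity in \<open>X\<close> matters: it
  confines all spectral measures to one compact interval.\<close>

lemma green_large_aux: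
  assumes "finite X" "norm z \<ge> real D + 1"
  shows "matching_val E X z \<noteq> 0 \<and> (\<forall>u\<in>X. norm (green E X {u} z) \<le> 1)"
  using assms(1)
proof (induction "card X" arbitrary: X rule: less_induct)
  case less
  have step: "norm (inverse (green E X {u} z)) \<ge> 1 \<and> matching_val E X z \<noteq> 0" if "u \<in> X" for u
  proof -
    have IH: "matching_val E (X - {u}) z \<noteq> 0" "\<And>v. v \<in> X - {u} \<Longrightarrow> norm (green E (X - {u}) {v} z) \<le> 1"
      using less.hyps[of "X - {u}"] less.prems that by (auto simp del: card_Diff_insert intro: card_Diff1_less)
    have "norm (\<Sum>v\<in>{v\<in>X - {u}. E u v}. green E (X - {u}) {v} z) \<le> (\<Sum>v\<in>{v\<in>X - {u}. E u v}. 1)"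
      using IH(2) by (intro sum_norm_le) auto
    also have "\<dots> \<le> real D" using card_nbrs_in[of "X - {u}" u] by simp
    finally have *: "norm (z - (\<Sum>v\<in>{v\<in>X - {u}. E u v}. green E (X - {u}) {v} z)) \<ge> 1"
      using assms(2) norm_triangle_ineq2[of z "\<Sum>v\<in>{v\<in>X - {u}. E u v}. green E (X - {u}) {v} z"] by linarith
    then have "z - (\<Sum>v\<in>{v\<in>X - {u}. E u v}. green E (X - {u}) {v} z) \<noteq> 0"
      by (metis norm_zero not_one_le_zero)
    then have "matching_val E X z \<noteq> 0"
      using green_rec[OF less.prems that IH(1)] IH(1) by (metis mult_eq_0_iff)
    then show ?thesis
      using * inverse_green[OF less.prems that IH(1)] by simp
  qed
  have nz: "matching_val E X z \<noteq> 0"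
    using step by (cases "X = {}") auto
  have "norm (green E X {u} z) \<le> 1" if "u \<in> X" for u
    using step[OF that] by (simp add: norm_inverse) (metis inverse_le_1_iff inverse_inverse_eq norm_ge_zero one_le_inverse_iff le_less)
  then show ?case using nz by blast
qed

definition paths :: "nat set \<Rightarrow> nat \<Rightarrow> nat list set" where
  "paths X u = path_tree_verts (X, E) u"

lemma paths_iff: "p \<in> paths X u \<longleftrightarrow> p \<noteq> [] \<and> hd p = u \<and> distinct p \<and> set p \<subseteq> X \<and>
    successively E p"
  by (auto simp: paths_def path_tree_verts_def verts_def adj_def successively_conv_nth)

lemma finite_paths [simp, intro]: "finite X \<Longrightarrow> finite (paths X u)"
  by (rule finite_subset[OF _ finite_subset_distinct[of X]]) (auto simp: paths_iff)

lemma hd_path: "p \<in> paths X u \<Longrightarrow> hd p = u"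
  and set_path_subset: "p \<in> paths X u \<Longrightarrow> set p \<subseteq> X"
  and path_nonempty: "p \<in> paths X u \<Longrightarrow> p \<noteq> []"
  by (auto simp: paths_iff)

lemma start_in_path: "p \<in> paths X u \<Longrightarrow> u \<in> set p"
  using hd_in_set hd_path path_nonempty by metis

lemma singleton_path: "u \<in> X \<Longrightarrow> [u] \<in> paths X u"
  by (simp add: paths_iff)

lemma paths_Cons:
  assumes "u \<in> X"
  shows "paths X u = insert [u] (\<Union>v\<in>{v\<in>X - {u}. E u v}. (#) u ` paths (X - {u}) v)"
proof -
  have "p \<in> paths X u \<longleftrightarrow> p = [u] \<or> (\<exists>v\<in>{v\<in>X - {u}. E u v}. p \<in> (#) u ` paths (X - {u}) v)" for p
  proof (cases p)
    case (Cons x q)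
    then show ?thesis
      using assms by (cases q) (auto simp: paths_iff image_iff)
  qed (auto simp: paths_iff)
  then show ?thesis by blast
qed

lemma sum_paths:
  assumes "finite X" "u \<in> X"
  shows "(\<Sum>p\<in>paths X u. g p) = g [u] +
    (\<Sum>v\<in>{v\<in>X - {u}. E u v}. \<Sum>q\<in>paths (X - {u}) v. g (u # q))"
proof -
  let ?N = "{v\<in>X - {u}. E u v}"
  have "(\<Sum>p\<in>(\<Union>v\<in>?N. (#) u ` paths (X - {u}) v). g p) = (\<Sum>v\<in>?N. \<Sum>p\<in>(#) u ` paths (X - {u}) v. g p)"
    using assms by (intro sum.UNION_disjoint) (auto dest: hd_path)
  also have "\<dots> = (\<Sum>v\<in>?N. \<Sum>q\<in>paths (X - {u}) v. g (u # q))"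
    by (intro sum.cong[OF refl]) (simp add: sum.reindex)
  finally have "(\<Sum>p\<in>(\<Union>v\<in>?N. (#) u ` paths (X - {u}) v). g p) = \<dots>" .
  moreover have "[u] \<notin> (\<Union>v\<in>?N. (#) u ` paths (X - {u}) v)"
    by (auto simp: paths_iff)
  moreover have "finite (\<Union>v\<in>?N. (#) u ` paths (X - {u}) v)"
    by (intro finite_UN_I finite_nbrs_in finite_imageI finite_paths) (use assms in auto)
  ultimately show ?thesis
    unfolding paths_Cons[OF assms(2)] by (subst sum.insert) auto
qed

lemma green_Cons:
  assumes "finite X" "Im z > 0"
  shows "green E X {u} z * green E (X - {u}) L z = green E X (insert u L) z"
  using green_mult[of X "{u}" z L] assms by (simp add: matching_val_nonzero)

text \<open>The Ward identity for the root column of the resolvent of the path tree. With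
  \<open>g_v\<close> the Green functions of \<open>X - {u}\<close>, the induction step is |g|^2 (1 +
  sum_v (- Im g_v) / Im z) = |g|^2 Im (1 / g) / Im z.\<close>

lemma sum_paths_norm_green:
  assumes "finite X" "u \<in> X" "Im z > 0"
  shows "(\<Sum>p\<in>paths X u. (norm (green E X (set p) z))\<^sup>2) = - Im (green E X {u} z) / Im z"
  using assms(1,2)
proof (induction "card X" arbitrary: X u rule: less_induct)
  case less
  let ?N = "{v\<in>X - {u}. E u v}"
  let ?g = "green E X {u} z"
  have IH: "(\<Sum>p\<in>paths (X - {u}) v. (norm (green E (X - {u}) (set p) z))\<^sup>2) = - Im (green E (X - {u}) {v} z) / Im z"
    if "v \<in> ?N" for v
    using less that by (intro less.hyps card_Diff1_less) auto
  define g where "g = ?g"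
  have ins: "green E X (insert u L) z = g * green E (X - {u}) L z" for L
    unfolding g_def using less.prems assms(3) by (simp add: green_Cons)
  have "(\<Sum>p\<in>paths X u. (norm (green E X (set p) z))\<^sup>2) =
     (norm g)\<^sup>2 + (\<Sum>v\<in>?N. \<Sum>q\<in>paths (X - {u}) v. (norm (green E X (insert u (set q)) z))\<^sup>2)"
    unfolding g_def using less.prems by (subst sum_paths) simp_all
  also have "(\<Sum>v\<in>?N. \<Sum>q\<in>paths (X - {u}) v. (norm (green E X (insert u (set q)) z))\<^sup>2) =
     (\<Sum>v\<in>?N. (norm g)\<^sup>2 * (\<Sum>q\<in>paths (X - {u}) v. (norm (green E (X - {u}) (set q) z))\<^sup>2))"
    unfolding ins norm_mult power_mult_distrib sum_distrib_left ..
  also have "\<dots> = (\<Sum>v\<in>?N. (norm g)\<^sup>2 * (- Im (green E (X - {u}) {v} z) / Im z))"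
    by (intro sum.cong refl arg_cong2[where f = "(*)"] IH)
  finally have "(\<Sum>p\<in>paths X u. (norm (green E X (set p) z))\<^sup>2) =
     (norm ?g)\<^sup>2 + (\<Sum>v\<in>?N. (norm ?g)\<^sup>2 * (- Im (green E (X - {u}) {v} z) / Im z))"
    unfolding g_def .
  also have "\<dots> = (norm ?g)\<^sup>2 * (Im (z - (\<Sum>v\<in>?N. green E (X - {u}) {v} z)) / Im z)"
    using assms(3) by (simp add: field_simps sum_negf sum_distrib_left sum_divide_distrib)
  also have "z - (\<Sum>v\<in>?N. green E (X - {u}) {v} z) = inverse ?g"
    using inverse_green[of X u z] less.prems assms(3) by (simp add: matching_val_nonzero)
  also have "Im (inverse ?g) = - Im ?g / (norm ?g)\<^sup>2"
    by (simp add: cmod_power2)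
  finally show ?case
    using Im_green_neg[OF less.prems(1) assms(3) less.prems(2)] by auto
qed

text \<open>The resolvent identity on the common part of the path trees of two induced subgraphs.\<close>

lemma green_diff:
  assumes "finite X" "finite Y" "w \<in> X" "w \<in> Y" "Im z1 > 0" "Im z2 > 0"
  shows "green E X {w} z1 - green E Y {w} z2 =
    (\<Sum>p\<in>paths (X \<inter> Y) w. (z2 - z1) * (green E X (set p) z1 * green E Y (set p) z2)
      + (\<Sum>v\<in>{v\<in>X - Y. E (last p) v}. green E X (insert v (set p)) z1 * green E Y (set p) z2)
      - (\<Sum>v\<in>{v\<in>Y - X. E (last p) v}. green E X (set p) z1 * green E Y (insert v (set p)) z2))"
  using assms(1-4)
proof (induction "card X" arbitrary: X Y w rule: less_induct)
  case less
  let ?x = "green E X {w} z1" and ?y = "green E Y {w} z2"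
  let ?X = "X - {w}" and ?Y = "Y - {w}"
  define F where "F X Y p = (z2 - z1) * (green E X (set p) z1 * green E Y (set p) z2)
      + (\<Sum>v\<in>{v\<in>X - Y. E (last p) v}. green E X (insert v (set p)) z1 * green E Y (set p) z2)
      - (\<Sum>v\<in>{v\<in>Y - X. E (last p) v}. green E X (set p) z1 * green E Y (insert v (set p)) z2)" for X Y p
  have IH: "green E ?X {v} z1 - green E ?Y {v} z2 = (\<Sum>p\<in>paths (?X \<inter> ?Y) v. F ?X ?Y p)"
    if "v \<in> ?X \<inter> ?Y" for v
    unfolding F_def using less that by (intro less.hyps card_Diff1_less) auto
  have fin: "finite X" "finite Y" and w: "w \<in> X" "w \<in> Y" using less.prems by auto
  have nz: "?x \<noteq> 0" "?y \<noteq> 0"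
    using Im_green_neg[OF fin(1) assms(5) w(1)] Im_green_neg[OF fin(2) assms(6) w(2)] by auto
  define x y where "x = ?x" and "y = ?y"
  have green_insert: "green E X (insert w L) z1 = x * green E ?X L z1"
      "green E Y (insert w L) z2 = y * green E ?Y L z2" for L
    unfolding x_def y_def using fin assms(5,6) by (simp_all add: green_Cons)
  have green_empties: "green E ?X {} z1 = 1" "green E ?Y {} z2 = 1"
    using fin assms(5,6) by (simp_all add: matching_val_nonzero)
  have comm: "insert v (insert w L) = insert w (insert v L)" for v L
    by auto
  have F_Cons: "F X Y (w # q) = ?x * ?y * F ?X ?Y q" if "q \<noteq> []" for q
  proof -
    have d: "X - Y = ?X - ?Y" "Y - X = ?Y - ?X" using w by auto
    show ?thesis
      using that unfolding F_def d x_def[symmetric] y_def[symmetric] list.set comm green_insert green_empties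
      by (simp add: algebra_simps sum_distrib_left)
  qed
  have F_single: "F X Y [w] = ?x * ?y * ((z2 - z1) + (\<Sum>v\<in>{v\<in>?X - ?Y. E w v}. green E ?X {v} z1)
       - (\<Sum>v\<in>{v\<in>?Y - ?X. E w v}. green E ?Y {v} z2))"
  proof -
    have d: "X - Y = ?X - ?Y" "Y - X = ?Y - ?X" using w by auto
    show ?thesis
      unfolding F_def d x_def[symmetric] y_def[symmetric] list.set comm green_insert green_empties
      by (simp add: algebra_simps sum_distrib_left)
  qed
  \<comment> \<open>In the difference of the two recursions the common neighbours give differences
    to which the induction hypothesis applies; neighbours in only one graph give the boundary terms
    at the path \<open>[w]\<close>.\<close>
  have "?x - ?y = ?x * ?y * (inverse ?y - inverse ?x)"
    using nz by (simp add: field_simps)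
  also have "inverse ?y - inverse ?x = (z2 - z1) + (\<Sum>v\<in>{v\<in>?X. E w v}. green E ?X {v} z1)
       - (\<Sum>v\<in>{v\<in>?Y. E w v}. green E ?Y {v} z2)"
    using inverse_green[OF fin(1) w(1)] inverse_green[OF fin(2) w(2)] fin assms(5,6)
    by (simp add: matching_val_nonzero)
  also have "(\<Sum>v\<in>{v\<in>?X. E w v}. green E ?X {v} z1) =
     (\<Sum>v\<in>{v\<in>?X - ?Y. E w v}. green E ?X {v} z1) + (\<Sum>v\<in>{v\<in>?X \<inter> ?Y. E w v}. green E ?X {v} z1)"
    by (subst sum.union_disjoint[symmetric]) (auto simp: fin intro!: sum.cong)
  also have "(\<Sum>v\<in>{v\<in>?Y. E w v}. green E ?Y {v} z2) =
     (\<Sum>v\<in>{v\<in>?Y - ?X. E w v}. green E ?Y {v} z2) + (\<Sum>v\<in>{v\<in>?X \<inter> ?Y. E w v}. green E ?Y {v} z2)"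
    by (subst sum.union_disjoint[symmetric]) (auto simp: fin intro!: sum.cong)
  finally have "?x - ?y = F X Y [w] + ?x * ?y * (\<Sum>v\<in>{v\<in>?X \<inter> ?Y. E w v}. green E ?X {v} z1 - green E ?Y {v} z2)"
    unfolding F_single sum_subtractf by (simp add: algebra_simps)
  also have "(\<Sum>v\<in>{v\<in>?X \<inter> ?Y. E w v}. green E ?X {v} z1 - green E ?Y {v} z2) =
     (\<Sum>v\<in>{v\<in>?X \<inter> ?Y. E w v}. \<Sum>q\<in>paths (?X \<inter> ?Y) v. F ?X ?Y q)"
    by (intro sum.cong refl IH) auto
  also have "?x * ?y * \<dots> = (\<Sum>v\<in>{v\<in>?X \<inter> ?Y. E w v}. \<Sum>q\<in>paths (?X \<inter> ?Y) v. F X Y (w # q))"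
    unfolding sum_distrib_left by (intro sum.cong refl F_Cons[symmetric] path_nonempty)
  also have "?X \<inter> ?Y = (X \<inter> Y) - {w}" by auto
  also have "F X Y [w] + (\<Sum>v\<in>{v\<in>(X \<inter> Y) - {w}. E w v}. \<Sum>q\<in>paths ((X \<inter> Y) - {w}) v. F X Y (w # q)) =
    (\<Sum>p\<in>paths (X \<inter> Y) w. F X Y p)"
    using fin w by (subst sum_paths) auto
  finally show ?case unfolding F_def .
qed

end

section \<open>Heilmann--Lieb inequalities\<close>

text \<open>By \<open>sum_paths_norm_green\<close>, the l2 norm of the root column of the resolvent
  of the path tree at \<open>v\<close>.\<close>

definition green_norm :: "(nat \<Rightarrow> nat \<Rightarrow> bool) \<Rightarrow> nat set \<Rightarrow> nat \<Rightarrow> complex \<Rightarrow> real" where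
  "green_norm E X v z = sqrt (- Im (green E X {v} z) / Im z)"

context bounded_graph
begin

lemma green_norm_nonneg: "finite X \<Longrightarrow> v \<in> X \<Longrightarrow> Im z > 0 \<Longrightarrow> green_norm E X v z \<ge> 0"
  unfolding green_norm_def using Im_green_neg[of X z v] by (simp add: divide_nonpos_pos)

lemma sum_sub_paths_le:
  assumes "finite X" "v \<in> X" "Im z > 0" "P \<subseteq> paths X v"
  shows "sqrt (\<Sum>p\<in>P. (norm (green E X (set p) z))\<^sup>2) \<le> green_norm E X v z"
  unfolding green_norm_def sum_paths_norm_green[OF assms(1-3), symmetric]
  using assms by (intro real_sqrt_le_mono sum_mono2) auto

lemma rev_path:
  assumes "p \<in> paths Z w" "E (last p) v" "v \<in> X - Z" "Z \<subseteq> X"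
  shows "v # rev p \<in> paths X v" "last (v # rev p) = w"
proof -
  have e: "(\<lambda>x y. E y x) = E" using sym by (intro ext) blast
  have "successively E (rev p)"
    unfolding successively_rev e using assms(1) by (simp add: paths_iff)
  then show "v # rev p \<in> paths X v"
    using assms by (auto simp: paths_iff successively_Cons hd_rev sym)
  show "last (v # rev p) = w"
    using assms(1) by (auto simp: paths_iff last_rev)
qed

text \<open>A path from \<open>w\<close> that can be prolonged to \<open>v\<close> becomes, read
  backwards, a path from \<open>v\<close> with the same vertex set. Keeping track of its end
  \<open>w\<close> makes the families for different \<open>w\<close> disjoint, so that the bounds
  can be added up in \<open>Heilmann_Lieb_le\<close>.\<close>

lemma sum_rev_paths_le:
  assumes "finite X" "v \<in> X - Z" "Z \<subseteq> X"
  shows "(\<Sum>p\<in>{p\<in>paths Z w. E (last p) v}. (norm (green E X (insert v (set p)) z))\<^sup>2) \<le>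
    (\<Sum>q\<in>{q\<in>paths X v. last q = w}. (norm (green E X (set q) z))\<^sup>2)"
proof -
  let ?P = "{p\<in>paths Z w. E (last p) v}"
  have "(\<Sum>p\<in>?P. (norm (green E X (insert v (set p)) z))\<^sup>2) =
      (\<Sum>q\<in>(\<lambda>p. v # rev p) ` ?P. (norm (green E X (set q) z))\<^sup>2)"
    by (subst sum.reindex) (auto simp: inj_on_def)
  also have "\<dots> \<le> (\<Sum>q\<in>{q\<in>paths X v. last q = w}. (norm (green E X (set q) z))\<^sup>2)"
    using assms rev_path[of _ Z w v X] by (intro sum_mono2) (auto simp del: last.simps)
  finally show ?thesis .
qed

lemma sqrt_sum_rev_paths_le:
  assumes "finite X" "v \<in> X - Z" "Z \<subseteq> X" "Im z > 0"
  shows "sqrt (\<Sum>p\<in>{p\<in>paths Z w. E (last p) v}. (norm (green E X (insert v (set p)) z))\<^sup>2)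
    \<le> green_norm E X v z"
  using sum_sub_paths_le[of X v z "{q\<in>paths X v. last q = w}"] assms
  by (intro order.trans[OF real_sqrt_le_mono[OF sum_rev_paths_le]]) auto

lemma green_diff':
  assumes "finite X" "finite Y" "w \<in> X" "w \<in> Y" "Im z1 > 0" "Im z2 > 0"
  shows "green E X {w} z1 - green E Y {w} z2 =
    (z2 - z1) * (\<Sum>p\<in>paths (X \<inter> Y) w. green E X (set p) z1 * green E Y (set p) z2)
    + (\<Sum>v\<in>X - Y. \<Sum>p\<in>{p\<in>paths (X \<inter> Y) w. E (last p) v}. green E X (insert v (set p)) z1 * green E Y (set p) z2)
    - (\<Sum>v\<in>Y - X. \<Sum>p\<in>{p\<in>paths (X \<inter> Y) w. E (last p) v}. green E X (set p) z1 * green E Y (insert v (set p)) z2)"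
  unfolding green_diff[OF assms] sum.distrib sum_subtractf sum_distrib_left
  by (intro arg_cong2[where f = "(+)"] arg_cong2[where f = "(-)"] refl sum.swap_restrict)
     (use assms in auto)

lemma sub_green_diff:
  assumes "finite X" "Y \<subseteq> X" "w \<in> Y" "Im z1 > 0" "Im z2 > 0"
  shows "green E X {w} z1 - green E Y {w} z2 =
    (z2 - z1) * (\<Sum>p\<in>paths Y w. green E X (set p) z1 * green E Y (set p) z2)
    + (\<Sum>v\<in>X - Y. \<Sum>p\<in>{p\<in>paths Y w. E (last p) v}. green E X (insert v (set p)) z1 * green E Y (set p) z2)"
proof -
  have "X \<inter> Y = Y" "Y - X = {}" using assms by auto
  then show ?thesis
    using green_diff'[of X Y w z1 z2] assms finite_subset[OF assms(2,1)]
    by (simp only: \<open>X \<inter> Y = Y\<close> \<open>Y - X = {}\<close>) auto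
qed

text \<open>Cauchy--Schwarz on each path sum of \<open>sub_green_diff\<close>, with the paths into a
  deleted vertex \<open>v\<close> read backwards. The two spectral parameters are kept apart so that
  they can later tend to \<open>\<theta>\<close> one after the other.\<close>

lemma norm_green_diff_le:
  assumes "finite X" "Y \<subseteq> X" "w \<in> Y" "Im z1 > 0" "Im z2 > 0"
  shows "norm (green E X {w} z1 - green E Y {w} z2) \<le>
    norm (z2 - z1) * (green_norm E X w z1 * green_norm E Y w z2)
    + (\<Sum>v\<in>X - Y. green_norm E X v z1 * green_norm E Y w z2)"
proof -
  have Y: "finite Y" using assms finite_subset by auto
  have sub: "paths Y w \<subseteq> paths X w" using assms(2) by (intro subsetI) (auto simp only: paths_iff intro: subset_trans)
  have "norm (\<Sum>p\<in>paths Y w. green E X (set p) z1 * green E Y (set p) z2) \<le>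
     green_norm E X w z1 * green_norm E Y w z2"
    using assms Y sub
    by (intro order.trans[OF sqrt_sum_Cauchy_Schwarz] mult_mono sum_sub_paths_le green_norm_nonneg)
       (auto intro: sum_nonneg)
  moreover have "norm (\<Sum>p\<in>{p\<in>paths Y w. E (last p) v}. green E X (insert v (set p)) z1 * green E Y (set p) z2) \<le>
      green_norm E X v z1 * green_norm E Y w z2" if "v \<in> X - Y" for v
    using assms Y that
    by (intro order.trans[OF sqrt_sum_Cauchy_Schwarz] mult_mono sum_sub_paths_le green_norm_nonneg
        sqrt_sum_rev_paths_le) (auto intro: sum_nonneg)
  ultimately show ?thesis
    unfolding sub_green_diff[OF assms]
    by (intro order.trans[OF norm_triangle_ineq] add_mono sum_norm_le) (auto simp: norm_mult intro: mult_left_mono)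
qed

text \<open>A quantitative form of the Heilmann--Lieb identity
  \<open>\<mu>(G-u) \<mu>(G-v) - \<mu>(G) \<mu>(G-u-v) = \<Sum>P. \<mu>(G-P)\<^sup>2\<close>, the sum being over the paths from u to v.\<close>

lemma Heilmann_Lieb_le:
  assumes "finite X" "u \<in> X" "F \<subseteq> X - {u}" "Im z > 0"
  shows "(norm (green E X {u} z))\<^sup>2 + (\<Sum>w\<in>F. norm (green E X {u} z) * norm (green E X {w} z - green E (X - {u}) {w} z))
    \<le> - Im (green E X {u} z) / Im z"
proof -
  let ?g = "\<lambda>q. (norm (green E X (set q) z))\<^sup>2"
  have F: "finite F" using assms finite_subset by blast
  have single: "norm (green E X {u} z) * norm (green E X {w} z - green E (X - {u}) {w} z) \<le>
     (\<Sum>q\<in>{q\<in>paths X u. last q = w}. ?g q)" if "w \<in> F" for w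
  proof -
    let ?P = "{p\<in>paths (X - {u}) w. E (last p) u}"
    have XX: "X - (X - {u}) = {u}" using assms by auto
    have "green E X {u} z * (green E X {w} z - green E (X - {u}) {w} z) =
       (\<Sum>p\<in>?P. green E X (insert u (set p)) z * (green E X {u} z * green E (X - {u}) (set p) z))"
      using assms that by (subst sub_green_diff) (auto simp: XX sum_distrib_left mult_ac)
    also have "\<dots> = (\<Sum>p\<in>?P. (green E X (insert u (set p)) z)\<^sup>2)"
      by (simp only: green_Cons[OF assms(1,4), of u "set _"] power2_eq_square)
    finally have "norm (green E X {u} z) * norm (green E X {w} z - green E (X - {u}) {w} z) =
        norm (\<Sum>p\<in>?P. (green E X (insert u (set p)) z)\<^sup>2)"
      by (simp flip: norm_mult)
    also have "\<dots> \<le> (\<Sum>p\<in>?P. (norm (green E X (insert u (set p)) z))\<^sup>2)"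
      by (intro sum_norm_le) (simp add: norm_power)
    also have "\<dots> \<le> (\<Sum>q\<in>{q\<in>paths X u. last q = w}. ?g q)"
      using assms by (intro sum_rev_paths_le) auto
    finally show ?thesis .
  qed
  have "(norm (green E X {u} z))\<^sup>2 + (\<Sum>w\<in>F. norm (green E X {u} z) * norm (green E X {w} z - green E (X - {u}) {w} z))
     \<le> ?g [u] + (\<Sum>w\<in>F. \<Sum>q\<in>{q\<in>paths X u. last q = w}. ?g q)"
    by (intro add_mono sum_mono single) auto
  \<comment> \<open>Paths with different ends are different, and \<open>[u]\<close> ends outside
    \<open>F\<close>, so all these terms occur in the single sum evaluated by
    \<open>sum_paths_norm_green\<close>.\<close>
  also have "(\<Sum>w\<in>F. \<Sum>q\<in>{q\<in>paths X u. last q = w}. ?g q) = (\<Sum>q\<in>(\<Union>w\<in>F. {q\<in>paths X u. last q = w}). ?g q)"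
    using F assms by (subst sum.UNION_disjoint) auto
  also have "?g [u] + \<dots> = (\<Sum>q\<in>insert [u] (\<Union>w\<in>F. {q\<in>paths X u. last q = w}). ?g q)"
    using F assms by (subst sum.insert) auto
  also have "\<dots> \<le> (\<Sum>q\<in>paths X u. ?g q)"
    using assms singleton_path[of u X] by (intro sum_mono2) auto
  finally show ?thesis
    using sum_paths_norm_green[OF assms(1,2,4)] by simp
qed

text \<open>The graphs without \<open>u\<close> and without \<open>v\<close> share the paths that
  avoid both, so by \<open>green_diff'\<close> they differ only by paths reaching \<open>v\<close>
  or reaching \<open>u\<close>. The point is the right side: near \<open>\<theta>\<close> it is
  negligible when deleting either of \<open>u\<close>, \<open>v\<close> destroys the atom at the
  other.\<close>

lemma norm_green_three_le:
  assumes X: "finite X" and uvw: "u \<in> X" "v \<in> X" "w \<in> X" "u \<noteq> v" "u \<noteq> w" "v \<noteq> w" and z: "Im z > 0"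
  shows "norm (green E X {u} z) * norm (green E X {v} z) * norm (green E (X - {u}) {w} z - green E (X - {v}) {w} z) \<le>
    norm (green E X {u} z) * (green_norm E (X - {u}) v z * green_norm E X v z) +
    norm (green E X {v} z) * (green_norm E (X - {v}) u z * green_norm E X u z)"
proof -
  let ?Z = "X - {u, v}"
  let ?u = "green E X {u} z" and ?v = "green E X {v} z"
  have e: "(X - {u}) \<inter> (X - {v}) = ?Z" "(X - {u}) - (X - {v}) = {v}" "(X - {v}) - (X - {u}) = {u}"
    using uvw by auto
  define S where "S a b = (\<Sum>p\<in>{p\<in>paths ?Z w. E (last p) b}. green E (X - {a}) (insert b (set p)) z * green E X (insert b (set p)) z)" for a b
  have S: "norm (S a b) \<le> green_norm E (X - {a}) b z * green_norm E X b z"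
    if "(a, b) = (u, v) \<or> (a, b) = (v, u)" for a b
    unfolding S_def using that uvw X z
    by (intro order.trans[OF sqrt_sum_Cauchy_Schwarz] mult_mono sqrt_sum_rev_paths_le green_norm_nonneg)
       (auto intro: sum_nonneg)
  define S' where "S' a b = (\<Sum>p\<in>{p\<in>paths ?Z w. E (last p) b}. green E (X - {a}) (insert b (set p)) z * green E (X - {b}) (set p) z)" for a b
  \<comment> \<open>Multiplying by the Green function at \<open>b\<close> turns a path in
    \<open>X - {b}\<close> into a path through \<open>b\<close> in \<open>X\<close>, whose sum is
    controlled by the Green norm at \<open>b\<close>. This is why the estimate carries both Green
    functions as factors.\<close>
  have S': "S a b = green E X {b} z * S' a b" for a b
  proof -
    have "green E X (insert b (set p)) z = green E X {b} z * green E (X - {b}) (set p) z" for p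
      by (rule green_Cons[OF X z, symmetric])
    then show ?thesis
      unfolding S_def S'_def sum_distrib_left by (intro sum.cong refl) (simp only: mult_ac)
  qed
  have "green E (X - {u}) {w} z - green E (X - {v}) {w} z = S' u v - S' v u"
    using X z uvw by (subst green_diff') (auto simp: e S'_def mult.commute)
  then have "?u * ?v * (green E (X - {u}) {w} z - green E (X - {v}) {w} z) = ?u * S u v - ?v * S v u"
    unfolding S' by (simp only: right_diff_distrib left_diff_distrib mult_ac)
  then have "norm ?u * norm ?v * norm (green E (X - {u}) {w} z - green E (X - {v}) {w} z) =
      norm (?u * S u v - ?v * S v u)"
    by (simp flip: norm_mult)
  also have "\<dots> \<le> norm ?u * norm (S u v) + norm ?v * norm (S v u)"
    by (metis norm_mult norm_triangle_ineq4)
  also have "\<dots> \<le> norm ?u * (green_norm E (X - {u}) v z * green_norm E X v z) +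
    norm ?v * (green_norm E (X - {v}) u z * green_norm E X u z)"
    by (intro add_mono mult_left_mono S) auto
  finally show ?thesis .
qed

end

section \<open>Partial fractions of real-rooted quotients\<close>

abbreviation cpoly :: "real poly \<Rightarrow> complex poly" where
  "cpoly p \<equiv> map_poly complex_of_real p"

lemma cpoly_add: "cpoly (p + q) = cpoly p + cpoly q"
  by (rule poly_eqI) (simp add: coeff_map_poly)

lemma cpoly_smult: "cpoly (smult a p) = smult (of_real a) (cpoly p)"
  by (rule poly_eqI) (simp add: coeff_map_poly)

lemma cpoly_pCons: "cpoly (pCons a p) = pCons (of_real a) (cpoly p)"
  by (simp add: map_poly_pCons)

lemma cpoly_mult: "cpoly (p * q) = cpoly p * cpoly q"
  by (induction p) (simp_all add: cpoly_add cpoly_smult cpoly_pCons)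

lemma cpoly_linear: "poly (cpoly [:- y, 1:]) z = z - of_real y"
  by (simp add: cpoly_pCons)

lemma poly_cpoly_of_real: "poly (cpoly p) (of_real x) = of_real (poly p x)"
  by (induction p) (simp_all add: cpoly_pCons)

lemma degree_cpoly [simp]: "degree (cpoly p) = degree p"
  by (rule degree_map_poly) simp

lemma real_rooted_has_root:
  assumes "degree q > 0" "\<And>z. poly (cpoly q) z = 0 \<Longrightarrow> Im z = 0"
  shows "\<exists>y. poly q y = 0"
proof -
  have "\<not> constant (poly (cpoly q))"
    using assms(1) by (simp add: constant_degree)
  then obtain z where z: "poly (cpoly q) z = 0"
    using fundamental_theorem_of_algebra by blast
  then have "z = of_real (Re z)"
    using assms(2) by (simp add: complex_eq_iff)
  then have "poly q (Re z) = 0"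
    using z by (metis of_real_eq_0_iff poly_cpoly_of_real)
  then show ?thesis ..
qed

text \<open>The growth condition says that all poles of the quotient are simple.\<close>

lemma partial_fractions_real_rooted:
  fixes p q :: "real poly"
  assumes "q \<noteq> 0" "p = 0 \<or> degree p < degree q"
    and "\<And>z. poly (cpoly q) z = 0 \<Longrightarrow> Im z = 0"
    and "\<And>y. poly q y = 0 \<Longrightarrow> \<exists>C. \<forall>t. 0 < t \<and> t \<le> 1 \<longrightarrow>
      norm (poly (cpoly p) (Complex y t)) * t \<le> C * norm (poly (cpoly q) (Complex y t))"
  shows "\<exists>Y r. finite Y \<and> (\<forall>y\<in>Y. poly q y = 0) \<and>
    (\<forall>z. poly (cpoly q) z \<noteq> 0 \<longrightarrow> poly (cpoly p) z / poly (cpoly q) z = (\<Sum>y\<in>Y. of_real (r y) / (z - of_real y)))"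
  using assms
proof (induction "degree q" arbitrary: p q rule: less_induct)
  case less
  show ?case
  proof (cases "p = 0")
    case True
    then show ?thesis by (intro exI[of _ "{}"]) auto
  next
    case False
    then have "degree q > 0" using less.prems(2) by simp
    then obtain y where y: "poly q y = 0" using real_rooted_has_root less.prems(3) by blast
    then obtain q1 where q1: "q = [:- y, 1:] * q1" by (metis dvdE poly_eq_0_iff_dvd)
    have q1nz: "q1 \<noteq> 0" using less.prems(1) q1 by auto
    have deg: "degree q = Suc (degree q1)" using q1nz unfolding q1 by (subst degree_mult_eq) auto
    have evq: "poly (cpoly q) z = (z - of_real y) * poly (cpoly q1) z" for z
      unfolding q1 cpoly_mult poly_mult cpoly_linear ..
    have roots1: "Im z = 0" if "poly (cpoly q1) z = 0" for z
      using less.prems(3) that evq by simp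
    have root1: "poly q y' = 0" if "poly q1 y' = 0" for y'
      unfolding q1 using that by simp
    show ?thesis
    proof (cases "poly p y = 0")
      case True
      then obtain p1 where p1: "p = [:- y, 1:] * p1" by (metis dvdE poly_eq_0_iff_dvd)
      have p1nz: "p1 \<noteq> 0" using False p1 by auto
      have degp: "degree p = Suc (degree p1)" using p1nz unfolding p1 by (subst degree_mult_eq) auto
      have evp: "poly (cpoly p) z = (z - of_real y) * poly (cpoly p1) z" for z
        unfolding p1 cpoly_mult poly_mult cpoly_linear ..
      have "\<exists>Y r. finite Y \<and> (\<forall>y\<in>Y. poly q1 y = 0) \<and>
        (\<forall>z. poly (cpoly q1) z \<noteq> 0 \<longrightarrow> poly (cpoly p1) z / poly (cpoly q1) z = (\<Sum>y\<in>Y. of_real (r y) / (z - of_real y)))"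
      proof (rule less.hyps)
        show "degree q1 < degree q" "q1 \<noteq> 0" "p1 = 0 \<or> degree p1 < degree q1"
          using deg degp q1nz less.prems(2) False by auto
        show "Im z = 0" if "poly (cpoly q1) z = 0" for z using roots1[OF that] .
        fix y' assume "poly q1 y' = 0"
        then obtain C where C: "\<And>t. 0 < t \<and> t \<le> 1 \<Longrightarrow>
            norm (poly (cpoly p) (Complex y' t)) * t \<le> C * norm (poly (cpoly q) (Complex y' t))"
          using less.prems(4)[OF root1] by blast
        have "norm (poly (cpoly p1) (Complex y' t)) * t \<le> C * norm (poly (cpoly q1) (Complex y' t))"
          if "0 < t \<and> t \<le> 1" for t
        proof -
          have "norm (Complex y' t - of_real y) > 0" using that by (simp add: complex_eq_iff)
          moreover have "norm (Complex y' t - of_real y) * (norm (poly (cpoly p1) (Complex y' t)) * t)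
            \<le> norm (Complex y' t - of_real y) * (C * norm (poly (cpoly q1) (Complex y' t)))"
            using C[OF that] unfolding evp evq norm_mult by (simp only: mult_ac)
          ultimately show ?thesis by (simp only: mult_le_cancel_left_pos)
        qed
        then show "\<exists>C. \<forall>t. 0 < t \<and> t \<le> 1 \<longrightarrow>
            norm (poly (cpoly p1) (Complex y' t)) * t \<le> C * norm (poly (cpoly q1) (Complex y' t))" by blast
      qed
      then obtain Y r where Y: "finite Y" "\<forall>y\<in>Y. poly q1 y = 0"
        "\<And>z. poly (cpoly q1) z \<noteq> 0 \<Longrightarrow> poly (cpoly p1) z / poly (cpoly q1) z = (\<Sum>y\<in>Y. of_real (r y) / (z - of_real y))"
        by blast
      have "poly (cpoly p) z / poly (cpoly q) z = (\<Sum>y\<in>Y. of_real (r y) / (z - of_real y))"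
        if "poly (cpoly q) z \<noteq> 0" for z
        using that Y(3)[of z] unfolding evp evq by auto
      then show ?thesis using Y(1,2) root1 by blast
    next
      case py: False
      \<comment> \<open>A double root of \<open>q\<close> at \<open>y\<close> would contradict the
        growth condition: one factor of size \<open>t\<close> cancels, and
        \<open>t \<rightarrow> 0\<close> then forces \<open>p\<close> to vanish at
        \<open>y\<close>.\<close>
      have q1y: "poly q1 y \<noteq> 0"
      proof
        assume 0: "poly q1 y = 0"
        then obtain C where C: "\<And>t. 0 < t \<and> t \<le> 1 \<Longrightarrow>
            norm (poly (cpoly p) (Complex y t)) * t \<le> C * norm (poly (cpoly q) (Complex y t))"
          using less.prems(4)[OF y] by blast
        have ev: "norm (poly (cpoly p) (Complex y t)) \<le> C * norm (poly (cpoly q1) (Complex y t))"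
          if "0 < t \<and> t \<le> 1" for t
        proof -
          have "norm (Complex y t - of_real y) = t" using that by (simp add: cmod_def)
          then have "norm (poly (cpoly p) (Complex y t)) * t \<le> (C * norm (poly (cpoly q1) (Complex y t))) * t"
            using C[OF that] unfolding evq norm_mult by (simp only: mult_ac)
          then show ?thesis using that by (simp only: mult_le_cancel_right_pos)
        qed
        have lim: "((\<lambda>t. norm (poly (cpoly f) (Complex y t))) \<longlongrightarrow> norm (poly (cpoly f) (Complex y 0))) (at_right 0)" for f
          by (intro tendsto_norm tendsto_poly tendsto_Complex tendsto_const tendsto_ident_at)
        have "norm (poly (cpoly p) (Complex y 0)) \<le> C * norm (poly (cpoly q1) (Complex y 0))"
        proof (rule tendsto_le[OF _ tendsto_mult_left[OF lim] lim])
          show "\<forall>\<^sub>F t in at_right 0. norm (poly (cpoly p) (Complex y t)) \<le> C * norm (poly (cpoly q1) (Complex y t))"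
            using eventually_at_right_real[OF zero_less_one] by eventually_elim (auto intro: ev)
        qed simp
        then show False
          using py 0 poly_cpoly_of_real[of p y] poly_cpoly_of_real[of q1 y]
          by (simp add: complex_of_real_def cmod_def)
      qed
      \<comment> \<open>\<open>c\<close> is the residue at \<open>y\<close>; subtracting
        \<open>c\<close> times \<open>q1\<close> makes the numerator divisible by the linear
        factor.\<close>
      define c where "c = poly p y / poly q1 y"
      have "poly (p - smult c q1) y = 0" using q1y by (simp add: c_def)
      then obtain p1 where p1: "p - smult c q1 = [:- y, 1:] * p1" by (metis dvdE poly_eq_0_iff_dvd)
      have pe: "p = [:- y, 1:] * p1 + smult c q1" using p1 by (simp add: algebra_simps)
      have evp: "poly (cpoly p) z = (z - of_real y) * poly (cpoly p1) z + of_real c * poly (cpoly q1) z" for z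
        unfolding pe cpoly_mult cpoly_add cpoly_smult poly_mult poly_add poly_smult cpoly_linear ..
      have degp1: "p1 = 0 \<or> degree p1 < degree q1"
      proof (cases "p1 = 0")
        case False
        then have "Suc (degree p1) = degree (p - smult c q1)"
          unfolding p1 by (subst degree_mult_eq) auto
        also have "\<dots> \<le> degree q1"
          using less.prems(2) \<open>p \<noteq> 0\<close> deg by (intro degree_diff_le) auto
        finally show ?thesis by simp
      qed simp
      have "\<exists>Y r. finite Y \<and> (\<forall>y\<in>Y. poly q1 y = 0) \<and>
        (\<forall>z. poly (cpoly q1) z \<noteq> 0 \<longrightarrow> poly (cpoly p1) z / poly (cpoly q1) z = (\<Sum>y\<in>Y. of_real (r y) / (z - of_real y)))"
      proof (rule less.hyps)
        show "degree q1 < degree q" "q1 \<noteq> 0" "p1 = 0 \<or> degree p1 < degree q1"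
          using deg degp1 q1nz by auto
        show "Im z = 0" if "poly (cpoly q1) z = 0" for z using roots1[OF that] .
        fix y' assume y': "poly q1 y' = 0"
        then obtain C where C: "\<And>t. 0 < t \<and> t \<le> 1 \<Longrightarrow>
            norm (poly (cpoly p) (Complex y' t)) * t \<le> C * norm (poly (cpoly q) (Complex y' t))"
          using less.prems(4)[OF root1] by blast
        have ne: "y' \<noteq> y" using y' q1y by auto
        \<comment> \<open>At the other roots the removed pole at \<open>y\<close> stays at distance
          at least \<open>\<bar>y' - y\<bar>\<close>, which accounts for the extra term in the
          constant.\<close>
        have "norm (poly (cpoly p1) (Complex y' t)) * t \<le> (C + \<bar>c\<bar> / \<bar>y' - y\<bar>) * norm (poly (cpoly q1) (Complex y' t))"
          if t: "0 < t \<and> t \<le> 1" for t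
        proof -
          define w where "w = Complex y' t - of_real y"
          have "\<bar>y' - y\<bar> \<le> norm w"
            using abs_Re_le_cmod[of w] by (simp add: w_def)
          then have w: "norm w > 0" "1 / norm w \<le> 1 / \<bar>y' - y\<bar>" using ne by (auto simp: frac_le)
          define P1 Q1 where "P1 = poly (cpoly p1) (Complex y' t)" and "Q1 = poly (cpoly q1) (Complex y' t)"
          have "norm w * (norm P1 * t) = norm (w * P1) * t" by (simp add: norm_mult)
          also have "w * P1 = (w * P1 + of_real c * Q1) - of_real c * Q1" by simp
          also have "norm \<dots> * t \<le> (norm (w * P1 + of_real c * Q1) + \<bar>c\<bar> * norm Q1) * t"
            using t norm_triangle_ineq4[of "w * P1 + of_real c * Q1" "of_real c * Q1"]
            by (intro mult_right_mono) (auto simp: norm_mult)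
          also have "\<dots> \<le> C * norm (w * Q1) + \<bar>c\<bar> * norm Q1"
            using C[OF t] mult_left_le[of t "\<bar>c\<bar> * norm Q1"] t unfolding evp evq w_def[symmetric] P1_def[symmetric] Q1_def[symmetric]
            by (simp add: distrib_right)
          also have "\<dots> = norm w * ((C + \<bar>c\<bar> * (1 / norm w)) * norm Q1)"
            using w by (simp add: norm_mult field_simps)
          finally have "norm P1 * t \<le> (C + \<bar>c\<bar> * (1 / norm w)) * norm Q1"
            using w(1) by (simp only: mult_le_cancel_left_pos)
          also have "\<dots> \<le> (C + \<bar>c\<bar> * (1 / \<bar>y' - y\<bar>)) * norm Q1"
            using w(2) by (intro mult_right_mono add_left_mono mult_left_mono) auto
          finally show ?thesis by (simp add: P1_def Q1_def)
        qed
        then show "\<exists>C. \<forall>t. 0 < t \<and> t \<le> 1 \<longrightarrow>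
            norm (poly (cpoly p1) (Complex y' t)) * t \<le> C * norm (poly (cpoly q1) (Complex y' t))" by blast
      qed
      then obtain Y r where Y: "finite Y" "\<forall>y\<in>Y. poly q1 y = 0"
        "\<And>z. poly (cpoly q1) z \<noteq> 0 \<Longrightarrow> poly (cpoly p1) z / poly (cpoly q1) z = (\<Sum>y\<in>Y. of_real (r y) / (z - of_real y))"
        by blast
      have yY: "y \<notin> Y" using Y(2) q1y by auto
      have "poly (cpoly p) z / poly (cpoly q) z = (\<Sum>y'\<in>insert y Y. of_real ((r(y := c)) y') / (z - of_real y'))"
        if nz: "poly (cpoly q) z \<noteq> 0" for z
      proof -
        have nz1: "z - of_real y \<noteq> 0" "poly (cpoly q1) z \<noteq> 0" using nz evq[of z] by auto
        have "poly (cpoly p) z / poly (cpoly q) z = of_real c / (z - of_real y) + poly (cpoly p1) z / poly (cpoly q1) z"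
          unfolding evp evq using nz1 by (simp add: divide_simps)
        also have "poly (cpoly p1) z / poly (cpoly q1) z = (\<Sum>y'\<in>Y. of_real ((r(y := c)) y') / (z - of_real y'))"
          unfolding Y(3)[OF nz1(2)] using yY by (intro sum.cong) auto
        finally show ?thesis using yY Y(1) by simp
      qed
      then show ?thesis
        using Y(1,2) root1 y by (intro exI[of _ "insert y Y"] exI[of _ "r(y := c)"]) auto
    qed
  qed
qed

section \<open>The method of moments\<close>

lemma integrable_bounded_support:
  fixes f :: "real \<Rightarrow> 'a::{banach, second_countable_topology}"
  assumes "real_distribution M" "AE x in M. \<bar>x\<bar> \<le> C" "f \<in> borel_measurable borel"
    "\<And>x. \<bar>x\<bar> \<le> C \<Longrightarrow> norm (f x) \<le> B"
  shows "integrable M f"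
proof -
  interpret real_distribution M by fact
  show ?thesis
    using assms(2-4) by (intro integrable_const_bound[where B = B]) auto
qed

lemma integral_power_abs_le:
  assumes "real_distribution M" "AE x in M. \<bar>x\<bar> \<le> C"
  shows "(\<integral>x. \<bar>x\<bar> ^ n \<partial>M) \<le> C ^ n"
proof -
  interpret real_distribution M by fact
  have "(\<integral>x. \<bar>x\<bar> ^ n \<partial>M) \<le> (\<integral>x. C ^ n \<partial>M)"
    using assms(2) by (intro integral_mono_AE integrable_bounded_support[OF assms, where B = "C ^ n"])
      (auto intro!: power_mono)
  then show ?thesis using prob_space by simp
qed

text \<open>For a law supported in \<open>[-C, C]\<close> the n-th absolute moment is at most
  \<open>C ^ n\<close>, so the Taylor remainder is at most \<open>2 (|t| C)^n / n!\<close>.\<close>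

lemma char_eq_moment_series:
  assumes M: "real_distribution M" "AE x in M. \<bar>x\<bar> \<le> C"
  shows "(\<lambda>n. \<Sum>k\<le>n. ((\<i> * t) ^ k / fact k) * (\<integral>x. x ^ k \<partial>M)) \<longlonglongrightarrow> char M t"
proof -
  interpret real_distribution M by fact
  have int: "integrable M (\<lambda>x. x ^ k)" for k
    using M by (intro integrable_bounded_support[OF M, where B = "C ^ k"])
      (auto intro!: power_mono simp: power_abs)
  have b: "cmod ((\<Sum>k\<le>n. ((\<i> * t) ^ k / fact k) * (\<integral>x. x ^ k \<partial>M)) - char M t) \<le> 2 * ((\<bar>t\<bar> * C) ^ n / fact n)" for n
  proof -
    have "cmod (char M t - (\<Sum>k\<le>n. ((\<i> * t) ^ k / fact k) * (\<integral>x. x ^ k \<partial>M))) \<le>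
        (2 * \<bar>t\<bar> ^ n / fact n) * (\<integral>x. \<bar>x\<bar> ^ n \<partial>M)"
      by (rule char_approx1) (rule int)
    also have "\<dots> \<le> (2 * \<bar>t\<bar> ^ n / fact n) * C ^ n"
      using integral_power_abs_le[OF M] by (intro mult_left_mono) auto
    finally show ?thesis by (simp add: norm_minus_commute power_mult_distrib)
  qed
  have lim: "(\<lambda>n. 2 * ((\<bar>t\<bar> * C) ^ n / fact n)) \<longlonglongrightarrow> 2 * 0"
    using summable_exp[of "\<bar>t\<bar> * C"]
    by (intro tendsto_mult tendsto_const summable_LIMSEQ_zero) (simp add: divide_inverse mult.commute)
  have "(\<lambda>n. (\<Sum>k\<le>n. ((\<i> * t) ^ k / fact k) * (\<integral>x. x ^ k \<partial>M)) - char M t) \<longlonglongrightarrow> 0"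
    by (rule Lim_null_comparison[OF always_eventually[OF allI[OF b]]]) (use lim in simp)
  then show ?thesis by (rule LIM_zero_cancel)
qed

text \<open>Equal moments give equal characteristic functions through the series. This is the
  uniqueness half of the \<open>THE\<close> in \<open>matching_measure\<close>, and it identifies
  all subsequential limits in \<open>moment_method\<close>.\<close>

lemma moments_determine_distribution:
  assumes "real_distribution M" "AE x in M. \<bar>x\<bar> \<le> C"
    and "real_distribution N" "AE x in N. \<bar>x\<bar> \<le> C'"
    and "\<And>k. (\<integral>x. x ^ k \<partial>M) = (\<integral>x. x ^ k \<partial>N)"
  shows "M = N"
proof (rule Levy_uniqueness[OF assms(1,3)])
  show "char M = char N"
  proof
    fix t
    show "char M t = char N t"
      using char_eq_moment_series[OF assms(1,2), of t] char_eq_moment_series[OF assms(3,4), of t]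
      unfolding assms(5) by (rule LIMSEQ_unique)
  qed
qed

lemma weak_limit_support:
  assumes "\<And>n. real_distribution (\<mu> n)" "\<And>n. AE x in \<mu> n. \<bar>x\<bar> \<le> C" "real_distribution M" "weak_conv_m \<mu> M"
  shows "AE x in M. \<bar>x\<bar> \<le> C"
proof -
  interpret M: real_distribution M by fact
  \<comment> \<open>A bounded continuous test function that vanishes exactly on
    \<open>[-C, C]\<close>.\<close>
  let ?g = "\<lambda>x::real. min 1 (max 0 (\<bar>x\<bar> - C))"
  have "(\<lambda>n. integral\<^sup>L (\<mu> n) ?g) \<longlonglongrightarrow> integral\<^sup>L M ?g"
    by (rule weak_conv_imp_integral_bdd_continuous_conv[OF assms(1,3,4), where B = 1])
       (auto intro!: continuous_intros)
  moreover have "integral\<^sup>L (\<mu> n) ?g = 0" for n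
    using assms(2)[of n] by (intro integral_eq_zero_AE) auto
  ultimately have "integral\<^sup>L M ?g = 0"
    by (simp add: LIMSEQ_const_iff)
  moreover have "integrable M ?g"
    by (rule M.integrable_const_bound[where B = 1]) auto
  ultimately have "AE x in M. ?g x = 0"
    by (subst (asm) integral_nonneg_eq_0_iff_AE) auto
  then show ?thesis by eventually_elim (auto simp: min_def max_def split: if_splits)
qed

lemma weak_limit_moments:
  assumes "\<And>n. real_distribution (\<mu> n)" "\<And>n. AE x in \<mu> n. \<bar>x\<bar> \<le> C" "real_distribution M" "weak_conv_m \<mu> M"
    and "C \<ge> 0"
  shows "(\<lambda>n. \<integral>x. x ^ k \<partial>\<mu> n) \<longlonglongrightarrow> (\<integral>x. x ^ k \<partial>M)"
proof -
  \<comment> \<open>Powers are unbounded and not admissible as test functions; clamping the argument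
    to \<open>[-C, C]\<close> repairs this without changing any of the integrals.\<close>
  let ?g = "\<lambda>x::real. (max (- C) (min C x)) ^ k"
  have b: "norm (?g x) \<le> C ^ k" for x
    unfolding norm_power using assms(5) by (intro power_mono) auto
  then have b: "\<bar>?g x\<bar> \<le> C ^ k" for x by simp
  have "(\<lambda>n. integral\<^sup>L (\<mu> n) ?g) \<longlonglongrightarrow> integral\<^sup>L M ?g"
    by (rule weak_conv_imp_integral_bdd_continuous_conv[OF assms(1,3,4), where B = "C ^ k"])
       (auto intro!: continuous_intros b)
  moreover have "integral\<^sup>L N ?g = (\<integral>x. x ^ k \<partial>N)" if "real_distribution N" "AE x in N. \<bar>x\<bar> \<le> C" for N
  proof -
    interpret real_distribution N by fact
    show ?thesis
    proof (rule integral_cong_AE)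
      show "AE x in N. ?g x = x ^ k"
        using that(2)
      proof eventually_elim
        fix x :: real assume "\<bar>x\<bar> \<le> C"
        then have "max (- C) (min C x) = x" by auto
        then show "?g x = x ^ k" by simp
      qed
    qed simp_all
  qed
  ultimately show ?thesis
    using assms weak_limit_support[OF assms(1-4)] by simp
qed

text \<open>The common support makes the sequence tight. Every subsequential limit has the moments
  \<open>m k\<close>, hence all of them coincide, and the whole sequence converges.\<close>

theorem moment_method:
  assumes "\<And>n. real_distribution (\<mu> n)" "\<And>n. AE x in \<mu> n. \<bar>x\<bar> \<le> C" and "C \<ge> 0"
    and "\<And>k. (\<lambda>n. \<integral>x. x ^ k \<partial>\<mu> n) \<longlonglongrightarrow> m k"
  shows "\<exists>M. real_distribution M \<and> (AE x in M. \<bar>x\<bar> \<le> C) \<and> (\<forall>k. (\<integral>x. x ^ k \<partial>M) = m k) \<and> weak_conv_m \<mu> M"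
proof -
  have tight: "tight \<mu>"
    unfolding tight_def
  proof (intro conjI allI impI assms(1))
    fix \<epsilon> :: real assume "\<epsilon> > 0"
    have "measure (\<mu> n) {- C - 1<..C + 1} = 1" for n
    proof -
      interpret real_distribution "\<mu> n" by fact
      show ?thesis using assms(2)[of n] by (subst prob_eq_1) auto
    qed
    then show "\<exists>a b. a < b \<and> (\<forall>n. 1 - \<epsilon> < measure (\<mu> n) {a<..b})"
      using \<open>\<epsilon> > 0\<close> assms(3) by (intro exI[of _ "- C - 1"] exI[of _ "C + 1"]) auto
  qed
  have lim: "(AE x in \<nu>. \<bar>x\<bar> \<le> C) \<and> (\<forall>k. (\<integral>x. x ^ k \<partial>\<nu>) = m k)"
    if "strict_mono s" "real_distribution \<nu>" "weak_conv_m (\<mu> \<circ> s) \<nu>" for s \<nu>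
  proof (intro conjI allI)
    have \<mu>s: "real_distribution ((\<mu> \<circ> s) n)" "AE x in (\<mu> \<circ> s) n. \<bar>x\<bar> \<le> C" for n
      unfolding o_apply by (rule assms(1), rule assms(2))
    show "AE x in \<nu>. \<bar>x\<bar> \<le> C"
      by (rule weak_limit_support[OF \<mu>s that(2,3)])
    fix k
    have "(\<lambda>n. \<integral>x. x ^ k \<partial>(\<mu> \<circ> s) n) \<longlonglongrightarrow> (\<integral>x. x ^ k \<partial>\<nu>)"
      by (rule weak_limit_moments[OF \<mu>s that(2,3) assms(3)])
    moreover have "(\<lambda>n. \<integral>x. x ^ k \<partial>(\<mu> \<circ> s) n) \<longlonglongrightarrow> m k"
      using LIMSEQ_subseq_LIMSEQ[OF assms(4)[of k] that(1)] by (simp add: o_def)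
    ultimately show "(\<integral>x. x ^ k \<partial>\<nu>) = m k" by (rule LIMSEQ_unique)
  qed
  obtain r M where r: "strict_mono (r :: nat \<Rightarrow> nat)" "real_distribution M" "weak_conv_m (\<mu> \<circ> r) M"
    using tight_imp_convergent_subsubsequence[OF tight strict_mono_id] by auto
  have M: "AE x in M. \<bar>x\<bar> \<le> C" "\<And>k. (\<integral>x. x ^ k \<partial>M) = m k"
    using lim[OF r] by auto
  have "weak_conv_m \<mu> M"
  proof (rule tight_subseq_weak_converge[OF assms(1) r(2) tight])
    fix s \<nu> assume s: "strict_mono s" "real_distribution \<nu>" "weak_conv_m (\<mu> \<circ> s) \<nu>"
    then have "\<nu> = M"
      using lim[OF s] M r(2) by (intro moments_determine_distribution[of \<nu> C M C]) auto
    then show "weak_conv_m (\<mu> \<circ> s) M" using s by simp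
  qed
  then show ?thesis using M r(2) by blast
qed

lemma finite_support_distribution:
  assumes "finite Y" "\<And>y. y \<in> Y \<Longrightarrow> 0 \<le> r y" "(\<Sum>y\<in>Y. r y) = 1"
  shows "\<exists>M. real_distribution M \<and> (AE x in M. x \<in> Y) \<and>
    (\<forall>g :: real \<Rightarrow> complex. g \<in> borel_measurable borel \<longrightarrow> integral\<^sup>L M g = (\<Sum>y\<in>Y. r y *\<^sub>R g y)) \<and>
    (\<forall>g :: real \<Rightarrow> real. g \<in> borel_measurable borel \<longrightarrow> integral\<^sup>L M g = (\<Sum>y\<in>Y. r y * g y))"
proof -
  define P where "P = point_measure Y r"
  interpret P: prob_space P
  proof
    show "emeasure P (space P) = 1"
      unfolding P_def space_point_measure using assms
      by (subst emeasure_point_measure_finite) (auto simp: sum_ennreal)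
  qed
  have id: "(\<lambda>x. x) \<in> measurable P borel"
    by (simp add: P_def measurable_point_measure_eq1)
  define M where "M = distr P borel (\<lambda>x. x)"
  have "real_distribution M"
    unfolding M_def by (rule P.real_distribution_distr) (use id in auto)
  moreover have "AE x in M. x \<in> Y"
  proof -
    have "closed Y" using assms(1) by (simp add: finite_imp_closed)
    then have "{x \<in> space borel. x \<in> Y} \<in> sets borel" by simp
    then show ?thesis
      unfolding M_def using id by (subst AE_distr_iff) (auto simp: P_def space_point_measure intro!: AE_I2)
  qed
  moreover have "integral\<^sup>L M g = (\<Sum>y\<in>Y. r y *\<^sub>R g y)" if "g \<in> borel_measurable borel" for g :: "real \<Rightarrow> complex"
    unfolding M_def using id that assms
    by (subst integral_distr) (auto simp: P_def lebesgue_integral_point_measure_finite)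
  moreover have "integral\<^sup>L M g = (\<Sum>y\<in>Y. r y * g y)" if "g \<in> borel_measurable borel" for g :: "real \<Rightarrow> real"
    unfolding M_def using id that assms
    by (subst integral_distr) (auto simp: P_def lebesgue_integral_point_measure_finite)
  ultimately show ?thesis by blast
qed

lemma cmod_resolvent_le:
  assumes "t \<noteq> 0"
  shows "norm (1 / (Complex a t - of_real x)) \<le> 1 / \<bar>t\<bar>"
proof -
  have "\<bar>t\<bar> \<le> norm (Complex a t - of_real x)"
    using abs_Im_le_cmod[of "Complex a t - of_real x"] by simp
  then show ?thesis using assms by (simp add: norm_divide frac_le)
qed

text \<open>Dominated convergence: \<open>i t / (a + i t - x)\<close> has norm at most 1 and tends
  to the indicator of \<open>x = a\<close>.\<close>

lemma tendsto_Stieltjes_atom: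
  assumes "real_distribution M"
  shows "((\<lambda>t. \<i> * of_real t * (\<integral>x. 1 / (Complex a t - of_real x) \<partial>M)) \<longlongrightarrow> of_real (measure M {a})) (at_right 0)"
proof (subst tendsto_at_iff_sequentially, intro allI impI)
  interpret real_distribution M by fact
  fix X :: "nat \<Rightarrow> real" assume X: "\<forall>i. X i \<in> {0<..} - {0}" "X \<longlonglongrightarrow> 0"
  have pos: "X i > 0" for i using X(1) by auto
  define s where "s i x = \<i> * of_real (X i) * (1 / (Complex a (X i) - of_real x))" for i x
  have "(\<lambda>i. integral\<^sup>L M (s i)) \<longlonglongrightarrow> integral\<^sup>L M (\<lambda>x. of_real (indicator {a} x) :: complex)"
  proof (rule integral_dominated_convergence[where w = "\<lambda>_. 1"])
    show "s i \<in> borel_measurable M" for i unfolding s_def by measurable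
    show "AE x in M. norm (s i x) \<le> 1" for i
    proof (rule AE_I2)
      fix x
      have "norm (s i x) = X i * norm (1 / (Complex a (X i) - of_real x))"
        using pos[of i] by (simp add: s_def norm_mult norm_divide)
      also have "\<dots> \<le> X i * (1 / \<bar>X i\<bar>)"
        using pos[of i] by (intro mult_left_mono cmod_resolvent_le) auto
      finally show "norm (s i x) \<le> 1" using pos[of i] by simp
    qed
    show "AE x in M. (\<lambda>i. s i x) \<longlonglongrightarrow> of_real (indicator {a} x)"
    proof (rule AE_I2)
      fix x
      show "(\<lambda>i. s i x) \<longlonglongrightarrow> of_real (indicator {a} x)"
      proof (cases "x = a")
        case True
        have "s i x = 1" for i
        proof -
          have "Complex a (X i) - of_real x = \<i> * of_real (X i)" using True by (simp add: complex_eq_iff)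
          then show ?thesis using pos[of i] by (simp add: s_def)
        qed
        then show ?thesis using True by simp
      next
        case False
        have "(\<lambda>i. s i x) \<longlonglongrightarrow> \<i> * of_real 0 * (1 / (Complex a 0 - of_real x))"
          unfolding s_def using False X(2)
          by (intro tendsto_intros tendsto_Complex) (auto simp: complex_eq_iff)
        then show ?thesis using False by simp
      qed
    qed
  qed auto
  moreover have "integral\<^sup>L M (s i) = \<i> * of_real (X i) * (\<integral>x. 1 / (Complex a (X i) - of_real x) \<partial>M)" for i
    unfolding s_def by (rule integral_mult_right_zero)
  moreover have "integral\<^sup>L M (\<lambda>x. of_real (indicator {a} x) :: complex) = of_real (measure M {a})"
    by simp
  ultimately show "((\<lambda>t. \<i> * of_real t * (\<integral>x. 1 / (Complex a t - of_real x) \<partial>M)) \<circ> X) \<longlonglongrightarrow> of_real (measure M {a})"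
    unfolding o_def by simp
qed

section \<open>Closed walks in the path tree as moments of the Green function\<close>

context bounded_graph
begin

lemma finite_nbrs_conj [simp]:
  "finite {v. P v \<and> E u v}" "finite {v. P v \<and> Q v \<and> E u v}"
  by (rule finite_subset[OF _ finite_nbrs[of u]], blast)+

lemma matching_poly_monic_aux:
  "finite X \<Longrightarrow> degree (matching_poly E X) \<le> card X \<and> coeff (matching_poly E X) (card X) = 1"
proof (induction "card X" arbitrary: X rule: less_induct)
  case less
  show ?case
  proof (cases "X = {}")
    case False
    then obtain u where u: "u \<in> X" by blast
    define n where "n = card (X - {u})"
    have n: "card X = Suc n" using card_Suc_Diff1[OF less.prems u] by (simp add: n_def)
    have IH: "degree (matching_poly E (X - {u})) \<le> n" "coeff (matching_poly E (X - {u})) n = 1"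
      using less.hyps[of "X - {u}"] less.prems n by (auto simp: n_def)
    have deg2: "degree (matching_poly E (X - {u, v})) < n" if "v \<in> X - {u}" for v
    proof -
      have e: "X - {u, v} = (X - {u}) - {v}" by auto
      have c: "card (X - {u, v}) < n"
        unfolding n_def e by (rule card_Diff1_less) (use that less.prems in auto)
      then show ?thesis using less.hyps[of "X - {u, v}"] less.prems n by auto
    qed
    let ?S = "\<Sum>v\<in>{v\<in>X - {u}. E u v}. matching_poly E (X - {u, v})"
    have S: "degree ?S \<le> n"
      using deg2 by (intro degree_sum_le) (auto simp: less_imp_le)
    then have "coeff ?S (Suc n) = 0" by (intro coeff_eq_0) simp
    moreover have "degree (pCons 0 (matching_poly E (X - {u})) - ?S) \<le> Suc n"
      using IH S by (intro degree_diff_le) (auto intro: order.trans[OF degree_pCons_le])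
    ultimately show ?thesis
      unfolding n matching_poly_rec[OF less.prems u] using IH by simp
  qed simp
qed

lemma degree_matching_poly: "finite X \<Longrightarrow> degree (matching_poly E X) = card X"
  and matching_poly_nonzero: "finite X \<Longrightarrow> matching_poly E X \<noteq> 0"
  using matching_poly_monic_aux[of X] by (auto intro!: antisym le_degree)

text \<open>Walks from the root with a free end: unlike closed walks they can be prolonged one step
  at a time, which induction on the length requires.\<close>

definition walks :: "nat set \<Rightarrow> nat \<Rightarrow> nat \<Rightarrow> nat list list set" where
  "walks X u k = {ws. length ws = Suc k \<and> hd ws = [u] \<and> set ws \<subseteq> paths X u \<and> successively path_tree_adj ws}"

lemma closed_walks_eq:
  "path_tree_closed_walks (X, E) u k = card {ws \<in> walks X u k. last ws = [u]}"
  unfolding path_tree_closed_walks_def walks_def paths_def successively_conv_nth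
  by (rule arg_cong[where f = card]) auto

lemma walks_0: "u \<in> X \<Longrightarrow> walks X u 0 = {[[u]]}"
  by (auto simp: walks_def length_Suc_conv singleton_path)

lemma closed_walks_0: "u \<in> X \<Longrightarrow> path_tree_closed_walks (X, E) u 0 = 1"
proof -
  assume "u \<in> X"
  then have "{ws \<in> walks X u 0. last ws = [u]} = {[[u]]}" by (auto simp: walks_0)
  then show ?thesis by (simp add: closed_walks_eq)
qed

definition tree_nbrs :: "nat set \<Rightarrow> nat \<Rightarrow> nat list \<Rightarrow> nat list set" where
  "tree_nbrs X u p = {q \<in> paths X u. path_tree_adj p q}"

lemma tree_nbrs_eq:
  assumes "p \<in> paths X u"
  shows "tree_nbrs X u p = (\<lambda>b. p @ [b]) ` {b \<in> X - set p. E (last p) b} \<union> (if p = [u] then {} else {butlast p})"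
proof (intro equalityI subsetI)
  fix q assume "q \<in> tree_nbrs X u p"
  then have q: "q \<in> paths X u" "path_tree_adj p q" by (auto simp: tree_nbrs_def)
  from q(2) consider x where "q = p @ [x]" | x where "p = q @ [x]"
    by (auto simp: path_tree_adj_def)
  then show "q \<in> (\<lambda>b. p @ [b]) ` {b \<in> X - set p. E (last p) b} \<union> (if p = [u] then {} else {butlast p})"
  proof cases
    case 1
    then show ?thesis using q(1) assms by (auto simp: paths_iff successively_append_iff)
  next
    case 2
    then show ?thesis using q(1) by (auto simp: paths_iff)
  qed
next
  fix q assume "q \<in> (\<lambda>b. p @ [b]) ` {b \<in> X - set p. E (last p) b} \<union> (if p = [u] then {} else {butlast p})"
  then consider b where "q = p @ [b]" "b \<in> X - set p" "E (last p) b" | "p \<noteq> [u]" "q = butlast p"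
    by (auto split: if_splits)
  then show "q \<in> tree_nbrs X u p"
  proof cases
    case 1
    then show ?thesis using assms
      by (auto simp: tree_nbrs_def paths_iff successively_append_iff path_tree_adj_def)
  next
    case 2
    obtain x where x: "p = q @ [x]"
      using 2 path_nonempty[OF assms] by (metis append_butlast_last_id)
    have "q \<noteq> []" using x 2(1) assms by (auto simp: paths_iff)
    then show ?thesis using assms unfolding x
      by (auto simp: tree_nbrs_def paths_iff successively_append_iff path_tree_adj_def)
  qed
qed

lemma finite_tree_nbrs: "p \<in> paths X u \<Longrightarrow> finite (tree_nbrs X u p)"
  unfolding tree_nbrs_eq by (auto intro!: finite_imageI finite_nbrs_in)

text \<open>Row \<open>p\<close> of the resolvent equation \<open>(z - A) R = I\<close> in the path
  tree. It is the recursion for \<open>X\<close> minus all but the last vertex of \<open>p\<close>,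
  expanded at that last vertex: the undeleted graph gives the parent of \<open>p\<close> and the
  neighbours give its children.\<close>

lemma green_tree_eq:
  assumes "finite X" "Im z > 0" "p \<in> paths X u"
  shows "z * green E X (set p) z = (if p = [u] then 1 else 0) + (\<Sum>q\<in>tree_nbrs X u p. green E X (set q) z)"
proof -
  obtain p' v where p: "p = p' @ [v]"
    using path_nonempty[OF assms(3)] by (metis append_butlast_last_id)
  have v: "v \<in> X - set p'" using assms(3) by (auto simp: p paths_iff)
  define m where "m = matching_val E X z"
  have m: "m \<noteq> 0" using assms by (simp add: m_def matching_val_nonzero)
  let ?N = "{b \<in> X - set p. E (last p) b}"
  have N: "?N = {b \<in> X - set p' - {v}. E v b}" by (auto simp: p)
  have e: "X - set p' - {v} = X - set p" "\<And>b. X - set p' - {v, b} = X - set (p @ [b])" by (auto simp: p)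
  have "matching_val E (X - set p') z = z * matching_val E (X - set p) z - (\<Sum>b\<in>?N. matching_val E (X - set (p @ [b])) z)"
    using matching_val_rec[of "X - set p'" v z] assms(1) v unfolding N e by simp
  then have "z * green E X (set p) z = green E X (set p') z + (\<Sum>b\<in>?N. green E X (set (p @ [b])) z)"
    by (simp add: green_def m_def[symmetric] diff_divide_distrib flip: sum_divide_distrib)
  also have "(\<Sum>b\<in>?N. green E X (set (p @ [b])) z) = (\<Sum>q\<in>(\<lambda>b. p @ [b]) ` ?N. green E X (set q) z)"
    by (subst sum.reindex) (auto simp: inj_on_def)
  also have "green E X (set p') z + \<dots> = (if p = [u] then 1 else 0) + (\<Sum>q\<in>tree_nbrs X u p. green E X (set q) z)"
  proof (cases "p = [u]")
    case True
    then have "green E X (set p') z = 1" using m by (simp add: p m_def)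
    then show ?thesis using True unfolding tree_nbrs_eq[OF assms(3)] by simp
  next
    case False
    have "p' \<notin> (\<lambda>b. p @ [b]) ` ?N" by (auto simp: p)
    then show ?thesis
      using False finite_nbrs_in[of "X - set p" "last p"] unfolding tree_nbrs_eq[OF assms(3)] by (auto simp add: p)
  qed
  finally show ?thesis .
qed

lemma walks_Suc: "walks X u (Suc k) = (\<Union>ws\<in>walks X u k. (\<lambda>q. ws @ [q]) ` tree_nbrs X u (last ws))"
proof (intro equalityI subsetI)
  fix ws assume w: "ws \<in> walks X u (Suc k)"
  then have "ws \<noteq> []" by (auto simp: walks_def)
  then obtain ws' q where ws: "ws = ws' @ [q]" by (metis append_butlast_last_id)
  have "ws' \<noteq> []" using w by (auto simp: ws walks_def)
  then have "ws' \<in> walks X u k" "q \<in> tree_nbrs X u (last ws')"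
    using w by (auto simp: ws walks_def tree_nbrs_def successively_append_iff)
  then show "ws \<in> (\<Union>ws\<in>walks X u k. (\<lambda>q. ws @ [q]) ` tree_nbrs X u (last ws))"
    unfolding ws by blast
next
  fix ws assume "ws \<in> (\<Union>ws\<in>walks X u k. (\<lambda>q. ws @ [q]) ` tree_nbrs X u (last ws))"
  then show "ws \<in> walks X u (Suc k)"
    by (auto simp: walks_def tree_nbrs_def successively_append_iff hd_append)
qed

lemma last_walk: "ws \<in> walks X u k \<Longrightarrow> last ws \<in> paths X u"
  using last_in_set[of ws] by (cases "ws = []") (auto simp: walks_def)

lemma finite_walks: "finite (walks X u k)"
proof (induction k)
  case 0
  have "walks X u 0 \<subseteq> {[[u]]}" by (auto simp: walks_def length_Suc_conv)
  then show ?case by (rule finite_subset) simp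
next
  case (Suc k)
  then show ?case unfolding walks_Suc by (auto intro!: finite_tree_nbrs last_walk)
qed

text \<open>The root entry of \<open>A^k (z - A)^{-1}\<close>, where \<open>A\<close> is the
  adjacency operator of the path tree.\<close>

definition walk_sum :: "nat set \<Rightarrow> nat \<Rightarrow> nat \<Rightarrow> complex \<Rightarrow> complex" where
  "walk_sum X u k z = (\<Sum>ws\<in>walks X u k. green E X (set (last ws)) z)"

lemma walk_sum_0: "u \<in> X \<Longrightarrow> walk_sum X u 0 z = green E X {u} z"
  by (simp add: walk_sum_def walks_0)

lemma walk_sum_Suc:
  assumes "finite X" "Im z > 0"
  shows "z * walk_sum X u k z = of_nat (path_tree_closed_walks (X, E) u k) + walk_sum X u (Suc k) z"
proof -
  have "z * walk_sum X u k z = (\<Sum>ws\<in>walks X u k. (if last ws = [u] then 1 else 0) +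
      (\<Sum>q\<in>tree_nbrs X u (last ws). green E X (set q) z))"
    unfolding walk_sum_def sum_distrib_left
    by (intro sum.cong refl green_tree_eq assms last_walk)
  also have "\<dots> = of_nat (path_tree_closed_walks (X, E) u k) +
      (\<Sum>ws\<in>walks X u k. \<Sum>q\<in>tree_nbrs X u (last ws). green E X (set q) z)"
    unfolding sum.distrib closed_walks_eq
    by (simp add: finite_walks sum.If_cases Collect_conj_eq)
  also have "(\<Sum>ws\<in>walks X u k. \<Sum>q\<in>tree_nbrs X u (last ws). green E X (set q) z) = walk_sum X u (Suc k) z"
  proof -
    have "walk_sum X u (Suc k) z = (\<Sum>ws\<in>walks X u k. \<Sum>w\<in>(\<lambda>q. ws @ [q]) ` tree_nbrs X u (last ws). green E X (set (last w)) z)"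
      unfolding walk_sum_def walks_Suc
      by (rule sum.UNION_disjoint) (auto intro!: finite_walks finite_imageI finite_tree_nbrs last_walk)
    also have "\<dots> = (\<Sum>ws\<in>walks X u k. \<Sum>q\<in>tree_nbrs X u (last ws). green E X (set q) z)"
      by (intro sum.cong refl, subst sum.reindex) (auto simp: inj_on_def)
    finally show ?thesis ..
  qed
  finally show ?thesis .
qed

lemma norm_green_path_le:
  assumes "finite X" "Im z > 0" "p \<in> paths X u"
  shows "norm (green E X (set p) z) \<le> 1 / Im z"
proof -
  have u: "u \<in> X" using start_in_path[OF assms(3)] set_path_subset[OF assms(3)] by blast
  have "(norm (green E X (set p) z))\<^sup>2 \<le> (\<Sum>p\<in>paths X u. (norm (green E X (set p) z))\<^sup>2)"
    using assms by (intro member_le_sum) auto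
  also have "\<dots> \<le> (1 / Im z) / Im z"
    unfolding sum_paths_norm_green[OF assms(1) u assms(2)]
    using norm_green_le[OF assms(1,2) u] abs_Im_le_cmod[of "green E X {u} z"] assms(2)
    by (intro divide_right_mono) auto
  finally have "(norm (green E X (set p) z))\<^sup>2 \<le> (1 / Im z)\<^sup>2" by (simp add: power2_eq_square)
  then show ?thesis using assms(2) by (rule_tac power2_le_imp_le) auto
qed

lemma walk_sum_tendsto_0:
  assumes "finite X"
  shows "((\<lambda>y. walk_sum X u k (Complex 0 y)) \<longlongrightarrow> 0) at_top"
  unfolding walk_sum_def
proof (rule tendsto_null_sum)
  fix ws assume "ws \<in> walks X u k"
  then have p: "last ws \<in> paths X u" by (rule last_walk)
  show "((\<lambda>y. green E X (set (last ws)) (Complex 0 y)) \<longlongrightarrow> 0) at_top"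
  proof (rule Lim_null_comparison)
    show "\<forall>\<^sub>F y in at_top. norm (green E X (set (last ws)) (Complex 0 y)) \<le> inverse y"
      using eventually_gt_at_top[of 0]
    proof eventually_elim
      case (elim y)
      then show ?case
        using norm_green_path_le[OF assms _ p, of "Complex 0 y"] by (simp add: inverse_eq_divide)
    qed
    show "(inverse \<longlongrightarrow> (0::real)) at_top" by (rule tendsto_inverse_0_at_top) (rule filterlim_ident)
  qed
qed

text \<open>Both the partial fraction sums \<open>B k\<close> and \<open>walk_sum\<close> satisfy
  \<open>z f_k = m_k + f_{k+1}\<close> with all \<open>f_k\<close> tending to 0 up the imaginary
  axis. If the \<open>f_k\<close> agree, the limit shows that the numbers \<open>m_k\<close> agree,
  and hence so do the \<open>f_{k+1}\<close>.\<close>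

lemma moments_eq_closed_walks:
  assumes X: "finite X" "u \<in> X" and Y: "finite Y"
    and g: "\<And>z. Im z > 0 \<Longrightarrow> green E X {u} z = (\<Sum>y\<in>Y. of_real (r y) / (z - of_real y))"
  shows "(\<Sum>y\<in>Y. r y * y ^ k) = real (path_tree_closed_walks (X, E) u k)"
proof -
  define B where "B k z = (\<Sum>y\<in>Y. of_real (r y * y ^ k) / (z - of_real y))" for k and z :: complex
  have B_Suc: "z * B k z = of_real (\<Sum>y\<in>Y. r y * y ^ k) + B (Suc k) z" if "Im z > 0" for k z
  proof -
    have "z * (of_real (r y * y ^ k) / (z - of_real y)) =
        of_real (r y * y ^ k) + of_real (r y * y ^ Suc k) / (z - of_real y)" for y
    proof -
      have "z - of_real y \<noteq> 0" using that by (auto simp: complex_eq_iff)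
      then show ?thesis by (simp add: field_simps)
    qed
    then show ?thesis unfolding B_def sum_distrib_left by (simp add: sum.distrib)
  qed
  have B_lim: "((\<lambda>y. B k (Complex 0 y)) \<longlongrightarrow> 0) at_top" for k
    unfolding B_def
  proof (rule tendsto_null_sum)
    fix y
    show "((\<lambda>t. complex_of_real (r y * y ^ k) / (Complex 0 t - of_real y)) \<longlongrightarrow> 0) at_top"
    proof (rule Lim_null_comparison)
      show "\<forall>\<^sub>F t in at_top. norm (complex_of_real (r y * y ^ k) / (Complex 0 t - of_real y)) \<le> \<bar>r y * y ^ k\<bar> * inverse t"
        using eventually_gt_at_top[of 0]
      proof eventually_elim
        case (elim t)
        then have "norm (1 / (Complex 0 t - of_real y)) \<le> inverse t"
          using cmod_resolvent_le[of t 0 y] by (simp add: inverse_eq_divide)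
        then have "\<bar>r y * y ^ k\<bar> * norm (1 / (Complex 0 t - of_real y)) \<le> \<bar>r y * y ^ k\<bar> * inverse t"
          by (intro mult_left_mono) auto
        then show ?case by (simp add: norm_divide norm_mult abs_mult norm_power power_abs)
      qed
      show "((\<lambda>t. \<bar>r y * y ^ k\<bar> * inverse t) \<longlongrightarrow> 0) at_top"
        by (intro tendsto_mult_right_zero tendsto_inverse_0_at_top filterlim_ident)
    qed
  qed
  have main: "(\<forall>z. Im z > 0 \<longrightarrow> walk_sum X u k z = B k z) \<and> (\<Sum>y\<in>Y. r y * y ^ k) = real (path_tree_closed_walks (X, E) u k)" for k
  proof (induction k)
    have step: "(\<Sum>y\<in>Y. r y * y ^ k) = real (path_tree_closed_walks (X, E) u k)"
      if "\<And>z. Im z > 0 \<Longrightarrow> walk_sum X u k z = B k z" for k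
    proof -
      let ?d = "complex_of_real (\<Sum>y\<in>Y. r y * y ^ k) - of_nat (path_tree_closed_walks (X, E) u k)"
      have "((\<lambda>y. walk_sum X u (Suc k) (Complex 0 y) - B (Suc k) (Complex 0 y)) \<longlongrightarrow> 0 - 0) at_top"
        by (intro tendsto_diff walk_sum_tendsto_0 X B_lim)
      moreover have "\<forall>\<^sub>F y in at_top. walk_sum X u (Suc k) (Complex 0 y) - B (Suc k) (Complex 0 y) = ?d"
        using eventually_gt_at_top[of 0]
      proof eventually_elim
        case (elim y)
        then have "Im (Complex 0 y) > 0" by simp
        then show ?case
          using walk_sum_Suc[OF X(1), of "Complex 0 y" u k] B_Suc[of "Complex 0 y" k] that[of "Complex 0 y"]
          by (simp add: algebra_simps)
      qed
      ultimately have "((\<lambda>y::real. ?d) \<longlongrightarrow> 0) at_top"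
        using tendsto_cong by force
      then have "?d = 0" by (simp add: tendsto_const_iff)
      then have "complex_of_real (\<Sum>y\<in>Y. r y * y ^ k) = of_real (real (path_tree_closed_walks (X, E) u k))"
        by simp
      then show ?thesis by (simp only: of_real_eq_iff)
    qed
    {
      case 0
      have "\<forall>z. Im z > 0 \<longrightarrow> walk_sum X u 0 z = B 0 z"
        using g X by (simp add: walk_sum_0 B_def)
      then show ?case using step[of 0] by blast
    next
      case (Suc k)
      have "walk_sum X u (Suc k) z = B (Suc k) z" if "Im z > 0" for z
        using walk_sum_Suc[OF X(1) that, of u k] B_Suc[OF that, of k] Suc that by simp
      then show ?case using step[of "Suc k"] by blast
    }
  qed
  then show ?thesis by blast
qed

end

section \<open>The spectral measure of the path tree\<close>

context bounded_graph
begin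

lemma matching_val_cpoly: "matching_val E X z = poly (cpoly (map_poly of_int (matching_poly E X))) z"
  unfolding matching_val_def by (subst map_poly_map_poly) (simp_all add: o_def)

lemma matching_val_cnj: "matching_val E X (cnj z) = cnj (matching_val E X z)"
proof -
  have "map_poly cnj (map_poly of_int p) = (map_poly of_int p :: complex poly)" for p
    by (rule poly_eqI) (simp add: coeff_map_poly)
  then show ?thesis unfolding matching_val_def poly_cnj by simp
qed

lemma matching_val_real_rooted: "finite X \<Longrightarrow> matching_val E X z = 0 \<Longrightarrow> Im z = 0"
  using matching_val_nonzero[of X z] matching_val_nonzero[of X "cnj z"] matching_val_cnj[of X z]
  by (cases "Im z" "0::real" rule: linorder_cases) auto

lemma root_bound: "finite X \<Longrightarrow> matching_val E X z = 0 \<Longrightarrow> norm z \<le> real D + 1"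
  using green_large_aux[of X z] by linarith

text \<open>The measure has the poles of the Green function as its support and the residues as
  weights. The weights are nonnegative because the Green function lies in the lower half-plane, and
  they sum to 1 because there is exactly one closed walk of length 0.\<close>

lemma finite_spectral_measure:
  assumes "finite X" "u \<in> X"
  shows "\<exists>M. real_distribution M \<and> (AE x in M. \<bar>x\<bar> \<le> real D + 1) \<and>
    (\<forall>z. Im z > 0 \<longrightarrow> green E X {u} z = (\<integral>x. 1 / (z - of_real x) \<partial>M)) \<and>
    (\<forall>k. (\<integral>x. x ^ k \<partial>M) = real (path_tree_closed_walks (X, E) u k))"
proof -
  define p q :: "real poly" where "p = map_poly of_int (matching_poly E (X - {u}))"
    and "q = map_poly of_int (matching_poly E X)"
  have ev: "poly (cpoly p) z = matching_val E (X - {u}) z" "poly (cpoly q) z = matching_val E X z" for z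
    unfolding p_def q_def by (simp_all add: matching_val_cpoly)
  have deg: "degree p = card (X - {u})" "degree q = card X"
    unfolding p_def q_def using assms by (simp_all add: degree_map_poly degree_matching_poly)
  have "q \<noteq> 0"
    unfolding q_def using matching_poly_nonzero[of X] assms by (simp add: map_poly_eq_0_iff)
  moreover have "p = 0 \<or> degree p < degree q"
    unfolding deg using card_Diff1_less[OF assms] by simp
  moreover have "Im z = 0" if "poly (cpoly q) z = 0" for z
    using that matching_val_real_rooted[OF assms(1)] by (simp add: ev)
  moreover have "\<exists>C. \<forall>t. 0 < t \<and> t \<le> 1 \<longrightarrow>
      norm (poly (cpoly p) (Complex y t)) * t \<le> C * norm (poly (cpoly q) (Complex y t))" for y
  \<comment> \<open>The a priori bound \<open>1 / t\<close> for the Green function on the vertical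
    line above \<open>y\<close> is the growth condition with constant 1.\<close>
  proof (intro exI[of _ 1] allI impI)
    fix t :: real assume t: "0 < t \<and> t \<le> 1"
    then have "norm (green E X {u} (Complex y t)) \<le> 1 / t" "matching_val E X (Complex y t) \<noteq> 0"
      using norm_green_le[of X "Complex y t" u] matching_val_nonzero[of X "Complex y t"] assms by auto
    then show "norm (poly (cpoly p) (Complex y t)) * t \<le> 1 * norm (poly (cpoly q) (Complex y t))"
      using t by (simp add: ev green_def norm_divide field_simps)
  qed
  ultimately obtain Y r where Y: "finite Y" "\<And>y. y \<in> Y \<Longrightarrow> poly q y = 0"
    "\<And>z. poly (cpoly q) z \<noteq> 0 \<Longrightarrow> poly (cpoly p) z / poly (cpoly q) z = (\<Sum>y\<in>Y. of_real (r y) / (z - of_real y))"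
    using partial_fractions_real_rooted[of q p] by blast
  have g: "green E X {u} z = (\<Sum>y\<in>Y. of_real (r y) / (z - of_real y))" if "Im z > 0" for z
    using Y(3)[of z] matching_val_nonzero[OF assms(1) that] unfolding ev green_def by blast
  \<comment> \<open>The residue is the limit of \<open>i t g\<close> along \<open>y + i t\<close>,
    and the real part of \<open>i t g\<close> is \<open>- t Im g > 0\<close>.\<close>
  have nonneg: "r y \<ge> 0" if y: "y \<in> Y" for y
  proof -
    have "((\<lambda>t. \<i> * of_real t * green E X {u} (Complex y t)) \<longlongrightarrow> (\<Sum>y'\<in>Y. if y' = y then of_real (r y') else 0)) (at_right 0)"
    proof (rule Lim_transform_eventually)
      show "((\<lambda>t. \<Sum>y'\<in>Y. \<i> * of_real t * (of_real (r y') / (Complex y t - of_real y'))) \<longlongrightarrow>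
          (\<Sum>y'\<in>Y. if y' = y then of_real (r y') else 0)) (at_right 0)"
      proof (rule tendsto_sum)
        fix y'
        show "((\<lambda>t. \<i> * of_real t * (of_real (r y') / (Complex y t - of_real y'))) \<longlongrightarrow> (if y' = y then of_real (r y') else 0)) (at_right 0)"
        proof (cases "y' = y")
          case True
          have "\<forall>\<^sub>F t in at_right 0. of_real (r y') = \<i> * of_real t * (of_real (r y') / (Complex y t - of_real y'))"
            using eventually_at_right_less[of 0]
          proof eventually_elim
            case (elim t)
            have "Complex y t - of_real y' = \<i> * of_real t" using True by (simp add: complex_eq_iff)
            then show ?case using elim by simp
          qed
          then show ?thesis using True by (auto intro: Lim_transform_eventually tendsto_const)
        next
          case False
          have "((\<lambda>t. \<i> * of_real t * (of_real (r y') / (Complex y t - of_real y'))) \<longlongrightarrow>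
             \<i> * of_real 0 * (of_real (r y') / (Complex y 0 - of_real y'))) (at_right 0)"
            using False by (intro tendsto_intros tendsto_Complex) (auto simp: complex_eq_iff)
          then show ?thesis using False by simp
        qed
      qed
      show "\<forall>\<^sub>F t in at_right 0. (\<Sum>y'\<in>Y. \<i> * of_real t * (of_real (r y') / (Complex y t - of_real y'))) =
          \<i> * of_real t * green E X {u} (Complex y t)"
        using eventually_at_right_less[of 0] by eventually_elim (simp add: g sum_distrib_left)
    qed
    also have "(\<Sum>y'\<in>Y. if y' = y then of_real (r y') else 0) = (of_real (r y) :: complex)"
      using y Y(1) by simp
    finally have "((\<lambda>t. Re (\<i> * of_real t * green E X {u} (Complex y t))) \<longlongrightarrow> Re (of_real (r y))) (at_right 0)"
      by (rule tendsto_Re)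
    moreover have "\<forall>\<^sub>F t in at_right 0. 0 \<le> Re (\<i> * of_real t * green E X {u} (Complex y t))"
      using eventually_at_right_less[of 0]
    proof eventually_elim
      case (elim t)
      then show ?case
        using Im_green_neg[OF assms(1) _ assms(2), of "Complex y t"] by (simp add: mult_le_0_iff)
    qed
    ultimately have "0 \<le> Re (of_real (r y) :: complex)"
      by (intro tendsto_lowerbound) auto
    then show ?thesis by simp
  qed
  have mom: "(\<Sum>y\<in>Y. r y * y ^ k) = real (path_tree_closed_walks (X, E) u k)" for k
    by (rule moments_eq_closed_walks[OF assms Y(1) g])
  have "(\<Sum>y\<in>Y. r y) = 1"
    using mom[of 0] assms(2) by (simp add: closed_walks_0)
  then obtain M where "real_distribution M \<and> (AE x in M. x \<in> Y) \<and>
    (\<forall>g :: real \<Rightarrow> complex. g \<in> borel_measurable borel \<longrightarrow> integral\<^sup>L M g = (\<Sum>y\<in>Y. r y *\<^sub>R g y)) \<and>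
    (\<forall>g :: real \<Rightarrow> real. g \<in> borel_measurable borel \<longrightarrow> integral\<^sup>L M g = (\<Sum>y\<in>Y. r y * g y))"
    using finite_support_distribution[where Y = Y and r = r, OF Y(1) nonneg] by blast
  then have M: "real_distribution M" "AE x in M. x \<in> Y"
    "\<And>g :: real \<Rightarrow> complex. g \<in> borel_measurable borel \<Longrightarrow> integral\<^sup>L M g = (\<Sum>y\<in>Y. r y *\<^sub>R g y)"
    "\<And>g :: real \<Rightarrow> real. g \<in> borel_measurable borel \<Longrightarrow> integral\<^sup>L M g = (\<Sum>y\<in>Y. r y * g y)"
    by auto
  have bound: "\<bar>y\<bar> \<le> real D + 1" if "y \<in> Y" for y
  proof -
    have "matching_val E X (of_real y) = 0"
      using Y(2)[OF that] poly_cpoly_of_real[of q y] by (simp add: ev)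
    then show ?thesis using root_bound[OF assms(1)] by fastforce
  qed
  have "AE x in M. \<bar>x\<bar> \<le> real D + 1"
    using M(2) by eventually_elim (rule bound)
  moreover have "green E X {u} z = (\<integral>x. 1 / (z - of_real x) \<partial>M)" if "Im z > 0" for z
    using M(3)[of "\<lambda>x. 1 / (z - of_real x)"] g[OF that] by (simp add: scaleR_conv_of_real)
  moreover have "(\<integral>x. x ^ k \<partial>M) = real (path_tree_closed_walks (X, E) u k)" for k
    using M(4)[of "\<lambda>x. x ^ k"] mom[of k] by simp
  ultimately show ?thesis using M(1) by blast
qed

text \<open>Degrees are finite, so there are finitely many walks of length \<open>k\<close> and
  together they visit finitely many vertices.\<close>

lemma closed_walks_truncate:
  "\<forall>\<^sub>F n in sequentially. path_tree_closed_walks (V \<inter> {..n}, E) u k = path_tree_closed_walks (V, E) u k"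
proof -
  let ?W = "{ws \<in> walks V u k. last ws = [u]}"
  have "\<forall>\<^sub>F n in sequentially. \<forall>ws\<in>walks V u k. (\<Union>p\<in>set ws. set p) \<subseteq> {..n}"
  proof (rule eventually_ball_finite[OF finite_walks], rule ballI)
    fix ws assume "ws \<in> walks V u k"
    have "finite (\<Union>p\<in>set ws. set p)" by simp
    then obtain m where m: "(\<Union>p\<in>set ws. set p) \<subseteq> {..m}" by (meson finite_nat_iff_bounded_le)
    show "\<forall>\<^sub>F n in sequentially. (\<Union>p\<in>set ws. set p) \<subseteq> {..n}"
      using eventually_ge_at_top[of m] by eventually_elim (use m in force)
  qed
  then show ?thesis
  proof eventually_elim
    case (elim n)
    have "ws \<in> walks (V \<inter> {..n}) u k \<longleftrightarrow> ws \<in> walks V u k" for ws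
    proof
      assume "ws \<in> walks V u k"
      moreover have "p \<in> paths (V \<inter> {..n}) u" if "p \<in> set ws" for p
      proof -
        have "set p \<subseteq> {..n}" using elim that \<open>ws \<in> walks V u k\<close> by blast
        moreover have "p \<in> paths V u" using that \<open>ws \<in> walks V u k\<close> by (auto simp: walks_def)
        ultimately show ?thesis by (simp add: paths_iff)
      qed
      ultimately show "ws \<in> walks (V \<inter> {..n}) u k" by (auto simp: walks_def)
    next
      assume "ws \<in> walks (V \<inter> {..n}) u k"
      then show "ws \<in> walks V u k" by (auto simp: walks_def paths_iff)
    qed
    then show ?case unfolding closed_walks_eq by simp
  qed
qed

text \<open>The truncations have spectral measures on one compact interval with eventually constant
  moments, so the moment method yields a weak limit. It is the measure singled out by the
  \<open>THE\<close>, and weak convergence tested on the resolvent function gives the limit of the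
  Green functions.\<close>

theorem matching_measure_spectral:
  assumes u: "u \<in> V"
  shows "real_distribution (matching_measure (V, E) u)"
    and "AE x in matching_measure (V, E) u. \<bar>x\<bar> \<le> real D + 1"
    and "(\<integral>x. x ^ k \<partial>matching_measure (V, E) u) = real (path_tree_closed_walks (V, E) u k)"
    and "Im z > 0 \<Longrightarrow> (\<lambda>n. green E (V \<inter> {..n}) {u} z) \<longlonglongrightarrow> (\<integral>x. 1 / (z - of_real x) \<partial>matching_measure (V, E) u)"
proof -
  \<comment> \<open>The shift by \<open>u\<close> puts \<open>u\<close> into every truncation; it is
    undone at the end by \<open>LIMSEQ_offset\<close>.\<close>
  let ?X = "\<lambda>n. V \<inter> {..n + u}"
  have "\<forall>n. \<exists>M. real_distribution M \<and> (AE x in M. \<bar>x\<bar> \<le> real D + 1) \<and>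
    (\<forall>z. Im z > 0 \<longrightarrow> green E (?X n) {u} z = (\<integral>x. 1 / (z - of_real x) \<partial>M)) \<and>
    (\<forall>k. (\<integral>x. x ^ k \<partial>M) = real (path_tree_closed_walks (?X n, E) u k))"
    by (intro allI finite_spectral_measure) (use u in auto)
  then obtain \<mu> where \<mu>: "\<And>n. real_distribution (\<mu> n)" "\<And>n. AE x in \<mu> n. \<bar>x\<bar> \<le> real D + 1"
    "\<And>n z. Im z > 0 \<Longrightarrow> green E (?X n) {u} z = (\<integral>x. 1 / (z - of_real x) \<partial>\<mu> n)"
    "\<And>n k. (\<integral>x. x ^ k \<partial>\<mu> n) = real (path_tree_closed_walks (?X n, E) u k)"
    by metis
  have lim: "(\<lambda>n. \<integral>x. x ^ k \<partial>\<mu> n) \<longlonglongrightarrow> real (path_tree_closed_walks (V, E) u k)" for k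
  proof -
    have "(\<lambda>n. real (path_tree_closed_walks (V \<inter> {..n}, E) u k)) \<longlonglongrightarrow> real (path_tree_closed_walks (V, E) u k)"
      by (rule tendsto_eventually) (use closed_walks_truncate[of V u k] in eventually_elim, simp)
    from LIMSEQ_ignore_initial_segment[OF this, of u] show ?thesis unfolding \<mu>(4) .
  qed
  have "\<exists>M. real_distribution M \<and> (AE x in M. \<bar>x\<bar> \<le> real D + 1) \<and>
      (\<forall>k. (\<integral>x. x ^ k \<partial>M) = real (path_tree_closed_walks (V, E) u k)) \<and> weak_conv_m \<mu> M"
    by (rule moment_method[OF \<mu>(1,2) _ lim]) simp
  then obtain M where M: "real_distribution M" "AE x in M. \<bar>x\<bar> \<le> real D + 1"
    "\<And>k. (\<integral>x. x ^ k \<partial>M) = real (path_tree_closed_walks (V, E) u k)" "weak_conv_m \<mu> M"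
    by blast
  have eq: "matching_measure (V, E) u = M"
    unfolding matching_measure_def
  proof (rule the_equality)
    interpret M: real_distribution M by fact
    show "prob_space M \<and> sets M = sets borel \<and> (\<exists>C. AE x in M. \<bar>x\<bar> \<le> C) \<and>
      (\<forall>k. (\<integral>x. x ^ k \<partial>M) = real (path_tree_closed_walks (V, E) u k))"
      using M M.prob_space_axioms by auto
    fix N :: "real measure"
    assume N: "prob_space N \<and> sets N = sets borel \<and> (\<exists>C. AE x in N. \<bar>x\<bar> \<le> C) \<and>
      (\<forall>k. (\<integral>x. x ^ k \<partial>N) = real (path_tree_closed_walks (V, E) u k))"
    then have "real_distribution N"
      by (simp add: real_distribution_def real_distribution_axioms_def)
    then show "N = M"
      using N M(1,2,3) by (auto intro: moments_determine_distribution)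
  qed
  show "real_distribution (matching_measure (V, E) u)" "AE x in matching_measure (V, E) u. \<bar>x\<bar> \<le> real D + 1"
    "(\<integral>x. x ^ k \<partial>matching_measure (V, E) u) = real (path_tree_closed_walks (V, E) u k)"
    unfolding eq by (rule M)+
  assume z: "Im z > 0"
  have "(\<lambda>n. \<integral>x. 1 / (z - of_real x) \<partial>\<mu> n) \<longlonglongrightarrow> (\<integral>x. 1 / (z - of_real x) \<partial>M)"
  proof (rule weak_conv_imp_integral_bdd_continuous_conv[OF \<mu>(1) M(1,4)])
    show "isCont (\<lambda>x. 1 / (z - complex_of_real x)) x" for x
      using z by (intro continuous_intros) (auto simp: complex_eq_iff)
    show "norm (1 / (z - complex_of_real x)) \<le> 1 / \<bar>Im z\<bar>" for x
      using cmod_resolvent_le[of "Im z" "Re z" x] z by simp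
  qed
  then have "(\<lambda>n. green E (?X n) {u} z) \<longlonglongrightarrow> (\<integral>x. 1 / (z - of_real x) \<partial>M)"
    using \<mu>(3)[OF z] by simp
  then show "(\<lambda>n. green E (V \<inter> {..n}) {u} z) \<longlonglongrightarrow> (\<integral>x. 1 / (z - of_real x) \<partial>matching_measure (V, E) u)"
    unfolding eq by (rule LIMSEQ_offset)
qed

end

section \<open>Green functions of infinite graphs\<close>

definition green_lim :: "(nat \<Rightarrow> nat \<Rightarrow> bool) \<Rightarrow> nat set \<Rightarrow> nat set \<Rightarrow> complex \<Rightarrow> complex" where
  "green_lim E V L z = lim (\<lambda>n. green E (V \<inter> {..n}) L z)"

context bounded_graph
begin

lemma truncate_Diff: "V \<inter> {..n} - B = (V - B) \<inter> {..n}" for V :: "nat set"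
  by auto

lemma eventually_truncate:
  assumes "finite L" "L \<subseteq> (V::nat set)"
  shows "\<forall>\<^sub>F n in sequentially. L \<subseteq> V \<inter> {..n}"
proof -
  obtain m where "L \<subseteq> {..m}" using assms(1) finite_nat_iff_bounded_le by blast
  then have "L \<subseteq> V \<inter> {..n}" if "n \<ge> m" for n
    using assms(2) that by (meson atMost_subset_iff le_inf_iff order.trans)
  then show ?thesis
    unfolding eventually_sequentially by blast
qed

text \<open>Telescoping reduces to single vertices, where the spectral measure supplies the limit.
  This justifies the use of \<open>lim\<close> in \<open>green_lim\<close>.\<close>

lemma green_convergent:
  assumes "finite L" "L \<subseteq> V" "Im z > 0"
  shows "convergent (\<lambda>n. green E (V \<inter> {..n}) L z)"
  using assms(1,2)
proof (induction L arbitrary: V rule: finite_induct)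
  case empty
  then show ?case by (simp add: matching_val_nonzero assms(3) convergent_const)
next
  case (insert u L)
  have "green E (V \<inter> {..n}) (insert u L) z = green E (V \<inter> {..n}) {u} z * green E ((V - {u}) \<inter> {..n}) L z" for n
    using green_Cons[of "V \<inter> {..n}" z u L] assms(3) by (simp add: truncate_Diff)
  moreover have "convergent (\<lambda>n. green E ((V - {u}) \<inter> {..n}) L z)"
    using insert by (intro insert.IH) auto
  moreover have "convergent (\<lambda>n. green E (V \<inter> {..n}) {u} z)"
    using matching_measure_spectral(4)[OF _ assms(3), of u V] insert.prems by (auto simp: convergent_def)
  ultimately show ?case by (simp add: convergent_mult)
qed

lemma green_tendsto:
  assumes "finite L" "L \<subseteq> V" "Im z > 0"
  shows "(\<lambda>n. green E (V \<inter> {..n}) L z) \<longlonglongrightarrow> green_lim E V L z"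
  using green_convergent[OF assms] unfolding green_lim_def by (simp add: convergent_LIMSEQ_iff)

lemma green_lim_mult:
  assumes "finite K" "finite L" "K \<subseteq> V" "L \<subseteq> V - K" "Im z > 0"
  shows "green_lim E V K z * green_lim E (V - K) L z = green_lim E V (K \<union> L) z"
proof (rule LIMSEQ_unique)
  show "(\<lambda>n. green E (V \<inter> {..n}) K z * green E ((V - K) \<inter> {..n}) L z) \<longlonglongrightarrow> green_lim E V K z * green_lim E (V - K) L z"
    using assms by (intro tendsto_mult green_tendsto)
  have "green E (V \<inter> {..n}) K z * green E ((V - K) \<inter> {..n}) L z = green E (V \<inter> {..n}) (K \<union> L) z" for n
    using green_mult[of "V \<inter> {..n}" K z L] assms(5) by (simp add: truncate_Diff matching_val_nonzero)
  then show "(\<lambda>n. green E (V \<inter> {..n}) K z * green E ((V - K) \<inter> {..n}) L z) \<longlonglongrightarrow> green_lim E V (K \<union> L) z"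
    using green_tendsto[of "K \<union> L" V z] assms by auto
qed

lemma green_lim_finite:
  assumes "finite X" "finite L" "L \<subseteq> X" "Im z > 0"
  shows "green_lim E X L z = green E X L z"
proof (rule LIMSEQ_unique[OF green_tendsto[OF assms(2-4)]])
  show "(\<lambda>n. green E (X \<inter> {..n}) L z) \<longlonglongrightarrow> green E X L z"
  proof (rule tendsto_eventually)
    show "\<forall>\<^sub>F n in sequentially. green E (X \<inter> {..n}) L z = green E X L z"
      using eventually_truncate[OF assms(1) subset_refl]
      by eventually_elim (metis Int_lower1 subset_antisym)
  qed
qed

lemma green_lim_eq_Stieltjes:
  "u \<in> V \<Longrightarrow> Im z > 0 \<Longrightarrow> green_lim E V {u} z = (\<integral>x. 1 / (z - of_real x) \<partial>matching_measure (V, E) u)"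
  using LIMSEQ_unique[OF green_tendsto matching_measure_spectral(4)] by auto

text \<open>Written as a product equal to 1, so that the nonvanishing of the limit Green function is
  a consequence and not a premise.\<close>

lemma green_lim_rec:
  assumes "u \<in> V" "Im z > 0"
  shows "green_lim E V {u} z * (z - (\<Sum>v\<in>{v\<in>V - {u}. E u v}. green_lim E (V - {u}) {v} z)) = 1"
proof (rule LIMSEQ_unique)
  let ?N = "{v\<in>V - {u}. E u v}"
  show "(\<lambda>n. green E (V \<inter> {..n}) {u} z * (z - (\<Sum>v\<in>?N. green E ((V - {u}) \<inter> {..n}) {v} z))) \<longlonglongrightarrow>
     green_lim E V {u} z * (z - (\<Sum>v\<in>?N. green_lim E (V - {u}) {v} z))"
    using assms by (intro tendsto_intros green_tendsto) auto
  show "(\<lambda>n. green E (V \<inter> {..n}) {u} z * (z - (\<Sum>v\<in>?N. green E ((V - {u}) \<inter> {..n}) {v} z))) \<longlonglongrightarrow> 1"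
  proof (rule tendsto_eventually)
    have "insert u ?N \<subseteq> V" using assms by auto
    then have "\<forall>\<^sub>F n in sequentially. insert u ?N \<subseteq> V \<inter> {..n}"
      by (intro eventually_truncate) auto
    then show "\<forall>\<^sub>F n in sequentially. green E (V \<inter> {..n}) {u} z * (z - (\<Sum>v\<in>?N. green E ((V - {u}) \<inter> {..n}) {v} z)) = 1"
    proof eventually_elim
      case (elim n)
      have "{v \<in> V \<inter> {..n} - {u}. E u v} = ?N" using elim by auto
      then have "inverse (green E (V \<inter> {..n}) {u} z) = z - (\<Sum>v\<in>?N. green E ((V - {u}) \<inter> {..n}) {v} z)"
        using inverse_green[of "V \<inter> {..n}" u z] elim assms by (simp add: matching_val_nonzero truncate_Diff)
      moreover have "green E (V \<inter> {..n}) {u} z \<noteq> 0"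
        using Im_green_neg[of "V \<inter> {..n}" z u] elim assms by auto
      ultimately show ?case by (metis right_inverse)
    qed
  qed
qed

definition green_lim_norm :: "nat set \<Rightarrow> nat \<Rightarrow> complex \<Rightarrow> real" where
  "green_lim_norm V v z = sqrt (- Im (green_lim E V {v} z) / Im z)"

lemma green_norm_tendsto:
  "v \<in> V \<Longrightarrow> Im z > 0 \<Longrightarrow> (\<lambda>n. green_norm E (V \<inter> {..n}) v z) \<longlonglongrightarrow> green_lim_norm V v z"
  unfolding green_norm_def green_lim_norm_def by (intro tendsto_intros green_tendsto) auto

text \<open>Once the truncation contains \<open>w\<close> and \<open>B\<close>, the two truncated
  vertex sets differ exactly by \<open>B\<close>, so the sum in the finite bound does not grow with
  \<open>n\<close> and the inequality passes to the limit.\<close>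

lemma norm_green_lim_diff_le:
  assumes "finite B" "B \<subseteq> V" "w \<in> V - B" "Im z1 > 0" "Im z2 > 0"
  shows "norm (green_lim E V {w} z1 - green_lim E (V - B) {w} z2) \<le>
    norm (z2 - z1) * (green_lim_norm V w z1 * green_lim_norm (V - B) w z2)
    + (\<Sum>v\<in>B. green_lim_norm V v z1 * green_lim_norm (V - B) w z2)"
proof (rule tendsto_le[OF sequentially_bot])
  show "(\<lambda>n. norm (z2 - z1) * (green_norm E (V \<inter> {..n}) w z1 * green_norm E ((V - B) \<inter> {..n}) w z2)
    + (\<Sum>v\<in>B. green_norm E (V \<inter> {..n}) v z1 * green_norm E ((V - B) \<inter> {..n}) w z2)) \<longlonglongrightarrow>
    norm (z2 - z1) * (green_lim_norm V w z1 * green_lim_norm (V - B) w z2)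
    + (\<Sum>v\<in>B. green_lim_norm V v z1 * green_lim_norm (V - B) w z2)"
    using assms by (intro tendsto_intros green_norm_tendsto) auto
  show "(\<lambda>n. norm (green E (V \<inter> {..n}) {w} z1 - green E ((V - B) \<inter> {..n}) {w} z2)) \<longlonglongrightarrow>
      norm (green_lim E V {w} z1 - green_lim E (V - B) {w} z2)"
    using assms by (intro tendsto_intros green_tendsto) auto
  have "\<forall>\<^sub>F n in sequentially. insert w B \<subseteq> V \<inter> {..n}"
    using assms by (intro eventually_truncate) auto
  then show "\<forall>\<^sub>F n in sequentially. norm (green E (V \<inter> {..n}) {w} z1 - green E ((V - B) \<inter> {..n}) {w} z2) \<le>
     norm (z2 - z1) * (green_norm E (V \<inter> {..n}) w z1 * green_norm E ((V - B) \<inter> {..n}) w z2)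
    + (\<Sum>v\<in>B. green_norm E (V \<inter> {..n}) v z1 * green_norm E ((V - B) \<inter> {..n}) w z2)"
  proof eventually_elim
    case (elim n)
    then have "V \<inter> {..n} - (V - B) \<inter> {..n} = B" by auto
    then show ?case
      using norm_green_diff_le[of "V \<inter> {..n}" "(V - B) \<inter> {..n}" w z1 z2] assms elim by auto
  qed
qed

lemma Heilmann_Lieb_lim_le:
  assumes "u \<in> V" "finite F" "F \<subseteq> V - {u}" "Im z > 0"
  shows "(norm (green_lim E V {u} z))\<^sup>2 + (\<Sum>w\<in>F. norm (green_lim E V {u} z) *
      norm (green_lim E V {w} z - green_lim E (V - {u}) {w} z))
    \<le> - Im (green_lim E V {u} z) / Im z"
proof (rule tendsto_le[OF sequentially_bot])
  show "(\<lambda>n. - Im (green E (V \<inter> {..n}) {u} z) / Im z) \<longlonglongrightarrow> - Im (green_lim E V {u} z) / Im z"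
    using assms by (intro tendsto_intros green_tendsto) auto
  show "(\<lambda>n. (norm (green E (V \<inter> {..n}) {u} z))\<^sup>2 + (\<Sum>w\<in>F. norm (green E (V \<inter> {..n}) {u} z) *
      norm (green E (V \<inter> {..n}) {w} z - green E ((V - {u}) \<inter> {..n}) {w} z))) \<longlonglongrightarrow>
     (norm (green_lim E V {u} z))\<^sup>2 + (\<Sum>w\<in>F. norm (green_lim E V {u} z) *
      norm (green_lim E V {w} z - green_lim E (V - {u}) {w} z))"
    using assms by (intro tendsto_intros green_tendsto) auto
  have "\<forall>\<^sub>F n in sequentially. insert u F \<subseteq> V \<inter> {..n}"
    using assms by (intro eventually_truncate) auto
  then show "\<forall>\<^sub>F n in sequentially. (norm (green E (V \<inter> {..n}) {u} z))\<^sup>2 + (\<Sum>w\<in>F. norm (green E (V \<inter> {..n}) {u} z) *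
      norm (green E (V \<inter> {..n}) {w} z - green E ((V - {u}) \<inter> {..n}) {w} z)) \<le> - Im (green E (V \<inter> {..n}) {u} z) / Im z"
  proof eventually_elim
    case (elim n)
    then have "F \<subseteq> V \<inter> {..n} - {u}" using assms(3) by auto
    then show ?case
      using Heilmann_Lieb_le[of "V \<inter> {..n}" u F z] assms elim by (simp add: truncate_Diff)
  qed
qed

lemma norm_green_lim_three_le:
  assumes "u \<in> V" "v \<in> V" "w \<in> V" "u \<noteq> v" "u \<noteq> w" "v \<noteq> w" and z: "Im z > 0"
  shows "norm (green_lim E V {u} z) * norm (green_lim E V {v} z) *
      norm (green_lim E (V - {u}) {w} z - green_lim E (V - {v}) {w} z) \<le>
    norm (green_lim E V {u} z) * (green_lim_norm (V - {u}) v z * green_lim_norm V v z) +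
    norm (green_lim E V {v} z) * (green_lim_norm (V - {v}) u z * green_lim_norm V u z)"
proof (rule tendsto_le[OF sequentially_bot])
  let ?X = "\<lambda>n. V \<inter> {..n}"
  show "(\<lambda>n. norm (green E (?X n) {u} z) * (green_norm E ((V - {u}) \<inter> {..n}) v z * green_norm E (?X n) v z) +
      norm (green E (?X n) {v} z) * (green_norm E ((V - {v}) \<inter> {..n}) u z * green_norm E (?X n) u z)) \<longlonglongrightarrow>
    norm (green_lim E V {u} z) * (green_lim_norm (V - {u}) v z * green_lim_norm V v z) +
    norm (green_lim E V {v} z) * (green_lim_norm (V - {v}) u z * green_lim_norm V u z)"
    using assms by (intro tendsto_intros green_tendsto green_norm_tendsto) auto
  show "(\<lambda>n. norm (green E (?X n) {u} z) * norm (green E (?X n) {v} z) *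
      norm (green E ((V - {u}) \<inter> {..n}) {w} z - green E ((V - {v}) \<inter> {..n}) {w} z)) \<longlonglongrightarrow>
    norm (green_lim E V {u} z) * norm (green_lim E V {v} z) *
      norm (green_lim E (V - {u}) {w} z - green_lim E (V - {v}) {w} z)"
    using assms by (intro tendsto_intros green_tendsto) auto
  have "\<forall>\<^sub>F n in sequentially. {u, v, w} \<subseteq> ?X n"
    using assms by (intro eventually_truncate) auto
  then show "\<forall>\<^sub>F n in sequentially. norm (green E (?X n) {u} z) * norm (green E (?X n) {v} z) *
      norm (green E ((V - {u}) \<inter> {..n}) {w} z - green E ((V - {v}) \<inter> {..n}) {w} z) \<le>
      norm (green E (?X n) {u} z) * (green_norm E ((V - {u}) \<inter> {..n}) v z * green_norm E (?X n) v z) +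
      norm (green E (?X n) {v} z) * (green_norm E ((V - {v}) \<inter> {..n}) u z * green_norm E (?X n) u z)"
  proof eventually_elim
    case (elim n)
    then show ?case
      using norm_green_three_le[of "?X n" u v w z] assms by (simp add: truncate_Diff)
  qed
qed

end

section \<open>Atoms and essential vertices\<close>

locale bounded_graph_at = bounded_graph E D for E D +
  fixes \<theta> :: real
begin

definition gl :: "nat set \<Rightarrow> nat set \<Rightarrow> real \<Rightarrow> complex" where
  "gl V L t = green_lim E V L (Complex \<theta> t)"

definition atom :: "nat set \<Rightarrow> nat \<Rightarrow> real" where
  "atom V u = measure (matching_measure (V, E) u) {\<theta>}"

lemma atom_nonneg [simp]: "atom V u \<ge> 0"
  by (simp add: atom_def)

lemma at_right_0_pos: "\<forall>\<^sub>F t in at_right 0. (t::real) > 0"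
  by (rule eventually_at_right_less)

lemma gl_atom: "u \<in> V \<Longrightarrow> ((\<lambda>t. \<i> * of_real t * gl V {u} t) \<longlongrightarrow> of_real (atom V u)) (at_right 0)"
proof -
  assume u: "u \<in> V"
  show ?thesis
    unfolding atom_def
  proof (rule Lim_transform_eventually[OF tendsto_Stieltjes_atom[OF matching_measure_spectral(1)[OF u]]])
    show "\<forall>\<^sub>F t in at_right 0. \<i> * of_real t * (\<integral>x. 1 / (Complex \<theta> t - of_real x) \<partial>matching_measure (V, E) u) =
        \<i> * of_real t * gl V {u} t"
      using at_right_0_pos
      by eventually_elim (simp add: gl_def green_lim_eq_Stieltjes[OF u])
  qed
qed

lemma gl_atom': "u \<in> V \<Longrightarrow> ((\<lambda>t. of_real t * gl V {u} t) \<longlongrightarrow> of_real (atom V u) / \<i>) (at_right 0)"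
  using tendsto_divide[OF gl_atom tendsto_const[of "\<i>"], of u V] by (simp add: mult.assoc)

lemma norm_gl_atom: "u \<in> V \<Longrightarrow> ((\<lambda>t. t * norm (gl V {u} t)) \<longlongrightarrow> atom V u) (at_right 0)"
proof (rule Lim_transform_eventually)
  assume u: "u \<in> V"
  show "((\<lambda>t. norm (\<i> * of_real t * gl V {u} t)) \<longlongrightarrow> atom V u) (at_right 0)"
    using tendsto_norm[OF gl_atom[OF u]] by simp
  show "\<forall>\<^sub>F t in at_right 0. norm (\<i> * of_real t * gl V {u} t) = t * norm (gl V {u} t)"
    using at_right_0_pos by eventually_elim (simp add: norm_mult)
qed

lemma Im_gl_atom: "u \<in> V \<Longrightarrow> ((\<lambda>t. - t * Im (gl V {u} t)) \<longlongrightarrow> atom V u) (at_right 0)"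
  using tendsto_Re[OF gl_atom, of u V] by simp

definition gn :: "nat set \<Rightarrow> nat \<Rightarrow> real \<Rightarrow> real" where
  "gn V u t = green_lim_norm V u (Complex \<theta> t)"

text \<open>The square of \<open>gn\<close> is \<open>- Im gl / t\<close>. So \<open>gn\<close>
  grows like \<open>1 / t\<close> at a vertex with an atom and more slowly at any other, which is
  how vertices without an atom drop out of the estimates.\<close>

lemma gn_atom: "u \<in> V \<Longrightarrow> ((\<lambda>t. t * gn V u t) \<longlongrightarrow> sqrt (atom V u)) (at_right 0)"
proof (rule Lim_transform_eventually)
  assume u: "u \<in> V"
  show "((\<lambda>t. sqrt (- t * Im (gl V {u} t))) \<longlongrightarrow> sqrt (atom V u)) (at_right 0)"
    by (intro tendsto_real_sqrt Im_gl_atom u)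
  show "\<forall>\<^sub>F t in at_right 0. sqrt (- t * Im (gl V {u} t)) = t * gn V u t"
    using at_right_0_pos
  proof eventually_elim
    case (elim t)
    then have "- t * Im (gl V {u} t) = t\<^sup>2 * (- Im (gl V {u} t) / t)" by (simp add: power2_eq_square)
    then show ?case
      using elim by (simp only: real_sqrt_mult) (simp add: gn_def green_lim_norm_def gl_def)
  qed
qed

lemma gl_diff_le:
  assumes "finite B" "B \<subseteq> V" "w \<in> V - B" "t > 0" "s > 0"
  shows "norm (gl V {w} t - gl (V - B) {w} s) \<le>
    \<bar>s - t\<bar> * (gn V w t * gn (V - B) w s) + (\<Sum>v\<in>B. gn V v t * gn (V - B) w s)"
proof -
  have "Complex \<theta> s - Complex \<theta> t = \<i> * of_real (s - t)" by (simp add: complex_eq_iff)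
  then have "norm (Complex \<theta> s - Complex \<theta> t) = \<bar>s - t\<bar>" by (simp only: norm_mult norm_of_real norm_ii) simp
  then show ?thesis
    using norm_green_lim_diff_le[OF assms(1-3), of "Complex \<theta> t" "Complex \<theta> s"] assms(4,5)
    by (simp add: gl_def gn_def)
qed

text \<open>First let the spectral parameter of the large graph tend to \<open>\<theta>\<close>: the vertices of
  \<open>B\<close> then stop contributing. Only afterwards does the parameter of the small graph tend to \<open>\<theta>\<close>.\<close>

lemma atom_mono_delete:
  assumes "finite B" "B \<subseteq> V" "w \<in> V - B" "\<And>v. v \<in> B \<Longrightarrow> atom V v = 0"
  shows "atom V w \<le> atom (V - B) w"
proof (cases "atom V w = 0")
  case False
  let ?a = "atom V w"
  have le: "?a \<le> sqrt ?a * (s * gn (V - B) w s)" if s: "s > 0" for s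
  proof (rule tendsto_le[OF trivial_limit_at_right_real])
    show "((\<lambda>t. t * norm (gl V {w} t) - t * norm (gl (V - B) {w} s)) \<longlongrightarrow> ?a) (at_right 0)"
    proof -
      have "((\<lambda>t. t * norm (gl V {w} t) - t * norm (gl (V - B) {w} s)) \<longlongrightarrow> ?a - 0 * norm (gl (V - B) {w} s)) (at_right 0)"
        using assms(3) by (intro tendsto_intros norm_gl_atom) auto
      then show ?thesis by simp
    qed
    show "((\<lambda>t. \<bar>s - t\<bar> * ((t * gn V w t) * gn (V - B) w s) + (\<Sum>v\<in>B. (t * gn V v t) * gn (V - B) w s))
        \<longlongrightarrow> sqrt ?a * (s * gn (V - B) w s)) (at_right 0)"
    proof -
      have "((\<lambda>t. \<bar>s - t\<bar> * ((t * gn V w t) * gn (V - B) w s) + (\<Sum>v\<in>B. (t * gn V v t) * gn (V - B) w s))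
        \<longlongrightarrow> \<bar>s - 0\<bar> * (sqrt ?a * gn (V - B) w s) + (\<Sum>v\<in>B. sqrt (atom V v) * gn (V - B) w s)) (at_right 0)"
        using assms by (intro tendsto_intros gn_atom) auto
      then show ?thesis using s assms(4) by (simp add: mult_ac)
    qed
    show "\<forall>\<^sub>F t in at_right 0. t * norm (gl V {w} t) - t * norm (gl (V - B) {w} s) \<le>
        \<bar>s - t\<bar> * ((t * gn V w t) * gn (V - B) w s) + (\<Sum>v\<in>B. (t * gn V v t) * gn (V - B) w s)"
      using at_right_0_pos
    proof eventually_elim
      case (elim t)
      have "t * norm (gl V {w} t) - t * norm (gl (V - B) {w} s) \<le> t * norm (gl V {w} t - gl (V - B) {w} s)"
        using elim norm_triangle_ineq2[of "gl V {w} t" "gl (V - B) {w} s"]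
        by (simp flip: right_diff_distrib)
      also have "\<dots> \<le> t * (\<bar>s - t\<bar> * (gn V w t * gn (V - B) w s) + (\<Sum>v\<in>B. gn V v t * gn (V - B) w s))"
        using elim s assms by (intro mult_left_mono gl_diff_le) auto
      finally show ?case by (simp add: algebra_simps sum_distrib_left)
    qed
  qed
  have "?a \<le> sqrt ?a * sqrt (atom (V - B) w)"
  proof (rule tendsto_lowerbound)
    show "((\<lambda>s. sqrt ?a * (s * gn (V - B) w s)) \<longlongrightarrow> sqrt ?a * sqrt (atom (V - B) w)) (at_right 0)"
      using assms(3) by (intro tendsto_intros gn_atom) auto
    show "\<forall>\<^sub>F s in at_right 0. ?a \<le> sqrt ?a * (s * gn (V - B) w s)"
      using at_right_0_pos by eventually_elim (rule le)
  qed simp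
  then have "sqrt ?a * sqrt ?a \<le> sqrt ?a * sqrt (atom (V - B) w)" by simp
  moreover have "sqrt ?a > 0" using False atom_nonneg[of V w] by (simp add: order_less_le)
  ultimately show ?thesis by (simp only: mult_le_cancel_left_pos real_sqrt_le_iff)
qed simp

text \<open>The finite inequality multiplied by \<open>t^2\<close>. Divided by a positive
  \<open>atom V u\<close>, it says that the atom at \<open>u\<close> plus the total change of the
  other atoms when \<open>u\<close> is deleted is at most 1.\<close>

lemma Heilmann_Lieb_atom:
  assumes "u \<in> V" "finite F" "F \<subseteq> V - {u}"
  shows "(atom V u)\<^sup>2 + (\<Sum>w\<in>F. atom V u * \<bar>atom V w - atom (V - {u}) w\<bar>) \<le> atom V u"
proof (rule tendsto_le[OF trivial_limit_at_right_real])
  show "((\<lambda>t. - t * Im (gl V {u} t)) \<longlongrightarrow> atom V u) (at_right 0)" by (rule Im_gl_atom[OF assms(1)])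
  show "((\<lambda>t. (t * norm (gl V {u} t))\<^sup>2 + (\<Sum>w\<in>F. (t * norm (gl V {u} t)) *
       norm (\<i> * of_real t * gl V {w} t - \<i> * of_real t * gl (V - {u}) {w} t))) \<longlongrightarrow>
     (atom V u)\<^sup>2 + (\<Sum>w\<in>F. atom V u * \<bar>atom V w - atom (V - {u}) w\<bar>)) (at_right 0)"
  proof -
    have e: "\<bar>atom V w - atom (V - {u}) w\<bar> = norm (complex_of_real (atom V w) - of_real (atom (V - {u}) w))" for w
      by (metis norm_of_real of_real_diff)
    show ?thesis unfolding e
      using assms by (intro tendsto_intros norm_gl_atom gl_atom) auto
  qed
  show "\<forall>\<^sub>F t in at_right 0. (t * norm (gl V {u} t))\<^sup>2 + (\<Sum>w\<in>F. (t * norm (gl V {u} t)) *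
       norm (\<i> * of_real t * gl V {w} t - \<i> * of_real t * gl (V - {u}) {w} t)) \<le> - t * Im (gl V {u} t)"
    using at_right_0_pos
  proof eventually_elim
    case (elim t)
    have "norm (\<i> * of_real t * gl V {w} t - \<i> * of_real t * gl (V - {u}) {w} t) =
        t * norm (gl V {w} t - gl (V - {u}) {w} t)" for w
      using elim by (simp add: norm_mult flip: right_diff_distrib)
    then have "(t * norm (gl V {u} t))\<^sup>2 + (\<Sum>w\<in>F. (t * norm (gl V {u} t)) *
       norm (\<i> * of_real t * gl V {w} t - \<i> * of_real t * gl (V - {u}) {w} t)) =
      t\<^sup>2 * ((norm (gl V {u} t))\<^sup>2 + (\<Sum>w\<in>F. norm (gl V {u} t) * norm (gl V {w} t - gl (V - {u}) {w} t)))"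
      by (simp add: algebra_simps power2_eq_square sum_distrib_left)
    also have "\<dots> \<le> t\<^sup>2 * (- Im (gl V {u} t) / t)"
      using Heilmann_Lieb_lim_le[OF assms, of "Complex \<theta> t"] elim
      by (intro mult_left_mono) (auto simp: gl_def)
    also have "\<dots> = - t * Im (gl V {u} t)" using elim by (simp add: power2_eq_square)
    finally show ?case .
  qed
qed

text \<open>The finite inequality multiplied by \<open>t^3\<close>. If \<open>u\<close> and
  \<open>v\<close> have atoms but each loses its atom when the other is deleted, the right side is
  0, so \<open>w\<close> has the same atom after deleting \<open>u\<close> as after deleting
  \<open>v\<close>.\<close>

lemma atom_three_le:
  assumes "u \<in> V" "v \<in> V" "w \<in> V" "u \<noteq> v" "u \<noteq> w" "v \<noteq> w"
  shows "atom V u * atom V v * \<bar>atom (V - {u}) w - atom (V - {v}) w\<bar> \<le>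
    atom V u * (sqrt (atom (V - {u}) v) * sqrt (atom V v)) + atom V v * (sqrt (atom (V - {v}) u) * sqrt (atom V u))"
proof (rule tendsto_le[OF trivial_limit_at_right_real])
  show "((\<lambda>t. (t * norm (gl V {u} t)) * ((t * gn (V - {u}) v t) * (t * gn V v t)) +
      (t * norm (gl V {v} t)) * ((t * gn (V - {v}) u t) * (t * gn V u t))) \<longlongrightarrow>
    atom V u * (sqrt (atom (V - {u}) v) * sqrt (atom V v)) + atom V v * (sqrt (atom (V - {v}) u) * sqrt (atom V u))) (at_right 0)"
    using assms by (intro tendsto_intros norm_gl_atom gn_atom) auto
  show "((\<lambda>t. (t * norm (gl V {u} t)) * (t * norm (gl V {v} t)) *
      norm (\<i> * of_real t * gl (V - {u}) {w} t - \<i> * of_real t * gl (V - {v}) {w} t)) \<longlongrightarrow>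
    atom V u * atom V v * \<bar>atom (V - {u}) w - atom (V - {v}) w\<bar>) (at_right 0)"
  proof -
    have e: "\<bar>atom (V - {u}) w - atom (V - {v}) w\<bar> = norm (complex_of_real (atom (V - {u}) w) - of_real (atom (V - {v}) w))"
      by (metis norm_of_real of_real_diff)
    show ?thesis unfolding e
      using assms by (intro tendsto_intros norm_gl_atom gl_atom) auto
  qed
  show "\<forall>\<^sub>F t in at_right 0. (t * norm (gl V {u} t)) * (t * norm (gl V {v} t)) *
      norm (\<i> * of_real t * gl (V - {u}) {w} t - \<i> * of_real t * gl (V - {v}) {w} t) \<le>
     (t * norm (gl V {u} t)) * ((t * gn (V - {u}) v t) * (t * gn V v t)) +
      (t * norm (gl V {v} t)) * ((t * gn (V - {v}) u t) * (t * gn V u t))"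
    using at_right_0_pos
  proof eventually_elim
    case (elim t)
    have "norm (\<i> * of_real t * gl (V - {u}) {w} t - \<i> * of_real t * gl (V - {v}) {w} t) =
        t * norm (gl (V - {u}) {w} t - gl (V - {v}) {w} t)"
      using elim by (simp add: norm_mult flip: right_diff_distrib)
    then have "(t * norm (gl V {u} t)) * (t * norm (gl V {v} t)) *
      norm (\<i> * of_real t * gl (V - {u}) {w} t - \<i> * of_real t * gl (V - {v}) {w} t) =
      t ^ 3 * (norm (gl V {u} t) * norm (gl V {v} t) * norm (gl (V - {u}) {w} t - gl (V - {v}) {w} t))"
      by (simp add: power3_eq_cube)
    also have "\<dots> \<le> t ^ 3 * (norm (gl V {u} t) * (gn (V - {u}) v t * gn V v t) +
      norm (gl V {v} t) * (gn (V - {v}) u t * gn V u t))"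
      using norm_green_lim_three_le[OF assms, of "Complex \<theta> t"] elim
      by (intro mult_left_mono) (auto simp: gl_def gn_def)
    also have "\<dots> = (t * norm (gl V {u} t)) * ((t * gn (V - {u}) v t) * (t * gn V v t)) +
      (t * norm (gl V {v} t)) * ((t * gn (V - {v}) u t) * (t * gn V u t))"
      by (simp add: power3_eq_cube algebra_simps)
    finally show ?case .
  qed
qed

section \<open>Mass on the neighbours of a deleted vertex, and transport\<close>

definition nbr_mass :: "nat set \<Rightarrow> nat \<Rightarrow> real" where
  "nbr_mass V a = (\<Sum>v\<in>{v\<in>V - {a}. E a v}. atom (V - {a}) v)"

lemma nbr_mass_nonneg: "nbr_mass V a \<ge> 0"
  unfolding nbr_mass_def by (intro sum_nonneg) simp

lemma nbr_mass_pos: "E a v \<Longrightarrow> v \<in> V - {a} \<Longrightarrow> atom (V - {a}) v > 0 \<Longrightarrow> nbr_mass V a > 0"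
  unfolding nbr_mass_def by (rule sum_pos2[of _ v]) auto

lemma gl_rec: "u \<in> V \<Longrightarrow> t > 0 \<Longrightarrow>
    gl V {u} t * (Complex \<theta> t - (\<Sum>v\<in>{v\<in>V - {u}. E u v}. gl (V - {u}) {v} t)) = 1"
  unfolding gl_def by (rule green_lim_rec) auto

lemma gl_nonzero: "u \<in> V \<Longrightarrow> t > 0 \<Longrightarrow> gl V {u} t \<noteq> 0"
  using gl_rec[of u V t] by auto

text \<open>In \<open>t\<close> times the recursion for \<open>1 / gl\<close> only the atoms of the
  neighbours in \<open>V - {a}\<close> survive. A positive limit makes \<open>gl V {a} t\<close> of
  order \<open>t\<close>, the opposite extreme of an atom at \<open>a\<close>.\<close>

lemma inverse_gl_tendsto:
  assumes "a \<in> V"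
  shows "((\<lambda>t. of_real t / gl V {a} t) \<longlongrightarrow> \<i> * of_real (nbr_mass V a)) (at_right 0)"
proof (rule Lim_transform_eventually)
  let ?N = "{v\<in>V - {a}. E a v}"
  have "((\<lambda>t. of_real t * Complex \<theta> t - (\<Sum>v\<in>?N. of_real t * gl (V - {a}) {v} t)) \<longlongrightarrow>
      of_real 0 * Complex \<theta> 0 - (\<Sum>v\<in>?N. of_real (atom (V - {a}) v) / \<i>)) (at_right 0)"
    by (intro tendsto_intros tendsto_Complex gl_atom') auto
  also have "of_real 0 * Complex \<theta> 0 - (\<Sum>v\<in>?N. of_real (atom (V - {a}) v) / \<i>) = \<i> * of_real (nbr_mass V a)"
    by (simp add: nbr_mass_def sum_negf sum_distrib_left)
  finally show "((\<lambda>t. of_real t * Complex \<theta> t - (\<Sum>v\<in>?N. of_real t * gl (V - {a}) {v} t)) \<longlongrightarrow> \<i> * of_real (nbr_mass V a)) (at_right 0)" .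
  show "\<forall>\<^sub>F t in at_right 0. of_real t * Complex \<theta> t - (\<Sum>v\<in>?N. of_real t * gl (V - {a}) {v} t) = of_real t / gl V {a} t"
    using at_right_0_pos
  proof eventually_elim
    case (elim t)
    then have "1 / gl V {a} t = Complex \<theta> t - (\<Sum>v\<in>?N. gl (V - {a}) {v} t)"
      using gl_rec[OF assms elim] gl_nonzero[OF assms elim] by (simp add: field_simps)
    then have "of_real t / gl V {a} t = of_real t * (Complex \<theta> t - (\<Sum>v\<in>?N. gl (V - {a}) {v} t))"
      by (metis times_divide_eq_right mult.right_neutral)
    then show ?case by (simp add: right_diff_distrib sum_distrib_left)
  qed
qed

lemma gl_over_t_tendsto:
  assumes "a \<in> V" "nbr_mass V a > 0"
  shows "((\<lambda>t. \<i> * gl V {a} t / of_real t) \<longlongrightarrow> of_real (1 / nbr_mass V a)) (at_right 0)"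
proof -
  have "((\<lambda>t. \<i> / (of_real t / gl V {a} t)) \<longlongrightarrow> \<i> / (\<i> * of_real (nbr_mass V a))) (at_right 0)"
    using assms by (intro tendsto_intros inverse_gl_tendsto) auto
  then show ?thesis by simp
qed

lemma atom_eq_0_if_nbr_mass:
  assumes "a \<in> V" "nbr_mass V a > 0"
  shows "atom V a = 0"
proof -
  have "((\<lambda>t. of_real t * of_real t * (\<i> * gl V {a} t / of_real t)) \<longlongrightarrow> of_real 0 * of_real 0 * of_real (1 / nbr_mass V a)) (at_right 0)"
    by (intro tendsto_intros gl_over_t_tendsto assms)
  moreover have "\<forall>\<^sub>F t in at_right 0. of_real t * of_real t * (\<i> * gl V {a} t / of_real t) = \<i> * of_real t * gl V {a} t"
    using at_right_0_pos by eventually_elim simp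
  ultimately have "((\<lambda>t. \<i> * of_real t * gl V {a} t) \<longlongrightarrow> of_real 0 * of_real 0 * of_real (1 / nbr_mass V a)) (at_right 0)"
    by (rule Lim_transform_eventually)
  then have "((\<lambda>t. \<i> * of_real t * gl V {a} t) \<longlongrightarrow> 0) (at_right 0)" by simp
  with gl_atom[OF assms(1)] have "complex_of_real (atom V a) = 0"
    by (rule tendsto_unique[OF trivial_limit_at_right_real])
  then show ?thesis by simp
qed

text \<open>An atom at the neighbour after deleting \<open>u\<close> would make the Green function
  at \<open>u\<close> of order \<open>t\<close>, which is incompatible with an atom at
  \<open>u\<close>.\<close>

lemma atom_nbr_eq_0:
  assumes "u \<in> V" "v \<in> V" "E u v" "atom V u > 0"
  shows "atom (V - {u}) v = 0"
proof (rule ccontr)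
  assume "atom (V - {u}) v \<noteq> 0"
  then have "atom (V - {u}) v > 0" using atom_nonneg[of "V - {u}" v] by linarith
  then have "nbr_mass V u > 0" using assms E_neq by (intro nbr_mass_pos[of u v]) auto
  then show False using atom_eq_0_if_nbr_mass[OF assms(1)] assms(4) by simp
qed

lemma gl_Un: "finite K \<Longrightarrow> finite L \<Longrightarrow> K \<subseteq> V \<Longrightarrow> L \<subseteq> V - K \<Longrightarrow> t > 0 \<Longrightarrow>
    gl V K t * gl (V - K) L t = gl V (K \<union> L) t"
  unfolding gl_def by (rule green_lim_mult) auto

definition transport :: "nat set \<Rightarrow> nat \<Rightarrow> nat \<Rightarrow> real" where
  "transport V a u = atom (V - {a}) u / nbr_mass V a"

lemma transport_nonneg: "transport V a u \<ge> 0"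
  unfolding transport_def using nbr_mass_nonneg by simp

text \<open>\<open>gl V {a, u}\<close> factors into a term of order \<open>t\<close> at
  \<open>a\<close> and a term of order \<open>1 / t\<close> at \<open>u\<close>, so the powers
  cancel; the sign comes from \<open>i * i = -1\<close>.\<close>

lemma transport_tendsto:
  assumes "a \<in> V" "u \<in> V - {a}" "nbr_mass V a > 0"
  shows "((\<lambda>t. - gl V {a, u} t) \<longlongrightarrow> of_real (transport V a u)) (at_right 0)"
proof (rule Lim_transform_eventually)
  have "((\<lambda>t. (\<i> * gl V {a} t / of_real t) * (\<i> * of_real t * gl (V - {a}) {u} t)) \<longlongrightarrow>
      of_real (1 / nbr_mass V a) * of_real (atom (V - {a}) u)) (at_right 0)"
    by (intro tendsto_mult gl_over_t_tendsto gl_atom assms)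
  then show "((\<lambda>t. (\<i> * gl V {a} t / of_real t) * (\<i> * of_real t * gl (V - {a}) {u} t)) \<longlongrightarrow> of_real (transport V a u)) (at_right 0)"
    by (simp add: transport_def)
  show "\<forall>\<^sub>F t in at_right 0. (\<i> * gl V {a} t / of_real t) * (\<i> * of_real t * gl (V - {a}) {u} t) = - gl V {a, u} t"
    using at_right_0_pos
  proof eventually_elim
    case (elim t)
    have "gl V {a, u} t = gl V {a} t * gl (V - {a}) {u} t"
      using gl_Un[of "{a}" "{u}" V t] assms elim by (simp add: insert_commute)
    then show ?case using elim by (simp add: mult_ac)
  qed
qed

text \<open>The essential vertices of the Gallai--Edmonds decomposition at \<open>\<theta>\<close>.\<close>

definition ess :: "nat set \<Rightarrow> nat set" where
  "ess V = {v \<in> V. atom V v > 0}"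

definition ess_rel :: "nat set \<Rightarrow> (nat \<times> nat) set" where
  "ess_rel V = {(x, y). x \<in> ess V \<and> y \<in> ess V \<and> E x y}"

lemma ess_rel_sym: "(x, y) \<in> (ess_rel V)\<^sup>* \<Longrightarrow> (y, x) \<in> (ess_rel V)\<^sup>*"
proof -
  have "sym_on UNIV (ess_rel V)" unfolding ess_rel_def using sym by (auto simp: sym_on_def)
  then show "(x, y) \<in> (ess_rel V)\<^sup>* \<Longrightarrow> (y, x) \<in> (ess_rel V)\<^sup>*"
    by (meson sym_rtrancl symE)
qed

lemma ess_rel_ess: "(x, y) \<in> (ess_rel V)\<^sup>* \<Longrightarrow> x \<in> ess V \<Longrightarrow> y \<in> ess V"
  by (induction rule: rtrancl_induct) (auto simp: ess_rel_def)

text \<open>An analogue of Gallai's lemma, by induction along a path of essential vertices. Adjacent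
  essential vertices destroy each other's atoms when deleted, so \<open>atom_three_le\<close>
  carries the loss of the atom at \<open>w\<close> from deleting \<open>v\<close> to deleting the
  next vertex. The alternative \<open>v = w\<close> is kept because there \<open>w\<close> itself is
  the deleted vertex.\<close>

lemma atom_delete_connected:
  assumes "(w, v) \<in> (ess_rel V)\<^sup>*" "w \<in> ess V"
  shows "v = w \<or> atom (V - {v}) w = 0"
  using assms(1)
proof (induction rule: rtrancl_induct)
  case (step v v')
  have v: "v \<in> V" "v' \<in> V" "E v v'" "atom V v > 0" "atom V v' > 0" and w: "w \<in> V"
    using step.hyps assms(2) by (auto simp: ess_rel_def ess_def)
  show ?case
  proof (cases "v' = w \<or> v = w")
    case True
    then show ?thesis using atom_nbr_eq_0[of v' V v] v sym by auto
  next
    case False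
    have "atom (V - {v}) v' = 0" "atom (V - {v'}) v = 0"
      using atom_nbr_eq_0[of v V v'] atom_nbr_eq_0[of v' V v] v sym by auto
    moreover have "v \<noteq> v'" using v E_neq by auto
    ultimately have "atom V v * atom V v' * \<bar>atom (V - {v}) w - atom (V - {v'}) w\<bar> \<le> 0"
      using atom_three_le[of v V v' w] v w False by auto
    then have "\<bar>atom (V - {v}) w - atom (V - {v'}) w\<bar> \<le> 0"
      using v(4,5) by (simp add: mult_le_0_iff)
    then show ?thesis using step.IH False by simp
  qed
qed simp

text \<open>Deleting \<open>u\<close> destroys every other atom of its component, so in
  \<open>Heilmann_Lieb_atom\<close> the changes are the atoms themselves. Finite subsets
  \<open>F\<close> are used because the component may still be infinite at this stage.\<close>

lemma component_atom_sum_le: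
  assumes "u \<in> ess V" "finite F" "\<And>v. v \<in> F \<Longrightarrow> (u, v) \<in> (ess_rel V)\<^sup>*"
  shows "(\<Sum>v\<in>F. atom V v) \<le> 1"
proof -
  let ?F = "F - {u}"
  have u: "u \<in> V" "atom V u > 0" using assms(1) by (auto simp: ess_def)
  have F: "?F \<subseteq> V - {u}" using ess_rel_ess[OF assms(3) assms(1)] by (auto simp: ess_def)
  have z: "atom (V - {u}) v = 0" if "v \<in> ?F" for v
    using atom_delete_connected[of v u V] assms(1,3) that ess_rel_sym ess_rel_ess by blast
  have "atom V u * (atom V u + (\<Sum>v\<in>?F. atom V v)) =
      (atom V u)\<^sup>2 + (\<Sum>w\<in>?F. atom V u * \<bar>atom V w - atom (V - {u}) w\<bar>)"
    using z by (simp add: power2_eq_square distrib_left sum_distrib_left)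
  also have "\<dots> \<le> atom V u * 1"
    using Heilmann_Lieb_atom[of u V ?F] u F assms(2) by simp
  finally have "atom V u + (\<Sum>v\<in>?F. atom V v) \<le> 1"
    using u by (simp only: mult_le_cancel_left_pos)
  moreover have "(\<Sum>v\<in>F. atom V v) \<le> (\<Sum>v\<in>insert u ?F. atom V v)"
    using assms(2) by (intro sum_mono2) auto
  moreover have "(\<Sum>v\<in>insert u ?F. atom V v) = atom V u + (\<Sum>v\<in>?F. atom V v)"
    using assms(2) by (subst sum.insert) auto
  ultimately show ?thesis by linarith
qed

lemma special_nbr_mass_pos:
  assumes "a \<in> V" "atom V a = 0" "E a w" "w \<in> ess V"
  shows "nbr_mass V a > 0"
proof (rule nbr_mass_pos[OF assms(3)])
  show w: "w \<in> V - {a}" using assms by (auto simp: ess_def)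
  show "atom (V - {a}) w > 0"
    using atom_mono_delete[of "{a}" V w] w assms by (auto simp: ess_def)
qed

text \<open>The Green function of \<open>{a, u}\<close> is computed in two orders. Deleting
  \<open>a\<close> first gives the limit \<open>transport V a u\<close>; deleting \<open>u\<close>
  first gives a finite constant times \<open>atom V u\<close>, which is 0. The constant is finite
  because \<open>w\<close> keeps its atom when both \<open>u\<close> and \<open>a\<close> are
  deleted, so \<open>a\<close> still has positive neighbour mass without \<open>u\<close>.\<close>

lemma stability:
  assumes "a \<in> V" "atom V a = 0" "E a w" "w \<in> ess V" and u: "u \<in> V - {a}" "atom V u = 0"
  shows "atom (V - {a}) u = 0"
proof (rule ccontr)
  assume "atom (V - {a}) u \<noteq> 0"
  then have pos: "atom (V - {a}) u > 0" using atom_nonneg[of "V - {a}" u] by linarith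
  have m: "nbr_mass V a > 0" using special_nbr_mass_pos[OF assms(1-4)] .
  have w: "w \<in> V - {u, a}" "w \<noteq> u" using assms by (auto simp: ess_def)
  have VV: "V - {u} - {a} = V - {u, a}" by auto
  have "atom V w \<le> atom (V - {u, a}) w"
    using atom_mono_delete[of "{u, a}" V w] assms w by auto
  then have "nbr_mass (V - {u}) a > 0"
    using assms w by (intro nbr_mass_pos[of a w]) (auto simp: ess_def VV)
  then have "((\<lambda>t. (\<i> * gl (V - {u}) {a} t / of_real t) * (\<i> * of_real t * gl V {u} t)) \<longlongrightarrow>
      of_real (1 / nbr_mass (V - {u}) a) * of_real (atom V u)) (at_right 0)"
    using assms by (intro tendsto_mult gl_over_t_tendsto gl_atom) auto
  moreover have "\<forall>\<^sub>F t in at_right 0. (\<i> * gl (V - {u}) {a} t / of_real t) * (\<i> * of_real t * gl V {u} t) = - gl V {a, u} t"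
    using at_right_0_pos
  proof eventually_elim
    case (elim t)
    have "gl V {a, u} t = gl V {u} t * gl (V - {u}) {a} t"
      using gl_Un[of "{u}" "{a}" V t] assms elim by (auto simp: insert_commute)
    then show ?case using elim by (simp add: mult_ac)
  qed
  ultimately have "((\<lambda>t. - gl V {a, u} t) \<longlongrightarrow> of_real (1 / nbr_mass (V - {u}) a) * of_real (atom V u)) (at_right 0)"
    by (rule Lim_transform_eventually)
  then have "((\<lambda>t. - gl V {a, u} t) \<longlongrightarrow> 0) (at_right 0)" by (simp add: u(2))
  with transport_tendsto[OF assms(1) u(1) m] have "complex_of_real (transport V a u) = 0"
    by (rule tendsto_unique[OF trivial_limit_at_right_real])
  then show False using pos m by (simp add: transport_def)
qed

text \<open>By \<open>stability\<close> only the essential neighbours of \<open>a\<close> carry mass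
  after its deletion, so the normalising constant \<open>nbr_mass\<close> is a sum over these
  alone.\<close>

lemma transport_sum:
  assumes "a \<in> V" "atom V a = 0" "E a w" "w \<in> ess V"
  shows "(\<Sum>u\<in>{u\<in>ess V. E a u}. transport V a u) = 1"
proof -
  have m: "nbr_mass V a > 0" using special_nbr_mass_pos[OF assms] .
  have "(\<Sum>u\<in>{u\<in>ess V. E a u}. transport V a u) = (\<Sum>u\<in>{u\<in>V - {a}. E a u}. transport V a u)"
  proof (rule sum.mono_neutral_left)
    show "{u \<in> ess V. E a u} \<subseteq> {u \<in> V - {a}. E a u}" using E_neq by (auto simp: ess_def)
    show "\<forall>u\<in>{u \<in> V - {a}. E a u} - {u \<in> ess V. E a u}. transport V a u = 0"
    proof
      fix u assume u: "u \<in> {u \<in> V - {a}. E a u} - {u \<in> ess V. E a u}"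
      then have "atom V u = 0" using atom_nonneg[of V u] by (auto simp: ess_def)
      then show "transport V a u = 0" using stability[OF assms, of u] u by (simp add: transport_def)
    qed
  qed (rule finite_nbrs_in)
  also have "\<dots> = 1" using m unfolding transport_def sum_divide_distrib[symmetric] nbr_mass_def by simp
  finally show ?thesis .
qed

end

section \<open>Removing the boundary of a finite set\<close>

context bounded_graph
begin

definition bdry :: "nat set \<Rightarrow> nat set \<Rightarrow> nat set" where
  "bdry S W = {a \<in> W - S. \<exists>u\<in>S. E u a}"

lemma finite_bdry: "finite S \<Longrightarrow> finite (bdry S W)"
proof -
  assume "finite S"
  then have "finite (\<Union>u\<in>S. {a. E u a})" using finite_nbrs by auto
  then show ?thesis by (rule rev_finite_subset) (auto simp: bdry_def)
qed

text \<open>Expanding \<open>S\<close> away leaves matching polynomials of \<open>W - A\<close>,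
  with \<open>A\<close> the boundary vertices used up by edges from \<open>S\<close> to
  \<open>W\<close>. The index \<open>j\<close> is a lower bound on the number of such edges.\<close>

definition cut_bound :: "nat \<Rightarrow> nat set \<Rightarrow> nat set \<Rightarrow> complex \<Rightarrow> real" where
  "cut_bound j S W z = (\<Sum>A\<in>{A. A \<subseteq> bdry S W \<and> j \<le> card A}. norm (matching_val E (W - A) z))"

lemma cut_bound_nonneg: "cut_bound j S W z \<ge> 0"
  unfolding cut_bound_def by (intro sum_nonneg) simp

lemma finite_cut_sets: "finite S \<Longrightarrow> finite {A. A \<subseteq> bdry S W \<and> j \<le> card A}"
  by (rule finite_subset[of _ "Pow (bdry S W)"]) (auto simp: finite_bdry)

text \<open>Adding \<open>a\<close> to \<open>A\<close> is injective on the sets that avoid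
  \<open>a\<close>, so every crossing edge that is used raises the index by one.\<close>

lemma cut_bound_delete:
  assumes "finite S" "a \<in> bdry S W"
  shows "cut_bound j S (W - {a}) z \<le> cut_bound (Suc j) S W z"
proof -
  let ?P = "{A. A \<subseteq> bdry S (W - {a}) \<and> j \<le> card A}"
  have fin: "finite A" if "A \<in> ?P" for A
    using that finite_bdry[OF assms(1), of "W - {a}"] finite_subset by blast
  have notin: "a \<notin> A" if "A \<in> ?P" for A using that by (auto simp: bdry_def)
  have inj: "inj_on (insert a) ?P"
    using notin by (auto simp: inj_on_def) (metis insert_ident)+
  have "cut_bound j S (W - {a}) z = (\<Sum>A\<in>insert a ` ?P. norm (matching_val E (W - A) z))"
    unfolding cut_bound_def sum.reindex[OF inj] o_def by (simp flip: Diff_insert2)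
  also have "\<dots> \<le> cut_bound (Suc j) S W z"
    unfolding cut_bound_def
  proof (rule sum_mono2[OF finite_cut_sets[OF assms(1)]])
    show "insert a ` ?P \<subseteq> {A. A \<subseteq> bdry S W \<and> Suc j \<le> card A}"
    proof (rule image_subsetI)
      fix A assume A: "A \<in> ?P"
      have "card (insert a A) = Suc (card A)"
        using fin[OF A] notin[OF A] by (rule card_insert_disjoint)
      moreover have "bdry S (W - {a}) \<subseteq> bdry S W" by (auto simp: bdry_def)
      ultimately show "insert a A \<in> {A. A \<subseteq> bdry S W \<and> Suc j \<le> card A}"
        using A assms(2) by (auto simp del: card_insert_if)
    qed
  qed simp
  finally show ?thesis .
qed

lemma cut_rec:
  assumes "finite U" "finite W" "U \<inter> W = {}" "u \<in> U"
  shows "matching_val E (U \<union> W) z = z * matching_val E ((U - {u}) \<union> W) z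
    - (\<Sum>b\<in>{b\<in>U - {u}. E u b}. matching_val E ((U - {u, b}) \<union> W) z)
    - (\<Sum>a\<in>{a\<in>W. E u a}. matching_val E ((U - {u}) \<union> (W - {a})) z)"
proof -
  have u: "u \<notin> W" using assms by auto
  have e1: "U \<union> W - {u} = (U - {u}) \<union> W" using u by auto
  have "matching_val E (U \<union> W) z = z * matching_val E ((U - {u}) \<union> W) z
      - (\<Sum>b\<in>{b\<in>U \<union> W - {u}. E u b}. matching_val E (U \<union> W - {u, b}) z)"
    unfolding e1[symmetric] using assms by (intro matching_val_rec) auto
  also have "{b\<in>U \<union> W - {u}. E u b} = {b\<in>U - {u}. E u b} \<union> {a\<in>W. E u a}" using u by auto
  also have "(\<Sum>b\<in>{b\<in>U - {u}. E u b} \<union> {a\<in>W. E u a}. matching_val E (U \<union> W - {u, b}) z) =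
      (\<Sum>b\<in>{b\<in>U - {u}. E u b}. matching_val E (U \<union> W - {u, b}) z) + (\<Sum>a\<in>{a\<in>W. E u a}. matching_val E (U \<union> W - {u, a}) z)"
    using assms by (intro sum.union_disjoint) auto
  also have "(\<Sum>b\<in>{b\<in>U - {u}. E u b}. matching_val E (U \<union> W - {u, b}) z) =
      (\<Sum>b\<in>{b\<in>U - {u}. E u b}. matching_val E ((U - {u, b}) \<union> W) z)"
    using assms by (intro sum.cong refl arg_cong[where f = "\<lambda>X. matching_val E X z"]) auto
  also have "(\<Sum>a\<in>{a\<in>W. E u a}. matching_val E (U \<union> W - {u, a}) z) =
      (\<Sum>a\<in>{a\<in>W. E u a}. matching_val E ((U - {u}) \<union> (W - {a})) z)"
    using assms by (intro sum.cong refl arg_cong[where f = "\<lambda>X. matching_val E X z"]) auto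
  finally show ?thesis by simp
qed

lemma matching_val_disjoint_union:
  assumes "finite U" "finite W" "U \<inter> W = {}" "\<And>u a. u \<in> U \<Longrightarrow> a \<in> W \<Longrightarrow> \<not> E u a"
  shows "matching_val E (U \<union> W) z = matching_val E U z * matching_val E W z"
  using assms(1,3,4)
proof (induction "card U" arbitrary: U rule: less_induct)
  case less
  show ?case
  proof (cases "U = {}")
    case False
    then obtain u where u: "u \<in> U" by blast
    have c: "card (U - {u}) < card U" "\<And>b. card (U - {u, b}) < card U"
      by (rule psubset_card_mono[OF less.prems(1)], use u in blast)+
    have IH: "matching_val E ((U - {u}) \<union> W) z = matching_val E (U - {u}) z * matching_val E W z"
      "\<And>b. matching_val E ((U - {u, b}) \<union> W) z = matching_val E (U - {u, b}) z * matching_val E W z"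
      using less.prems by (auto intro!: less.hyps c)
    have "{a\<in>W. E u a} = {}" using less.prems u by auto
    then have "(\<Sum>a\<in>{a\<in>W. E u a}. matching_val E ((U - {u}) \<union> (W - {a})) z) = 0" by (metis sum.empty)
    then have "matching_val E (U \<union> W) z = (z * matching_val E (U - {u}) z
      - (\<Sum>b\<in>{b\<in>U - {u}. E u b}. matching_val E (U - {u, b}) z)) * matching_val E W z"
      unfolding cut_rec[OF less.prems(1) assms(2) less.prems(2) u] IH
      by (simp add: left_diff_distrib sum_distrib_right)
    then show ?thesis
      unfolding matching_val_rec[OF less.prems(1) u] .
  qed simp
qed

text \<open>Induction on \<open>U\<close> by the recursion. What counts is that \<open>C\<close>
  depends on \<open>U\<close>, \<open>S\<close> and \<open>R\<close> only, so it survives when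
  \<open>W\<close> grows to an infinite graph and when \<open>z\<close> approaches the real
  line.\<close>

lemma cut_crude_bound:
  assumes S: "finite S" and "U \<subseteq> S" "R \<ge> 0"
  shows "\<exists>C\<ge>0. \<forall>W z. finite W \<and> S \<inter> W = {} \<and> norm z \<le> R \<longrightarrow>
    norm (matching_val E (U \<union> W) z) \<le> C * cut_bound 0 S W z"
  using assms(2)
proof (induction "card U" arbitrary: U rule: less_induct)
  case less
  have finU: "finite U" using less.prems S finite_subset by blast
  show ?case
  proof (cases "U = {}")
    case True
    have "norm (matching_val E W z) \<le> cut_bound 0 S W z" for W z
      unfolding cut_bound_def
      using member_le_sum[of "{}" "{A. A \<subseteq> bdry S W \<and> 0 \<le> card A}" "\<lambda>A. norm (matching_val E (W - A) z)"]
        finite_cut_sets[OF S, of W 0] by simp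
    then show ?thesis using True by (intro exI[of _ 1]) auto
  next
    case False
    then obtain u where u: "u \<in> U" by blast
    have c: "card (U - {u}) < card U" "\<And>b. card (U - {u, b}) < card U"
      by (rule psubset_card_mono[OF finU], use u in blast)+
    obtain C1 where C1: "C1 \<ge> 0" "\<And>W z. finite W \<and> S \<inter> W = {} \<and> norm z \<le> R \<Longrightarrow>
      norm (matching_val E ((U - {u}) \<union> W) z) \<le> C1 * cut_bound 0 S W z"
      using less.hyps[OF c(1)] less.prems by blast
    have "\<forall>b. \<exists>C\<ge>0. \<forall>W z. finite W \<and> S \<inter> W = {} \<and> norm z \<le> R \<longrightarrow>
      norm (matching_val E ((U - {u, b}) \<union> W) z) \<le> C * cut_bound 0 S W z"
      using less.hyps[OF c(2)] less.prems by blast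
    then obtain C2 where C2: "\<And>b. C2 b \<ge> 0" "\<And>b W z. finite W \<and> S \<inter> W = {} \<and> norm z \<le> R \<Longrightarrow>
      norm (matching_val E ((U - {u, b}) \<union> W) z) \<le> C2 b * cut_bound 0 S W z"
      by metis
    let ?N = "{b\<in>U - {u}. E u b}"
    have "norm (matching_val E (U \<union> W) z) \<le> (R * C1 + (\<Sum>b\<in>?N. C2 b) + real D * C1) * cut_bound 0 S W z"
      if W: "finite W \<and> S \<inter> W = {} \<and> norm z \<le> R" for W z
    proof -
      have UW: "U \<inter> W = {}" using W less.prems by auto
      let ?M = "{a\<in>W. E u a}"
      have a_term: "norm (matching_val E ((U - {u}) \<union> (W - {a})) z) \<le> C1 * cut_bound 0 S W z" if "a \<in> ?M" for a
      proof -
        have "a \<in> bdry S W" using that u less.prems W by (auto simp: bdry_def)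
        then have "cut_bound 0 S (W - {a}) z \<le> cut_bound 1 S W z" using cut_bound_delete[OF S, of a W 0 z] by simp
        also have "\<dots> \<le> cut_bound 0 S W z"
          unfolding cut_bound_def by (rule sum_mono2[OF finite_cut_sets[OF S]]) auto
        finally have "C1 * cut_bound 0 S (W - {a}) z \<le> C1 * cut_bound 0 S W z"
          using C1(1) by (rule mult_left_mono)
        moreover have "norm (matching_val E ((U - {u}) \<union> (W - {a})) z) \<le> C1 * cut_bound 0 S (W - {a}) z"
          using W by (intro C1(2)) auto
        ultimately show ?thesis by linarith
      qed
      have "norm (matching_val E (U \<union> W) z) \<le> norm (z * matching_val E ((U - {u}) \<union> W) z)
        + norm (\<Sum>b\<in>?N. matching_val E ((U - {u, b}) \<union> W) z)
        + norm (\<Sum>a\<in>?M. matching_val E ((U - {u}) \<union> (W - {a})) z)"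
        unfolding cut_rec[OF finU conjunct1[OF W] UW u]
        by (meson add_mono norm_triangle_ineq4 order.trans order_refl)
      also have "norm (z * matching_val E ((U - {u}) \<union> W) z) \<le> R * (C1 * cut_bound 0 S W z)"
        unfolding norm_mult using W C1 assms(3) by (intro mult_mono) auto
      also have "norm (\<Sum>b\<in>?N. matching_val E ((U - {u, b}) \<union> W) z) \<le> (\<Sum>b\<in>?N. C2 b * cut_bound 0 S W z)"
        using W by (intro sum_norm_le C2(2))
      also have "norm (\<Sum>a\<in>?M. matching_val E ((U - {u}) \<union> (W - {a})) z) \<le> (\<Sum>a\<in>?M. C1 * cut_bound 0 S W z)"
        by (intro sum_norm_le a_term)
      also have "\<dots> \<le> real D * (C1 * cut_bound 0 S W z)"
        using card_nbrs_in[of W u] C1(1) cut_bound_nonneg[of 0 S W z]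
        by (simp only: sum_constant) (intro mult_right_mono mult_nonneg_nonneg, auto)
      finally show ?thesis by (simp only: distrib_right sum_distrib_right mult.assoc)
    qed
    moreover have "R * C1 + (\<Sum>b\<in>?N. C2 b) + real D * C1 \<ge> 0"
      using assms(3) C1(1) C2(1) by (intro add_nonneg_nonneg sum_nonneg mult_nonneg_nonneg) auto
    ultimately show ?thesis by (intro exI[of _ "R * C1 + (\<Sum>b\<in>?N. C2 b) + real D * C1"]) blast
  qed
qed

text \<open>A matching of \<open>U \<union> W\<close> with \<open>k\<close> edges between
  \<open>U\<close> and \<open>W\<close> is counted once in the first term, if \<open>k = 0\<close>
  also in the second, and \<open>k\<close> times with opposite sign in the last. So it enters with
  weight \<open>1 - k\<close> if \<open>k \<ge> 1\<close> and 0 if \<open>k = 0\<close>: only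
  matchings with at least two crossing edges survive.\<close>

definition cut_error :: "nat set \<Rightarrow> nat set \<Rightarrow> complex \<Rightarrow> complex" where
  "cut_error U W z = matching_val E (U \<union> W) z - matching_val E U z * matching_val E W z
    + (\<Sum>v\<in>U. \<Sum>a\<in>{a\<in>W. E v a}. matching_val E ((U - {v}) \<union> (W - {a})) z)"

text \<open>The error obeys the recursion of the matching polynomial at \<open>u\<close> up to a
  last sum. The terms with a single crossing edge at \<open>u\<close> cancel, and what is left are
  pairs of crossing edges, one of them at \<open>u\<close>.\<close>

lemma cut_error_rec:
  assumes "finite U" "finite W" "U \<inter> W = {}" "u \<in> U"
  shows "cut_error U W z = z * cut_error (U - {u}) W z
    - (\<Sum>b\<in>{b\<in>U - {u}. E u b}. cut_error (U - {u, b}) W z)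
    - (\<Sum>v\<in>U - {u}. \<Sum>a\<in>{a\<in>W. E v a}. \<Sum>a'\<in>{a'\<in>W - {a}. E u a'}. matching_val E ((U - {u, v}) \<union> (W - {a, a'})) z)"
proof -
  let ?m = "\<lambda>X. matching_val E X z"
  let ?N = "{b\<in>U - {u}. E u b}"
  have r1: "?m (U \<union> W) = z * ?m ((U - {u}) \<union> W) - (\<Sum>b\<in>?N. ?m ((U - {u, b}) \<union> W)) - (\<Sum>a\<in>{a\<in>W. E u a}. ?m ((U - {u}) \<union> (W - {a})))"
    by (rule cut_rec[OF assms])
  have r2: "?m U = z * ?m (U - {u}) - (\<Sum>b\<in>?N. ?m (U - {u, b}))"
    by (rule matching_val_rec[OF assms(1,4)])
  have r3: "?m ((U - {v}) \<union> (W - {a})) = z * ?m ((U - {u, v}) \<union> (W - {a}))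
      - (\<Sum>b\<in>{b\<in>U - {u, v}. E u b}. ?m ((U - {u, v, b}) \<union> (W - {a})))
      - (\<Sum>a'\<in>{a'\<in>W - {a}. E u a'}. ?m ((U - {u, v}) \<union> (W - {a, a'})))"
    if "v \<in> U - {u}" for v a
  proof -
    have e: "U - {v} - {u} = U - {u, v}" "\<And>b. U - {v} - {u, b} = U - {u, v, b}" "\<And>a'. W - {a} - {a'} = W - {a, a'}"
      by auto
    have "(U - {v}) \<inter> (W - {a}) = {}" "u \<in> U - {v}" using assms that by auto
    from cut_rec[OF _ _ this, of z] show ?thesis using assms(1,2) by (simp only: e finite_Diff)
  qed
  have s: "(\<Sum>v\<in>U. \<Sum>a\<in>{a\<in>W. E v a}. ?m ((U - {v}) \<union> (W - {a}))) =
     (\<Sum>a\<in>{a\<in>W. E u a}. ?m ((U - {u}) \<union> (W - {a}))) + (\<Sum>v\<in>U - {u}. \<Sum>a\<in>{a\<in>W. E v a}. ?m ((U - {v}) \<union> (W - {a})))"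
    using assms by (subst sum.remove[of U u]) auto
  have s3: "(\<Sum>v\<in>U - {u}. \<Sum>a\<in>{a\<in>W. E v a}. ?m ((U - {v}) \<union> (W - {a}))) =
     z * (\<Sum>v\<in>U - {u}. \<Sum>a\<in>{a\<in>W. E v a}. ?m ((U - {u, v}) \<union> (W - {a})))
     - (\<Sum>v\<in>U - {u}. \<Sum>a\<in>{a\<in>W. E v a}. \<Sum>b\<in>{b\<in>U - {u, v}. E u b}. ?m ((U - {u, v, b}) \<union> (W - {a})))
     - (\<Sum>v\<in>U - {u}. \<Sum>a\<in>{a\<in>W. E v a}. \<Sum>a'\<in>{a'\<in>W - {a}. E u a'}. ?m ((U - {u, v}) \<union> (W - {a, a'})))"
    unfolding sum_distrib_left sum_subtractf[symmetric]
    by (intro sum.cong refl r3)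
  have "(\<Sum>v\<in>U - {u}. \<Sum>a\<in>{a\<in>W. E v a}. \<Sum>b\<in>{b\<in>U - {u, v}. E u b}. ?m ((U - {u, v, b}) \<union> (W - {a}))) =
     (\<Sum>v\<in>U - {u}. \<Sum>b\<in>{b\<in>U - {u, v}. E u b}. \<Sum>a\<in>{a\<in>W. E v a}. ?m ((U - {u, v, b}) \<union> (W - {a})))"
    by (intro sum.cong refl sum.swap)
  also have "\<dots> = (\<Sum>v\<in>U - {u}. \<Sum>b\<in>{b. b \<in> ?N \<and> v \<noteq> b}. \<Sum>a\<in>{a\<in>W. E v a}. ?m ((U - {u, v, b}) \<union> (W - {a})))"
    by (intro sum.cong refl) auto
  also have "\<dots> = (\<Sum>b\<in>?N. \<Sum>v\<in>{v. v \<in> U - {u} \<and> v \<noteq> b}. \<Sum>a\<in>{a\<in>W. E v a}. ?m ((U - {u, v, b}) \<union> (W - {a})))"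
    using assms(1) by (intro sum.swap_restrict) auto
  also have "\<dots> = (\<Sum>b\<in>?N. \<Sum>v\<in>U - {u, b}. \<Sum>a\<in>{a\<in>W. E v a}. ?m ((U - {u, b} - {v}) \<union> (W - {a})))"
  proof (intro sum.cong refl)
    show "{v. v \<in> U - {u} \<and> v \<noteq> b} = U - {u, b}" for b by auto
    show "?m ((U - {u, v, b}) \<union> (W - {a})) = ?m ((U - {u, b} - {v}) \<union> (W - {a}))" for v b a
      by (intro arg_cong[where f = "\<lambda>X. matching_val E X z"]) auto
  qed
  finally have s4: "(\<Sum>v\<in>U - {u}. \<Sum>a\<in>{a\<in>W. E v a}. \<Sum>b\<in>{b\<in>U - {u, v}. E u b}. ?m ((U - {u, v, b}) \<union> (W - {a}))) =
    (\<Sum>b\<in>?N. \<Sum>v\<in>U - {u, b}. \<Sum>a\<in>{a\<in>W. E v a}. ?m ((U - {u, b} - {v}) \<union> (W - {a})))" .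
  have e: "U - {u} - {v} = U - {u, v}" for v by auto
  show ?thesis
    unfolding cut_error_def r1 r2 s s3 s4 e
    by (simp only: sum.distrib sum_subtractf right_diff_distrib distrib_left left_diff_distrib sum_distrib_right
        sum_distrib_left mult.assoc) (simp add: algebra_simps)
qed

text \<open>The last sum of \<open>cut_error_rec\<close> deletes two boundary vertices from
  \<open>W\<close>; the crude bound followed by two uses of \<open>cut_bound_delete\<close> gives
  the index 2. The other terms are covered by induction.\<close>

lemma cut_error_bound:
  assumes S: "finite S" and "U \<subseteq> S" "R \<ge> 0"
  shows "\<exists>C\<ge>0. \<forall>W z. finite W \<and> S \<inter> W = {} \<and> norm z \<le> R \<longrightarrow>
    norm (cut_error U W z) \<le> C * cut_bound 2 S W z"
  using assms(2)
proof (induction "card U" arbitrary: U rule: less_induct)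
  case less
  have finU: "finite U" using less.prems S finite_subset by blast
  show ?case
  proof (cases "U = {}")
    case True
    then show ?thesis
      by (intro exI[of _ 0]) (simp add: cut_error_def)
  next
    case False
    then obtain u where u: "u \<in> U" by blast
    have c: "card (U - {u}) < card U" "\<And>b. card (U - {u, b}) < card U"
      by (rule psubset_card_mono[OF finU], use u in blast)+
    obtain C1 where C1: "C1 \<ge> 0" "\<And>W z. finite W \<and> S \<inter> W = {} \<and> norm z \<le> R \<Longrightarrow>
      norm (cut_error (U - {u}) W z) \<le> C1 * cut_bound 2 S W z"
      using less.hyps[OF c(1)] less.prems by blast
    have "\<forall>b. \<exists>C\<ge>0. \<forall>W z. finite W \<and> S \<inter> W = {} \<and> norm z \<le> R \<longrightarrow>
      norm (cut_error (U - {u, b}) W z) \<le> C * cut_bound 2 S W z"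
      using less.hyps[OF c(2)] less.prems by blast
    then obtain C2 where C2: "\<And>b. C2 b \<ge> 0" "\<And>b W z. finite W \<and> S \<inter> W = {} \<and> norm z \<le> R \<Longrightarrow>
      norm (cut_error (U - {u, b}) W z) \<le> C2 b * cut_bound 2 S W z"
      by metis
    have "\<forall>v. \<exists>C\<ge>0. \<forall>W z. finite W \<and> S \<inter> W = {} \<and> norm z \<le> R \<longrightarrow>
      norm (matching_val E ((U - {u, v}) \<union> W) z) \<le> C * cut_bound 0 S W z"
    proof
      fix v
      have "U - {u, v} \<subseteq> S" using less.prems by auto
      from cut_crude_bound[OF S this assms(3)]
      show "\<exists>C\<ge>0. \<forall>W z. finite W \<and> S \<inter> W = {} \<and> norm z \<le> R \<longrightarrow>
        norm (matching_val E ((U - {u, v}) \<union> W) z) \<le> C * cut_bound 0 S W z" .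
    qed
    then obtain C3 where C3: "\<And>v. C3 v \<ge> 0" "\<And>v W z. finite W \<and> S \<inter> W = {} \<and> norm z \<le> R \<Longrightarrow>
      norm (matching_val E ((U - {u, v}) \<union> W) z) \<le> C3 v * cut_bound 0 S W z"
      by metis
    let ?N = "{b\<in>U - {u}. E u b}"
    let ?C = "R * C1 + (\<Sum>b\<in>?N. C2 b) + (\<Sum>v\<in>U - {u}. real D * (real D * C3 v))"
    have "norm (cut_error U W z) \<le> ?C * cut_bound 2 S W z"
      if W: "finite W \<and> S \<inter> W = {} \<and> norm z \<le> R" for W z
    proof -
      have UW: "U \<inter> W = {}" using W less.prems by auto
      let ?M = "\<lambda>v. {a\<in>W. E v a}" and ?M' = "\<lambda>a. {a'\<in>W - {a}. E u a'}"
      have crossing: "norm (matching_val E ((U - {u, v}) \<union> (W - {a, a'})) z) \<le> C3 v * cut_bound 2 S W z"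
        if "v \<in> U - {u}" "a \<in> ?M v" "a' \<in> ?M' a" for v a a'
      proof -
        have e: "W - {a, a'} = W - {a'} - {a}" by auto
        have "a' \<in> bdry S W" "a \<in> bdry S (W - {a'})" using that u less.prems W by (auto simp: bdry_def)
        then have "cut_bound 0 S (W - {a'} - {a}) z \<le> cut_bound (Suc (Suc 0)) S W z"
          by (meson S cut_bound_delete order.trans)
        then have "C3 v * cut_bound 0 S (W - {a, a'}) z \<le> C3 v * cut_bound 2 S W z"
          unfolding e using C3(1) by (intro mult_left_mono) (simp_all add: numeral_2_eq_2)
        moreover have "norm (matching_val E ((U - {u, v}) \<union> (W - {a, a'})) z) \<le> C3 v * cut_bound 0 S (W - {a, a'}) z"
          using W by (intro C3(2)) auto
        ultimately show ?thesis by linarith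
      qed
      have nn: "0 \<le> C3 v * cut_bound 2 S W z" for v
        using C3(1) cut_bound_nonneg by (rule mult_nonneg_nonneg)
      have inner: "norm (\<Sum>a'\<in>?M' a. matching_val E ((U - {u, v}) \<union> (W - {a, a'})) z) \<le> real D * (C3 v * cut_bound 2 S W z)"
        if "v \<in> U - {u}" "a \<in> ?M v" for v a
      proof -
        have "norm (\<Sum>a'\<in>?M' a. matching_val E ((U - {u, v}) \<union> (W - {a, a'})) z) \<le> (\<Sum>a'\<in>?M' a. C3 v * cut_bound 2 S W z)"
          using that by (intro sum_norm_le crossing)
        also have "\<dots> \<le> real D * (C3 v * cut_bound 2 S W z)"
          using card_nbrs_in[of "W - {a}" u] nn by (simp only: sum_constant) (intro mult_right_mono, auto)
        finally show ?thesis .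
      qed
      have outer: "norm (\<Sum>a\<in>?M v. \<Sum>a'\<in>?M' a. matching_val E ((U - {u, v}) \<union> (W - {a, a'})) z) \<le>
          real D * (real D * (C3 v * cut_bound 2 S W z))" if "v \<in> U - {u}" for v
      proof -
        have "norm (\<Sum>a\<in>?M v. \<Sum>a'\<in>?M' a. matching_val E ((U - {u, v}) \<union> (W - {a, a'})) z) \<le>
           (\<Sum>a\<in>?M v. real D * (C3 v * cut_bound 2 S W z))"
          using that by (intro sum_norm_le inner)
        also have "\<dots> \<le> real D * (real D * (C3 v * cut_bound 2 S W z))"
          using card_nbrs_in[of W v] mult_nonneg_nonneg[OF of_nat_0_le_iff nn]
          by (simp only: sum_constant) (intro mult_right_mono, auto)
        finally show ?thesis .
      qed
      have "norm (cut_error U W z) \<le> norm (z * cut_error (U - {u}) W z)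
        + norm (\<Sum>b\<in>?N. cut_error (U - {u, b}) W z)
        + norm (\<Sum>v\<in>U - {u}. \<Sum>a\<in>?M v. \<Sum>a'\<in>?M' a. matching_val E ((U - {u, v}) \<union> (W - {a, a'})) z)"
        unfolding cut_error_rec[OF finU conjunct1[OF W] UW u]
        by (meson add_mono norm_triangle_ineq4 order.trans order_refl)
      also have "norm (z * cut_error (U - {u}) W z) \<le> R * (C1 * cut_bound 2 S W z)"
        unfolding norm_mult using W C1 assms(3) by (intro mult_mono) auto
      also have "norm (\<Sum>b\<in>?N. cut_error (U - {u, b}) W z) \<le> (\<Sum>b\<in>?N. C2 b * cut_bound 2 S W z)"
        using W by (intro sum_norm_le C2(2))
      also have "norm (\<Sum>v\<in>U - {u}. \<Sum>a\<in>?M v. \<Sum>a'\<in>?M' a. matching_val E ((U - {u, v}) \<union> (W - {a, a'})) z) \<le>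
          (\<Sum>v\<in>U - {u}. real D * (real D * (C3 v * cut_bound 2 S W z)))"
        by (intro sum_norm_le outer)
      finally show ?thesis by (simp only: distrib_right sum_distrib_right mult.assoc)
    qed
    moreover have "?C \<ge> 0"
      using assms(3) C1(1) C2(1) C3(1) by (intro add_nonneg_nonneg sum_nonneg mult_nonneg_nonneg) auto
    ultimately show ?thesis by (intro exI[of _ ?C]) blast
  qed
qed

text \<open>Dividing \<open>cut_error S (X - S)\<close> by the matching polynomial of
  \<open>X\<close> turns every term into a Green function. The constant is independent of
  \<open>X\<close>, as the passage to infinite graphs requires.\<close>

lemma cut_expansion_finite:
  assumes "finite S" "R \<ge> 0"
  shows "\<exists>C\<ge>0. \<forall>X z. finite X \<and> S \<subseteq> X \<and> Im z > 0 \<and> norm z \<le> R \<longrightarrow>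
    norm (1 - matching_val E S z * green E X S z + (\<Sum>u\<in>S. \<Sum>a\<in>{a\<in>X - S. E u a}. green E X {u, a} z))
      \<le> C * (\<Sum>A\<in>{A. A \<subseteq> bdry S (X - S) \<and> 2 \<le> card A}. norm (green E X (S \<union> A) z))"
proof -
  obtain C where C: "C \<ge> 0" "\<And>W z. finite W \<and> S \<inter> W = {} \<and> norm z \<le> R \<Longrightarrow>
    norm (cut_error S W z) \<le> C * cut_bound 2 S W z"
    using cut_error_bound[OF assms(1) subset_refl assms(2)] by blast
  have "norm (1 - matching_val E S z * green E X S z + (\<Sum>u\<in>S. \<Sum>a\<in>{a\<in>X - S. E u a}. green E X {u, a} z))
      \<le> C * (\<Sum>A\<in>{A. A \<subseteq> bdry S (X - S) \<and> 2 \<le> card A}. norm (green E X (S \<union> A) z))"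
    if X: "finite X" "S \<subseteq> X" "Im z > 0" "norm z \<le> R" for X z
  proof -
    define m where "m = matching_val E X z"
    have m: "m \<noteq> 0" unfolding m_def using X by (intro matching_val_nonzero)
    have XS: "S \<union> (X - S) = X" "\<And>A. X - S - A = X - (S \<union> A)" using X by auto
    have e: "(S - {v}) \<union> (X - S - {a}) = X - {v, a}" if "v \<in> S" "a \<in> X - S" for v a
      using that X by auto
    have e': "(\<Sum>v\<in>S. \<Sum>a\<in>{a\<in>X - S. E v a}. matching_val E ((S - {v}) \<union> (X - S - {a})) z) =
        (\<Sum>v\<in>S. \<Sum>a\<in>{a\<in>X - S. E v a}. matching_val E (X - {v, a}) z)"
      by (intro sum.cong refl arg_cong[where f = "\<lambda>X. matching_val E X z"] e) auto
    have "1 - matching_val E S z * green E X S z + (\<Sum>u\<in>S. \<Sum>a\<in>{a\<in>X - S. E u a}. green E X {u, a} z) =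
        cut_error S (X - S) z / m"
      unfolding cut_error_def XS(1) e' green_def m_def[symmetric] using m
      by (simp add: add_divide_distrib diff_divide_distrib flip: sum_divide_distrib)
    also have "norm \<dots> \<le> C * cut_bound 2 S (X - S) z / norm m"
      unfolding norm_divide using X by (intro divide_right_mono C(2)) auto
    also have "\<dots> = C * (\<Sum>A\<in>{A. A \<subseteq> bdry S (X - S) \<and> 2 \<le> card A}. norm (green E X (S \<union> A) z))"
      unfolding cut_bound_def green_def m_def[symmetric] XS(2) norm_divide sum_divide_distrib[symmetric] by simp
    finally show ?thesis .
  qed
  then show ?thesis using C(1) by blast
qed

lemma cut_expansion:
  assumes "finite S" "S \<subseteq> V" "R \<ge> 0"
  shows "\<exists>C\<ge>0. \<forall>z. Im z > 0 \<and> norm z \<le> R \<longrightarrow>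
    norm (1 - matching_val E S z * green_lim E V S z + (\<Sum>u\<in>S. \<Sum>a\<in>{a\<in>V - S. E u a}. green_lim E V {u, a} z))
      \<le> C * (\<Sum>A\<in>{A. A \<subseteq> bdry S V \<and> 2 \<le> card A}. norm (green_lim E V (S \<union> A) z))"
proof -
  obtain C where C: "C \<ge> 0" "\<And>X z. finite X \<and> S \<subseteq> X \<and> Im z > 0 \<and> norm z \<le> R \<Longrightarrow>
    norm (1 - matching_val E S z * green E X S z + (\<Sum>u\<in>S. \<Sum>a\<in>{a\<in>X - S. E u a}. green E X {u, a} z))
      \<le> C * (\<Sum>A\<in>{A. A \<subseteq> bdry S (X - S) \<and> 2 \<le> card A}. norm (green E X (S \<union> A) z))"
    using cut_expansion_finite[OF assms(1,3)] by blast
  let ?P = "{A. A \<subseteq> bdry S V \<and> 2 \<le> card A}"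
  have bd: "finite (bdry S V)" "bdry S V \<subseteq> V" using finite_bdry[OF assms(1)] by (auto simp: bdry_def)
  have "norm (1 - matching_val E S z * green_lim E V S z + (\<Sum>u\<in>S. \<Sum>a\<in>{a\<in>V - S. E u a}. green_lim E V {u, a} z))
      \<le> C * (\<Sum>A\<in>?P. norm (green_lim E V (S \<union> A) z))" if z: "Im z > 0" "norm z \<le> R" for z
  proof (rule tendsto_le[OF sequentially_bot])
    show "(\<lambda>n. C * (\<Sum>A\<in>?P. norm (green E (V \<inter> {..n}) (S \<union> A) z))) \<longlonglongrightarrow> C * (\<Sum>A\<in>?P. norm (green_lim E V (S \<union> A) z))"
      using assms bd z finite_subset[OF _ bd(1)] by (intro tendsto_intros green_tendsto) auto
    show "(\<lambda>n. norm (1 - matching_val E S z * green E (V \<inter> {..n}) S z + (\<Sum>u\<in>S. \<Sum>a\<in>{a\<in>V - S. E u a}. green E (V \<inter> {..n}) {u, a} z)))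
      \<longlonglongrightarrow> norm (1 - matching_val E S z * green_lim E V S z + (\<Sum>u\<in>S. \<Sum>a\<in>{a\<in>V - S. E u a}. green_lim E V {u, a} z))"
      using assms z by (intro tendsto_intros green_tendsto) auto
    have "\<forall>\<^sub>F n in sequentially. S \<union> bdry S V \<subseteq> V \<inter> {..n}"
      using assms bd by (intro eventually_truncate) auto
    then show "\<forall>\<^sub>F n in sequentially. norm (1 - matching_val E S z * green E (V \<inter> {..n}) S z + (\<Sum>u\<in>S. \<Sum>a\<in>{a\<in>V - S. E u a}. green E (V \<inter> {..n}) {u, a} z))
      \<le> C * (\<Sum>A\<in>?P. norm (green E (V \<inter> {..n}) (S \<union> A) z))"
    proof eventually_elim
      case (elim n)
      have e1: "{a \<in> V \<inter> {..n} - S. E u a} = {a \<in> V - S. E u a}" if "u \<in> S" for u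
      proof -
        have "{a \<in> V - S. E u a} \<subseteq> bdry S V" using that by (auto simp: bdry_def)
        then show ?thesis using elim by auto
      qed
      have e2: "bdry S (V \<inter> {..n} - S) = bdry S V"
      proof -
        have "bdry S (V \<inter> {..n} - S) \<subseteq> bdry S V" by (auto simp: bdry_def)
        moreover have "bdry S V \<subseteq> bdry S (V \<inter> {..n} - S)" using elim unfolding bdry_def by auto
        ultimately show ?thesis by blast
      qed
      have "(\<Sum>u\<in>S. \<Sum>a\<in>{a\<in>V \<inter> {..n} - S. E u a}. green E (V \<inter> {..n}) {u, a} z) =
         (\<Sum>u\<in>S. \<Sum>a\<in>{a\<in>V - S. E u a}. green E (V \<inter> {..n}) {u, a} z)"
        by (intro sum.cong refl e1)
      then show ?case
        using C(2)[of "V \<inter> {..n}" z] elim z unfolding e2 by simp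
    qed
  qed
  then show ?thesis using C(1) by blast
qed

text \<open>Without edges between \<open>S\<close> and the rest the matching polynomial factors, and
  the outer factor cancels in the quotient.\<close>

lemma green_lim_isolated:
  assumes "finite S" "S \<subseteq> W" "bdry S W = {}" "L \<subseteq> S" "Im z > 0"
  shows "green_lim E W L z = green E S L z"
proof (rule LIMSEQ_unique[OF green_tendsto])
  show "finite L" "L \<subseteq> W" using assms finite_subset by auto
  show "(\<lambda>n. green E (W \<inter> {..n}) L z) \<longlonglongrightarrow> green E S L z"
  proof (rule tendsto_eventually)
    show "\<forall>\<^sub>F n in sequentially. green E (W \<inter> {..n}) L z = green E S L z"
      using eventually_truncate[OF assms(1,2)]
    proof eventually_elim
      case (elim n)
      let ?O = "W \<inter> {..n} - S"
      have no: "\<not> E u a" if "u \<in> S" "a \<in> ?O" for u a using assms(3) that by (auto simp: bdry_def)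
      have X: "W \<inter> {..n} = S \<union> ?O" "W \<inter> {..n} - L = (S - L) \<union> ?O" using elim assms(4) by auto
      have "matching_val E (S \<union> ?O) z = matching_val E S z * matching_val E ?O z"
        using assms no by (intro matching_val_disjoint_union) auto
      moreover have "matching_val E ((S - L) \<union> ?O) z = matching_val E (S - L) z * matching_val E ?O z"
        using assms no by (intro matching_val_disjoint_union) auto
      moreover have "matching_val E ?O z \<noteq> 0" using assms(5) by (intro matching_val_nonzero) auto
      ultimately show ?case unfolding green_def X(2) by (subst X(1)) simp
    qed
  qed
qed (fact assms(5))

end

section \<open>Finite components of essential vertices\<close>

context bounded_graph
begin

text \<open>The classical derivative formula. The polynomials of \<open>X\<close> and of all
  \<open>X - {w}\<close> with \<open>w \<noteq> m\<close> are expanded at the same vertex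
  \<open>m\<close>; the double sums then agree after exchanging the summations.\<close>

lemma pderiv_matching_poly:
  assumes "finite X"
  shows "pderiv (matching_poly E X) = (\<Sum>u\<in>X. matching_poly E (X - {u}))"
  using assms
proof (induction "card X" arbitrary: X rule: less_induct)
  case less
  let ?P = "matching_poly E"
  show ?case
  proof (cases "X = {}")
    case False
    then obtain m where m: "m \<in> X" by blast
    have c: "card (X - {m}) < card X" "\<And>v. card (X - {m, v}) < card X"
      by (rule psubset_card_mono[OF less.prems], use m in blast)+
    let ?N = "{v\<in>X - {m}. E m v}"
    have IH: "pderiv (?P (X - {m})) = (\<Sum>w\<in>X - {m}. ?P (X - {m, w}))"
      "\<And>v. pderiv (?P (X - {m, v})) = (\<Sum>w\<in>X - {m, v}. ?P (X - {m, v, w}))"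
    proof -
      have e: "X - {m} - {w} = X - {m, w}" "X - {m, v} - {w} = X - {m, v, w}" for v w by auto
      show "pderiv (?P (X - {m})) = (\<Sum>w\<in>X - {m}. ?P (X - {m, w}))"
        using less.hyps[OF c(1)] less.prems by (simp only: e finite_Diff)
      show "pderiv (?P (X - {m, v})) = (\<Sum>w\<in>X - {m, v}. ?P (X - {m, v, w}))" for v
        using less.hyps[OF c(2)[of v]] less.prems by (simp only: e finite_Diff)
    qed
    have pd: "pderiv (pCons 0 p) = p + pCons 0 (pderiv p)" for p :: "int poly"
      by (simp add: pderiv_pCons)
    have psum: "pderiv (\<Sum>v\<in>?N. ?P (X - {m, v})) = (\<Sum>v\<in>?N. \<Sum>w\<in>X - {m, v}. ?P (X - {m, v, w}))"
      unfolding IH(2)[symmetric] by (rule higher_pderiv_sum[of 1, simplified])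
    have "pderiv (?P X) = ?P (X - {m}) + [:0, 1:] * (\<Sum>w\<in>X - {m}. ?P (X - {m, w}))
        - (\<Sum>v\<in>?N. \<Sum>w\<in>X - {m, v}. ?P (X - {m, v, w}))"
      unfolding matching_poly_rec[OF less.prems m] pderiv_diff psum by (simp add: pd IH(1))
    moreover have "(\<Sum>u\<in>X. ?P (X - {u})) = ?P (X - {m}) + (\<Sum>w\<in>X - {m}. ?P (X - {w}))"
      using less.prems m by (simp add: sum.remove)
    moreover have "(\<Sum>w\<in>X - {m}. ?P (X - {w})) = [:0, 1:] * (\<Sum>w\<in>X - {m}. ?P (X - {m, w}))
        - (\<Sum>w\<in>X - {m}. \<Sum>v\<in>{v\<in>X - {m, w}. E m v}. ?P (X - {m, v, w}))"
      unfolding sum_distrib_left sum_subtractf[symmetric]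
    proof (intro sum.cong refl)
      fix w assume w: "w \<in> X - {m}"
      have e: "X - {w} - {m} = X - {m, w}" "\<And>v. X - {w} - {m, v} = X - {m, v, w}" by auto
      show "?P (X - {w}) = [:0, 1:] * ?P (X - {m, w}) - (\<Sum>v\<in>{v\<in>X - {m, w}. E m v}. ?P (X - {m, v, w}))"
        using matching_poly_rec[of "X - {w}" m] less.prems m w by (simp only: e finite_Diff) auto
    qed
    moreover have "(\<Sum>w\<in>X - {m}. \<Sum>v\<in>{v\<in>X - {m, w}. E m v}. ?P (X - {m, v, w})) =
       (\<Sum>w\<in>X - {m}. \<Sum>v\<in>{v. v \<in> ?N \<and> w \<noteq> v}. ?P (X - {m, v, w}))"
      by (intro sum.cong refl) auto
    moreover have "\<dots> = (\<Sum>v\<in>?N. \<Sum>w\<in>{w. w \<in> X - {m} \<and> w \<noteq> v}. ?P (X - {m, v, w}))"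
      using less.prems by (intro sum.swap_restrict) auto
    moreover have "\<dots> = (\<Sum>v\<in>?N. \<Sum>w\<in>X - {m, v}. ?P (X - {m, v, w}))"
      by (intro sum.cong refl) auto
    ultimately show ?thesis by simp
  qed simp
qed

end

context bounded_graph_at
begin

lemma gl_finite: "finite X \<Longrightarrow> L \<subseteq> X \<Longrightarrow> t > 0 \<Longrightarrow> gl X L t = green E X L (Complex \<theta> t)"
  unfolding gl_def by (intro green_lim_finite) (auto intro: finite_subset)

lemma matching_val_tendsto: "((\<lambda>t. matching_val E X (Complex \<theta> t)) \<longlongrightarrow> matching_val E X (of_real \<theta>)) (at_right 0)"
proof -
  have "((\<lambda>t. matching_val E X (Complex \<theta> t)) \<longlongrightarrow> matching_val E X (Complex \<theta> 0)) (at_right 0)"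
    unfolding matching_val_def by (intro tendsto_poly tendsto_Complex tendsto_const tendsto_ident_at)
  then show ?thesis by (simp add: complex_of_real_def)
qed

text \<open>The logarithmic derivative of the matching polynomial is the sum of the Green functions, so the
  multiplicity of \<open>\<theta>\<close> is the sum of the atoms.\<close>

lemma matching_val_nonzero_if_no_atoms:
  assumes X: "finite X" and "\<And>u. u \<in> X \<Longrightarrow> atom X u = 0"
  shows "matching_val E X (of_real \<theta>) \<noteq> 0"
proof
  assume root: "matching_val E X (of_real \<theta>) = 0"
  define P :: "complex poly" where "P = map_poly of_int (matching_poly E X)"
  have P: "P \<noteq> 0" unfolding P_def using matching_poly_nonzero[OF X] by (simp add: map_poly_eq_0_iff)
  have evP: "matching_val E X z = poly P z" for z by (simp add: matching_val_def P_def)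
  have "pderiv P = map_poly of_int (pderiv (matching_poly E X))"
    unfolding P_def by (rule poly_eqI) (simp add: coeff_map_poly coeff_pderiv)
  then have evP': "(\<Sum>u\<in>X. matching_val E (X - {u}) z) = poly (pderiv P) z" for z
    unfolding matching_val_def by (simp add: pderiv_matching_poly[OF X] map_poly_of_int_sum poly_sum)
  define m where "m = order (of_real \<theta>) P"
  have m: "m > 0" using root P by (simp add: m_def evP order_gt_0_iff)
  obtain R where R: "P = [:- of_real \<theta>, 1:] ^ m * R" "\<not> [:- of_real \<theta>, 1:] dvd R"
    using order_decomp[OF P] unfolding m_def by blast
  have R0: "poly R (of_real \<theta>) \<noteq> 0" using R(2) by (simp add: poly_eq_0_iff_dvd)
  let ?w = "\<lambda>t. \<i> * complex_of_real t"
  \<comment> \<open>With \<open>P = (x - \<theta>)^m R\<close> one has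
    \<open>P' / P = m / (z - \<theta>) + R' / R\<close>, and
    \<open>z - \<theta> = i t\<close>.\<close>
  have eq: "?w t * (\<Sum>u\<in>X. gl X {u} t) = of_nat m + ?w t * poly (pderiv R) (Complex \<theta> t) / poly R (Complex \<theta> t)"
    if t: "t > 0" for t
  proof -
    define z where "z = Complex \<theta> t"
    have z: "z - of_real \<theta> = ?w t" "?w t \<noteq> 0" using t by (auto simp: z_def complex_eq_iff)
    have nz: "poly P z \<noteq> 0" using matching_val_nonzero[OF X, of z] t by (simp add: evP z_def)
    have p1: "poly P z = ?w t ^ m * poly R z"
      unfolding R(1) by (simp add: poly_power z(1)[symmetric])
    have Rz: "poly R z \<noteq> 0" using nz p1 by auto
    have "poly (pderiv P) z = of_nat m * ?w t ^ (m - 1) * poly R z + ?w t ^ m * poly (pderiv R) z"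
    proof -
      have "pderiv P = pderiv ([:- of_real \<theta>, 1:] ^ m) * R + [:- of_real \<theta>, 1:] ^ m * pderiv R"
        unfolding R(1) pderiv_mult by (simp add: algebra_simps)
      also have "pderiv ([:- complex_of_real \<theta>, 1:] ^ m) = smult (of_nat m) ([:- of_real \<theta>, 1:] ^ (m - 1))"
      proof -
        obtain n where n: "m = Suc n" using m by (cases m) auto
        have d: "pderiv [:- complex_of_real \<theta>, 1:] = 1" by (simp add: pderiv_pCons)
        show ?thesis unfolding n pderiv_power_Suc d by simp
      qed
      finally show ?thesis by (simp add: poly_power z(1)[symmetric])
    qed
    then have "?w t * poly (pderiv P) z = of_nat m * (?w t * ?w t ^ (m - 1)) * poly R z + ?w t * (?w t ^ m * poly (pderiv R) z)"
      by (simp add: algebra_simps)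
    also have "?w t * ?w t ^ (m - 1) = ?w t ^ m" using m by (simp add: power_eq_if)
    finally have "?w t * poly (pderiv P) z / poly P z = of_nat m + ?w t * poly (pderiv R) z / poly R z"
      unfolding p1 using z(2) Rz by (simp add: add_divide_distrib)
    moreover have "(\<Sum>u\<in>X. gl X {u} t) = poly (pderiv P) z / poly P z"
      using X t by (simp add: gl_finite green_def evP z_def evP'[symmetric] sum_divide_distrib)
    ultimately show ?thesis by (simp add: z_def)
  qed
  have "((\<lambda>t. \<Sum>u\<in>X. ?w t * gl X {u} t) \<longlongrightarrow> (\<Sum>u\<in>X. of_real (atom X u))) (at_right 0)"
    by (intro tendsto_sum gl_atom)
  then have l1: "((\<lambda>t. \<Sum>u\<in>X. ?w t * gl X {u} t) \<longlongrightarrow> 0) (at_right 0)" using assms(2) by simp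
  have "((\<lambda>t. of_nat m + ?w t * poly (pderiv R) (Complex \<theta> t) / poly R (Complex \<theta> t)) \<longlongrightarrow>
      of_nat m + \<i> * complex_of_real 0 * poly (pderiv R) (Complex \<theta> 0) / poly R (Complex \<theta> 0)) (at_right 0)"
    using R0 by (intro tendsto_intros tendsto_Complex) (auto simp: complex_of_real_def)
  moreover have "\<forall>\<^sub>F t in at_right 0. of_nat m + ?w t * poly (pderiv R) (Complex \<theta> t) / poly R (Complex \<theta> t) = (\<Sum>u\<in>X. ?w t * gl X {u} t)"
    using at_right_0_pos by eventually_elim (simp only: eq[symmetric] sum_distrib_left)
  ultimately have "((\<lambda>t. \<Sum>u\<in>X. ?w t * gl X {u} t) \<longlongrightarrow>
      of_nat m + \<i> * complex_of_real 0 * poly (pderiv R) (Complex \<theta> 0) / poly R (Complex \<theta> 0)) (at_right 0)"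
    by (rule Lim_transform_eventually)
  from tendsto_unique[OF trivial_limit_at_right_real this l1] m show False by simp
qed

text \<open>The vertices of \<open>B\<close> are deleted one by one. Each still contributes a factor
  of order \<open>t\<close>, since by \<open>atom_mono_delete\<close> its essential neighbour keeps
  an atom after the earlier deletions.\<close>

lemma gl_over_t_Un:
  assumes "finite B" "B \<subseteq> V" "\<And>b. b \<in> B \<Longrightarrow> atom V b = 0" "\<And>b. b \<in> B \<Longrightarrow> \<exists>w\<in>ess V. E b w"
  shows "\<exists>c\<ge>0. ((\<lambda>t. (\<i> / of_real t) ^ card B * gl V B t) \<longlongrightarrow> complex_of_real c) (at_right 0)"
  using assms
proof (induction B rule: finite_induct)
  case empty
  have "\<forall>\<^sub>F t in at_right 0. 1 = (\<i> / complex_of_real t) ^ card {} * gl V {} t"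
    using at_right_0_pos
  proof eventually_elim
    case (elim t)
    have "(\<lambda>n. green E (V \<inter> {..n}) {} (Complex \<theta> t)) = (\<lambda>_. 1)"
      using elim by (intro ext green_empty_set matching_val_nonzero) auto
    then show ?case by (simp add: gl_def green_lim_def)
  qed
  then show ?case
    by (intro exI[of _ 1]) (auto intro: Lim_transform_eventually[OF tendsto_const])
next
  case (insert b B)
  then obtain c where c: "c \<ge> 0" "((\<lambda>t. (\<i> / of_real t) ^ card B * gl V B t) \<longlongrightarrow> complex_of_real c) (at_right 0)"
    by auto
  obtain w where w: "w \<in> ess V" "E b w" using insert.prems by blast
  have w': "w \<notin> insert b B" using w insert.prems(2) by (auto simp: ess_def)
  have e: "V - B - {b} = V - insert b B" by auto
  have "atom V w \<le> atom (V - insert b B) w"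
    using insert w w' by (intro atom_mono_delete) (auto simp: ess_def)
  then have "nbr_mass (V - B) b > 0"
    using w w' by (intro nbr_mass_pos[of b w]) (auto simp: ess_def e)
  then have "((\<lambda>t. ((\<i> / of_real t) ^ card B * gl V B t) * (\<i> * gl (V - B) {b} t / of_real t)) \<longlongrightarrow>
      complex_of_real c * of_real (1 / nbr_mass (V - B) b)) (at_right 0)"
    using insert by (intro tendsto_mult c gl_over_t_tendsto) auto
  moreover have "\<forall>\<^sub>F t in at_right 0. ((\<i> / of_real t) ^ card B * gl V B t) * (\<i> * gl (V - B) {b} t / of_real t) =
      (\<i> / of_real t) ^ card (insert b B) * gl V (insert b B) t"
    using at_right_0_pos
  proof eventually_elim
    case (elim t)
    have "gl V B t * gl (V - B) {b} t = gl V (insert b B) t"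
      using gl_Un[of B "{b}" V t] insert elim by simp
    then show ?case using insert.hyps by (simp add: mult_ac flip: \<open>gl V B t * gl (V - B) {b} t = gl V (insert b B) t\<close>)
  qed
  ultimately have "((\<lambda>t. (\<i> / of_real t) ^ card (insert b B) * gl V (insert b B) t) \<longlongrightarrow> complex_of_real (c * (1 / nbr_mass (V - B) b))) (at_right 0)"
    unfolding of_real_mult by (rule Lim_transform_eventually)
  moreover have "c * (1 / nbr_mass (V - B) b) \<ge> 0" using c(1) nbr_mass_nonneg by simp
  ultimately show ?case by blast
qed

lemma gl_nonzero_Un: "finite B \<Longrightarrow> B \<subseteq> V \<Longrightarrow> t > 0 \<Longrightarrow> gl V B t \<noteq> 0"
proof (induction B rule: finite_induct)
  case empty
  have "(\<lambda>n. green E (V \<inter> {..n}) {} (Complex \<theta> t)) = (\<lambda>_. 1)"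
    using empty by (intro ext green_empty_set matching_val_nonzero) auto
  then show ?case by (simp add: gl_def green_lim_def)
next
  case (insert b B)
  then have "gl V B t * gl (V - B) {b} t = gl V (insert b B) t"
    using gl_Un[of B "{b}" V t] by simp
  moreover have "gl (V - B) {b} t \<noteq> 0" using insert by (intro gl_nonzero) auto
  ultimately show ?case using insert by auto
qed

text \<open>The opposite estimate: no one-vertex Green function decays faster than order
  \<open>t\<close>, because \<open>t / gl\<close> always converges. The limit \<open>d\<close> may
  be 0.\<close>

lemma t_over_gl_Un:
  assumes "finite B" "B \<subseteq> V"
  shows "\<exists>d\<ge>0. ((\<lambda>t. (of_real t / \<i>) ^ card B / gl V B t) \<longlongrightarrow> complex_of_real d) (at_right 0)"
  using assms
proof (induction B rule: finite_induct)
  case empty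
  have "\<forall>\<^sub>F t in at_right 0. 1 = (complex_of_real t / \<i>) ^ card {} / gl V {} t"
    using at_right_0_pos
  proof eventually_elim
    case (elim t)
    have "(\<lambda>n. green E (V \<inter> {..n}) {} (Complex \<theta> t)) = (\<lambda>_. 1)"
      using elim by (intro ext green_empty_set matching_val_nonzero) auto
    then show ?case by (simp add: gl_def green_lim_def)
  qed
  then show ?case
    by (intro exI[of _ 1]) (auto intro: Lim_transform_eventually[OF tendsto_const])
next
  case (insert b B)
  then obtain d where d: "d \<ge> 0" "((\<lambda>t. (of_real t / \<i>) ^ card B / gl V B t) \<longlongrightarrow> complex_of_real d) (at_right 0)"
    by auto
  have "((\<lambda>t. ((of_real t / \<i>) ^ card B / gl V B t) * ((of_real t / gl (V - B) {b} t) / \<i>)) \<longlongrightarrow>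
      complex_of_real d * (\<i> * of_real (nbr_mass (V - B) b) / \<i>)) (at_right 0)"
    using insert by (intro tendsto_mult tendsto_divide tendsto_const d inverse_gl_tendsto) auto
  moreover have "\<forall>\<^sub>F t in at_right 0. ((of_real t / \<i>) ^ card B / gl V B t) * ((of_real t / gl (V - B) {b} t) / \<i>) =
      (of_real t / \<i>) ^ card (insert b B) / gl V (insert b B) t"
    using at_right_0_pos
  proof eventually_elim
    case (elim t)
    have "gl V (insert b B) t = gl V B t * gl (V - B) {b} t"
      using gl_Un[of B "{b}" V t] insert elim by simp
    then show ?case using insert.hyps by (simp add: mult_ac)
  qed
  ultimately have "((\<lambda>t. (of_real t / \<i>) ^ card (insert b B) / gl V (insert b B) t) \<longlongrightarrow> complex_of_real d * (\<i> * of_real (nbr_mass (V - B) b) / \<i>)) (at_right 0)"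
    by (rule Lim_transform_eventually)
  then have "((\<lambda>t. (of_real t / \<i>) ^ card (insert b B) / gl V (insert b B) t) \<longlongrightarrow> complex_of_real (d * nbr_mass (V - B) b)) (at_right 0)"
    by simp
  moreover have "d * nbr_mass (V - B) b \<ge> 0" using d(1) nbr_mass_nonneg by simp
  ultimately show ?case by blast
qed

definition component :: "nat set \<Rightarrow> nat \<Rightarrow> nat set" where
  "component V u = {v. (u, v) \<in> (ess_rel V)\<^sup>*}"

section \<open>A finite component of essential vertices and its boundary\<close>

context
  fixes V S u0
  assumes u0: "u0 \<in> ess V" and S_def: "S = component V u0" and finS: "finite S"
begin

lemma component_ess: "S \<subseteq> ess V"
  unfolding S_def component_def using ess_rel_ess u0 by auto

lemma component_sub: "S \<subseteq> V"
  using component_ess by (auto simp: ess_def)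

lemma u0_in: "u0 \<in> S"
  by (simp add: S_def component_def)

lemma bdry_atom: "a \<in> bdry S V \<Longrightarrow> atom V a = 0"
proof (rule ccontr)
  assume a: "a \<in> bdry S V" "atom V a \<noteq> 0"
  then obtain u where u: "u \<in> S" "E u a" by (auto simp: bdry_def)
  have "a \<in> ess V" using a atom_nonneg[of V a] by (auto simp: bdry_def ess_def order_less_le)
  then have "(u, a) \<in> ess_rel V" using u component_ess by (auto simp: ess_rel_def)
  then have "a \<in> S" using u(1) by (auto simp: S_def component_def intro: rtrancl_into_rtrancl)
  then show False using a by (simp add: bdry_def)
qed

lemma bdry_facts: "finite (bdry S V)" "bdry S V \<subseteq> V" "bdry S V \<inter> S = {}" "bdry S (V - bdry S V) = {}"
  using finite_bdry[OF finS] by (auto simp: bdry_def)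

lemma gl_component:
  assumes "L \<subseteq> S" "t > 0"
  shows "gl (V - bdry S V) L t = gl S L t"
proof -
  have "gl (V - bdry S V) L t = green E S L (Complex \<theta> t)"
    unfolding gl_def using assms finS component_sub bdry_facts
    by (intro green_lim_isolated) auto
  then show ?thesis using gl_finite[OF finS assms] by simp
qed

text \<open>Boundary vertices have no atom, so deleting them can only increase the atoms on
  \<open>S\<close>; afterwards \<open>S\<close> is isolated and its Green functions are those of the
  finite graph \<open>S\<close>.\<close>

lemma atom_component_pos: "u \<in> S \<Longrightarrow> atom S u > 0"
proof -
  assume u: "u \<in> S"
  have uV: "u \<in> V - bdry S V" using u component_sub bdry_facts by auto
  have "((\<lambda>t. \<i> * of_real t * gl S {u} t) \<longlongrightarrow> of_real (atom (V - bdry S V) u)) (at_right 0)"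
  proof (rule Lim_transform_eventually[OF gl_atom[OF uV]])
    show "\<forall>\<^sub>F t in at_right 0. \<i> * of_real t * gl (V - bdry S V) {u} t = \<i> * of_real t * gl S {u} t"
      using at_right_0_pos by eventually_elim (simp add: gl_component u)
  qed
  from tendsto_unique[OF trivial_limit_at_right_real this gl_atom[OF u]]
  have "atom (V - bdry S V) u = atom S u" by simp
  moreover have "atom V u \<le> atom (V - bdry S V) u"
    using bdry_facts uV bdry_atom by (intro atom_mono_delete) auto
  moreover have "atom V u > 0" using u component_ess by (auto simp: ess_def)
  ultimately show ?thesis by simp
qed

text \<open>Otherwise the Green function of \<open>S\<close> would stay bounded near
  \<open>\<theta>\<close> and leave no atom.\<close>

lemma component_root: "matching_val E S (of_real \<theta>) = 0"
proof (rule ccontr)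
  assume nz: "matching_val E S (of_real \<theta>) \<noteq> 0"
  have "((\<lambda>t. \<i> * of_real t * (matching_val E (S - {u0}) (Complex \<theta> t) / matching_val E S (Complex \<theta> t))) \<longlongrightarrow>
      \<i> * of_real 0 * (matching_val E (S - {u0}) (of_real \<theta>) / matching_val E S (of_real \<theta>))) (at_right 0)"
    using nz by (intro tendsto_intros matching_val_tendsto)
  moreover have "\<forall>\<^sub>F t in at_right 0. \<i> * of_real t * (matching_val E (S - {u0}) (Complex \<theta> t) / matching_val E S (Complex \<theta> t)) =
      \<i> * of_real t * gl S {u0} t"
    using at_right_0_pos by eventually_elim (simp add: gl_finite[OF finS] u0_in green_def)
  ultimately have "((\<lambda>t. \<i> * of_real t * gl S {u0} t) \<longlongrightarrow>
      \<i> * of_real 0 * (matching_val E (S - {u0}) (of_real \<theta>) / matching_val E S (of_real \<theta>))) (at_right 0)"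
    by (rule Lim_transform_eventually)
  from tendsto_unique[OF trivial_limit_at_right_real this gl_atom[OF u0_in]]
  show False using atom_component_pos[OF u0_in] by simp
qed

text \<open>Within the graph \<open>S\<close> all vertices are essential and connected to
  \<open>u0\<close>, so deleting \<open>u0\<close> destroys all atoms and \<open>\<theta>\<close> is
  not a root of the matching polynomial of \<open>S - {u0}\<close>. The bound \<open>1 / t\<close>
  for the Green function at \<open>u0\<close> then keeps the polynomial of \<open>S\<close> at least
  of order \<open>t\<close>.\<close>

lemma component_simple_root: "\<exists>c>0. \<forall>\<^sub>F t in at_right 0. c * t \<le> norm (matching_val E S (Complex \<theta> t))"
proof -
  have conn: "(u0, v) \<in> (ess_rel S)\<^sup>*" if "v \<in> S" for v
  proof -
    have "(u0, v) \<in> (ess_rel V)\<^sup>*" using that by (simp add: S_def component_def)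
    then have "(u0, v) \<in> (ess_rel S)\<^sup>* \<and> v \<in> S"
    proof (induction rule: rtrancl_induct)
      case base
      show ?case by (simp add: u0_in)
    next
      case (step x y)
      have x: "x \<in> S" using step.IH by simp
      then have y: "y \<in> S"
        using step.hyps(2) by (auto simp: S_def component_def intro: rtrancl_into_rtrancl)
      have "(x, y) \<in> ess_rel S"
        using step.hyps(2) x y atom_component_pos by (auto simp: ess_rel_def ess_def)
      then show ?case using step.IH y by (auto intro: rtrancl_into_rtrancl)
    qed
    then show ?thesis ..
  qed
  have "atom (S - {u0}) v = 0" if "v \<in> S - {u0}" for v
    using atom_delete_connected[of v u0 S] conn[of v] ess_rel_sym[of u0 v S] that atom_component_pos
    by (auto simp: ess_def)
  then have nz: "matching_val E (S - {u0}) (of_real \<theta>) \<noteq> 0"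
    using finS by (intro matching_val_nonzero_if_no_atoms) auto
  define c where "c = norm (matching_val E (S - {u0}) (of_real \<theta>)) / 2"
  have c: "c > 0" "c < norm (matching_val E (S - {u0}) (of_real \<theta>))" using nz by (auto simp: c_def)
  have "\<forall>\<^sub>F t in at_right 0. c < norm (matching_val E (S - {u0}) (Complex \<theta> t))"
    by (rule order_tendstoD(1)[OF tendsto_norm[OF matching_val_tendsto] c(2)])
  then have "\<forall>\<^sub>F t in at_right 0. c * t \<le> norm (matching_val E S (Complex \<theta> t))"
    using at_right_0_pos
  proof eventually_elim
    case (elim t)
    have z: "Im (Complex \<theta> t) > 0" using elim by simp
    have mz: "matching_val E S (Complex \<theta> t) \<noteq> 0" by (rule matching_val_nonzero[OF finS z])
    have "norm (green E S {u0} (Complex \<theta> t)) \<le> 1 / t"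
      using norm_green_le[OF finS z u0_in] by simp
    then have "norm (matching_val E (S - {u0}) (Complex \<theta> t)) * t \<le> norm (matching_val E S (Complex \<theta> t))"
      using mz elim by (simp add: green_def norm_divide field_simps)
    moreover have "c * t \<le> norm (matching_val E (S - {u0}) (Complex \<theta> t)) * t"
      using elim by (intro mult_right_mono) auto
    ultimately show ?case by linarith
  qed
  then show ?thesis using c(1) by blast
qed

text \<open>Expanding the matching polynomial along the edges that leave a component, the terms with two
  or more such edges vanish in the limit because \<open>\<theta>\<close> is only a simple root of the matching polynomial
  of the component. What remains is a probability distribution: either the component is matched to no
  boundary vertex or it is matched along exactly one edge.\<close>

lemma component_inflow:
  "(\<Sum>u\<in>S. \<Sum>a\<in>{a\<in>V - S. E u a}. transport V a u) \<le> 1"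
proof -
  let ?B = "bdry S V"
  let ?m = "\<lambda>t. matching_val E S (Complex \<theta> t)"
  let ?P = "{A. A \<subseteq> ?B \<and> 2 \<le> card A}"
  have Bess: "\<exists>w\<in>ess V. E b w" if b: "b \<in> ?B" for b
  proof -
    obtain u where "u \<in> S" "E u b" using b by (auto simp: bdry_def)
    then show ?thesis using component_ess sym by blast
  qed
  obtain c where c: "c \<ge> 0" "((\<lambda>t. (\<i> / of_real t) ^ card ?B * gl V ?B t) \<longlongrightarrow> complex_of_real c) (at_right 0)"
    using gl_over_t_Un[OF bdry_facts(1,2) bdry_atom Bess] by blast
  have mnz: "?m t \<noteq> 0" if "t > 0" for t using matching_val_nonzero[OF finS, of "Complex \<theta> t"] that by simp
  have SB: "gl V (S \<union> ?B) t = gl V ?B t / ?m t" if t: "t > 0" for t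
  proof -
    have "gl V ?B t * gl (V - ?B) S t = gl V (?B \<union> S) t"
      using bdry_facts component_sub finS t by (intro gl_Un) auto
    moreover have "gl (V - ?B) S t = 1 / ?m t"
      using gl_component[OF subset_refl t] gl_finite[OF finS subset_refl t] by (simp add: green_def)
    ultimately show ?thesis by (simp add: Un_commute)
  qed
  obtain d where d: "d \<ge> 0" "((\<lambda>t. (of_real t / \<i>) ^ card ?B / gl (V - S) ?B t) \<longlongrightarrow> complex_of_real d) (at_right 0)"
    using t_over_gl_Un[of ?B "V - S"] bdry_facts by blast
  \<comment> \<open>Each of the two quotients compares the boundary with a power of
    \<open>t\<close>, once in \<open>V\<close> and once in \<open>V - S\<close>. The powers cancel,
    and only the sign of the limit \<open>c * d\<close> matters later.\<close>
  have free: "((\<lambda>t. ?m t * gl V S t) \<longlongrightarrow> of_real (c * d)) (at_right 0)"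
    unfolding of_real_mult
  proof (rule Lim_transform_eventually[OF tendsto_mult[OF c(2) d(2)]])
    show "\<forall>\<^sub>F t in at_right 0. (\<i> / of_real t) ^ card ?B * gl V ?B t * ((of_real t / \<i>) ^ card ?B / gl (V - S) ?B t) = ?m t * gl V S t"
      using at_right_0_pos
    proof eventually_elim
      case (elim t)
      have "gl V S t * gl (V - S) ?B t = gl V (S \<union> ?B) t"
        using bdry_facts component_sub finS elim by (intro gl_Un) auto
      moreover have "gl (V - S) ?B t \<noteq> 0"
        using bdry_facts elim by (intro gl_nonzero_Un) auto
      ultimately have "?m t * gl V S t = gl V ?B t / gl (V - S) ?B t"
        using SB[OF elim] mnz[OF elim] by (simp add: field_simps)
      moreover have "(\<i> / of_real t) ^ card ?B * (of_real t / \<i>) ^ card ?B = 1"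
        using elim by (simp flip: power_mult_distrib)
      ultimately show ?case by (simp add: mult_ac)
    qed
  qed
  obtain c1 where c1: "c1 > 0" "\<forall>\<^sub>F t in at_right 0. c1 * t \<le> norm (?m t)"
    using component_simple_root by blast
  \<comment> \<open>Order count: the whole boundary gives \<open>t^|B|\<close>, the part outside
    \<open>A\<close> takes back at most \<open>t^(|B|-|A|)\<close>, and the simple root of the
    polynomial of \<open>S\<close> costs one more factor \<open>t\<close>. What remains is of order
    \<open>t^(|A|-1)\<close>, which vanishes for \<open>|A| \<ge> 2\<close>.\<close>
  have multi: "((\<lambda>t. gl V (S \<union> A) t) \<longlongrightarrow> 0) (at_right 0)" if A: "A \<in> ?P" for A
  proof -
    have A': "A \<subseteq> ?B" "2 \<le> card A" "finite A" using A finite_subset[OF _ bdry_facts(1)] by auto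
    obtain e where e: "((\<lambda>t. (of_real t / \<i>) ^ card (?B - A) / gl (V - (S \<union> A)) (?B - A) t) \<longlongrightarrow> complex_of_real e) (at_right 0)"
      using t_over_gl_Un[of "?B - A" "V - (S \<union> A)"] bdry_facts by blast
    let ?k = "\<lambda>t. ((\<i> / of_real t) ^ card ?B * gl V ?B t) * ((of_real t / \<i>) ^ card (?B - A) / gl (V - (S \<union> A)) (?B - A) t)"
    have q: "((\<lambda>t. (of_real t / \<i>) ^ card A / ?m t) \<longlongrightarrow> 0) (at_right 0)"
    proof (rule Lim_null_comparison)
      show "\<forall>\<^sub>F t in at_right 0. norm ((of_real t / \<i>) ^ card A / ?m t) \<le> t ^ (card A - 1) / c1"
        using at_right_0_pos c1(2)
      proof eventually_elim
        case (elim t)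
        have "norm ((of_real t / \<i>) ^ card A / ?m t) = t ^ card A / norm (?m t)"
          using elim by (simp add: norm_divide norm_power norm_mult)
        also have "\<dots> \<le> t ^ card A / (c1 * t)"
          using elim c1(1) mnz[of t] by (intro divide_left_mono) auto
        also have "t ^ card A = t ^ (card A - 1) * t"
          using A'(2) by (simp add: power_eq_if[of t "card A"] mult.commute)
        finally show ?case using elim by simp
      qed
      have "((\<lambda>t. t ^ (card A - 1) / c1) \<longlongrightarrow> 0 ^ (card A - 1) / c1) (at_right 0)"
        using c1(1) by (intro tendsto_intros) auto
      then show "((\<lambda>t. t ^ (card A - 1) / c1) \<longlongrightarrow> 0) (at_right 0)"
        using A'(2) by (simp add: power_0_left)
    qed
    have "((\<lambda>t. ?k t * ((of_real t / \<i>) ^ card A / ?m t)) \<longlongrightarrow> complex_of_real c * complex_of_real e * 0) (at_right 0)"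
      by (intro tendsto_mult c(2) e q)
    moreover have "\<forall>\<^sub>F t in at_right 0. ?k t * ((of_real t / \<i>) ^ card A / ?m t) = gl V (S \<union> A) t"
      using at_right_0_pos
    proof eventually_elim
      case (elim t)
      have "gl V (S \<union> A) t * gl (V - (S \<union> A)) (?B - A) t = gl V (S \<union> A \<union> (?B - A)) t"
        using bdry_facts component_sub finS elim A' by (intro gl_Un) auto
      also have "S \<union> A \<union> (?B - A) = S \<union> ?B" using A' by auto
      finally have "gl V (S \<union> A) t * gl (V - (S \<union> A)) (?B - A) t = gl V ?B t / ?m t"
        using SB[OF elim] by simp
      moreover have "gl (V - (S \<union> A)) (?B - A) t \<noteq> 0"
        using bdry_facts elim by (intro gl_nonzero_Un) auto
      ultimately have g: "gl V (S \<union> A) t = gl V ?B t / gl (V - (S \<union> A)) (?B - A) t / ?m t"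
        using mnz[OF elim] by (simp add: field_simps)
      have "card ?B = card (?B - A) + card A"
        using A' bdry_facts by (simp add: card_Diff_subset card_mono)
      then have p: "(\<i> / of_real t) ^ card ?B * ((of_real t / \<i>) ^ card (?B - A) * (of_real t / \<i>) ^ card A) = 1"
        using elim by (simp flip: power_mult_distrib power_add)
      have r: "x1 * y * (x2 / h) * (x3 / m) = (x1 * (x2 * x3)) * (y / h / m)" for x1 x2 x3 y h m :: complex
        by simp
      show ?case unfolding g r p by simp
    qed
    ultimately show ?thesis by (simp add: Lim_transform_eventually)
  qed
  define F where "F t = 1 - ?m t * gl V S t + (\<Sum>u\<in>S. \<Sum>a\<in>{a\<in>V - S. E u a}. gl V {u, a} t)" for t
  have F_lim: "(F \<longlongrightarrow> 1 - of_real (c * d) + (\<Sum>u\<in>S. \<Sum>a\<in>{a\<in>V - S. E u a}. - of_real (transport V a u))) (at_right 0)"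
    unfolding F_def
  proof (intro tendsto_add tendsto_diff tendsto_const free tendsto_sum)
    fix u a assume ua: "u \<in> S" "a \<in> {a\<in>V - S. E u a}"
    have a: "a \<in> V" "a \<in> ?B" using ua by (auto simp: bdry_def)
    have "nbr_mass V a > 0"
      using special_nbr_mass_pos[OF a(1) bdry_atom[OF a(2)]] Bess[OF a(2)] by blast
    then have "((\<lambda>t. - gl V {a, u} t) \<longlongrightarrow> of_real (transport V a u)) (at_right 0)"
      using ua component_sub by (intro transport_tendsto) auto
    then show "((\<lambda>t. gl V {u, a} t) \<longlongrightarrow> - of_real (transport V a u)) (at_right 0)"
      using tendsto_minus by (fastforce simp: insert_commute)
  qed
  \<comment> \<open>The radius comes from \<open>t < 1\<close>, which keeps
    \<open>\<theta> + i t\<close> in a fixed disc.\<close>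
  obtain C where C: "C \<ge> 0" "\<And>z. Im z > 0 \<and> norm z \<le> \<bar>\<theta>\<bar> + 1 \<Longrightarrow>
    norm (1 - matching_val E S z * green_lim E V S z + (\<Sum>u\<in>S. \<Sum>a\<in>{a\<in>V - S. E u a}. green_lim E V {u, a} z))
      \<le> C * (\<Sum>A\<in>?P. norm (green_lim E V (S \<union> A) z))"
    using cut_expansion[OF finS component_sub, of "\<bar>\<theta>\<bar> + 1"] by auto
  have "(F \<longlongrightarrow> 0) (at_right 0)"
  proof (rule Lim_null_comparison)
    show "\<forall>\<^sub>F t in at_right 0. norm (F t) \<le> C * (\<Sum>A\<in>?P. norm (gl V (S \<union> A) t))"
      using eventually_at_right_real[OF zero_less_one]
    proof eventually_elim
      case (elim t)
      have "norm (Complex \<theta> t) \<le> \<bar>\<theta>\<bar> + 1"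
        using cmod_le[of "Complex \<theta> t"] elim by simp
      then show ?case using C(2)[of "Complex \<theta> t"] elim by (simp add: F_def gl_def)
    qed
    have "((\<lambda>t. C * (\<Sum>A\<in>?P. norm (gl V (S \<union> A) t))) \<longlongrightarrow> C * (\<Sum>A\<in>?P. 0)) (at_right 0)"
      by (intro tendsto_intros tendsto_norm_zero multi)
    then show "((\<lambda>t. C * (\<Sum>A\<in>?P. norm (gl V (S \<union> A) t))) \<longlongrightarrow> 0) (at_right 0)" by simp
  qed
  \<comment> \<open>Here \<open>c * d\<close> is the weight of joining \<open>S\<close> to no
    boundary vertex; together with the inflow it adds up to 1.\<close>
  from tendsto_unique[OF trivial_limit_at_right_real F_lim this]
  have "complex_of_real (1 - c * d - (\<Sum>u\<in>S. \<Sum>a\<in>{a\<in>V - S. E u a}. transport V a u)) = 0"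
    by (simp add: sum_negf)
  then have "1 - c * d - (\<Sum>u\<in>S. \<Sum>a\<in>{a\<in>V - S. E u a}. transport V a u) = 0"
    by (simp only: of_real_eq_0_iff)
  moreover have "c * d \<ge> 0" using c(1) d(1) by simp
  ultimately show ?thesis by linarith
qed

end

end

section \<open>Roots of small matching polynomials\<close>

context bounded_graph
begin

text \<open>The induction rests on \<open>n! + n (n-1)! \<le> (n+1)!\<close>. Any bound depending on
  the number of vertices alone would serve.\<close>

lemma matching_poly_coeff_bound:
  "finite X \<Longrightarrow> \<bar>coeff (matching_poly E X) i\<bar> \<le> fact (card X)"
proof (induction "card X" arbitrary: X i rule: less_induct)
  case less
  let ?P = "matching_poly E"
  show ?case
  proof (cases "X = {}")
    case True
    then show ?thesis by (cases i) auto
  next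
    case False
    then obtain m where m: "m \<in> X" by blast
    have c: "card (X - {m}) < card X" "\<And>v. card (X - {m, v}) < card X"
      by (rule psubset_card_mono[OF less.prems], use m in blast)+
    define n where "n = card (X - {m})"
    have n: "card X = Suc n" using card_Suc_Diff1[OF less.prems m] by (simp add: n_def)
    let ?N = "{v\<in>X - {m}. E m v}"
    have 1: "\<bar>coeff ([:0, 1:] * ?P (X - {m})) i\<bar> \<le> fact n"
      using less.hyps[OF c(1), of "i - 1"] less.prems by (cases i) (auto simp: n_def)
    have 2: "\<bar>coeff (\<Sum>v\<in>?N. ?P (X - {m, v})) i\<bar> \<le> int n * fact (n - 1)"
    proof -
      have "\<bar>coeff (?P (X - {m, v})) i\<bar> \<le> fact (n - 1)" if "v \<in> ?N" for v
      proof -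
        have e: "X - {m, v} = X - {m} - {v}" by auto
        have "card (X - {m, v}) = n - 1" unfolding e n_def using that less.prems by (intro card_Diff_singleton) auto
        then show ?thesis using less.hyps[OF c(2), of v i] less.prems by (metis finite_Diff)
      qed
      then have "\<bar>coeff (\<Sum>v\<in>?N. ?P (X - {m, v})) i\<bar> \<le> (\<Sum>v\<in>?N. fact (n - 1))"
        unfolding coeff_sum by (intro order.trans[OF sum_abs] sum_mono)
      also have "\<dots> = int (card ?N) * fact (n - 1)" by simp
      also have "card ?N \<le> n" unfolding n_def using less.prems by (intro card_mono) auto
      finally show ?thesis by (simp add: mult_right_mono)
    qed
    have "\<bar>coeff (?P X) i\<bar> \<le> fact n + int n * fact (n - 1)"
      unfolding matching_poly_rec[OF less.prems m] coeff_diff using 1 2 by linarith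
    also have "\<dots> \<le> fact (Suc n)"
    proof (cases n)
      case (Suc k)
      have "fact n + int n * fact (n - 1) = 2 * fact n" using Suc by simp
      also have "\<dots> \<le> (1 + int n) * fact n" using Suc by (intro mult_right_mono) auto
      finally show ?thesis by simp
    qed simp
    finally show ?thesis unfolding n .
  qed
qed

end

lemma finite_bounded_int_polys: "finite {p :: int poly. degree p < K \<and> (\<forall>i. \<bar>coeff p i\<bar> \<le> N)}"
proof (rule finite_subset)
  show "finite (Poly ` {xs. set xs \<subseteq> {- N..N} \<and> length xs \<le> K})"
    by (intro finite_imageI finite_lists_length_le) auto
  show "{p :: int poly. degree p < K \<and> (\<forall>i. \<bar>coeff p i\<bar> \<le> N)} \<subseteq> Poly ` {xs. set xs \<subseteq> {- N..N} \<and> length xs \<le> K}"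
  proof
    fix p :: "int poly" assume p: "p \<in> {p. degree p < K \<and> (\<forall>i. \<bar>coeff p i\<bar> \<le> N)}"
    have "set (coeffs p) \<subseteq> {- N..N}"
    proof
      fix c assume "c \<in> set (coeffs p)"
      then obtain i where "c = coeff p i" by (auto simp: coeffs_def split: if_splits)
      then have "\<bar>c\<bar> \<le> N" using p by simp
      then show "c \<in> {- N..N}" by auto
    qed
    moreover have "length (coeffs p) \<le> K" using p by (auto simp: coeffs_def)
    ultimately show "p \<in> Poly ` {xs. set xs \<subseteq> {- N..N} \<and> length xs \<le> K}"
      by (intro image_eqI[of _ _ "coeffs p"]) auto
  qed
qed

text \<open>Graphs are not enumerated up to isomorphism: there are only finitely many integer
  polynomials of degree below \<open>K\<close> with coefficients bounded by \<open>K!\<close>, and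
  each nonzero one has finitely many roots.\<close>

lemma finite_small_matching_roots:
  "finite {\<theta> :: real. \<exists>E D S. bounded_graph E D \<and> finite S \<and> card S < K \<and> matching_val E S (of_real \<theta>) = 0}"
proof (rule finite_subset)
  let ?Q = "{p :: int poly. degree p < K \<and> (\<forall>i. \<bar>coeff p i\<bar> \<le> fact K)} - {0}"
  show "finite (\<Union>p\<in>?Q. {x :: real. poly (map_poly of_int p) x = 0})"
  proof (rule finite_UN_I)
    show "finite ?Q" using finite_bounded_int_polys by blast
    fix p :: "int poly" assume "p \<in> ?Q"
    then have "map_poly real_of_int p \<noteq> 0" by (simp add: map_poly_eq_0_iff)
    then show "finite {x :: real. poly (map_poly of_int p) x = 0}" by (rule poly_roots_finite)
  qed
  show "{\<theta> :: real. \<exists>E D S. bounded_graph E D \<and> finite S \<and> card S < K \<and> matching_val E S (of_real \<theta>) = 0} \<subseteq>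
      (\<Union>p\<in>?Q. {x :: real. poly (map_poly of_int p) x = 0})"
  proof
    fix \<theta> :: real
    assume "\<theta> \<in> {\<theta> :: real. \<exists>E D S. bounded_graph E D \<and> finite S \<and> card S < K \<and> matching_val E S (of_real \<theta>) = 0}"
    then obtain E D S where *: "bounded_graph E D" "finite S" "card S < K" "matching_val E S (of_real \<theta>) = 0" by blast
    interpret bounded_graph E D by fact
    let ?p = "matching_poly E S"
    have "fact (card S) \<le> (fact K :: int)" using *(3) by (intro fact_mono) auto
    then have "\<forall>i. \<bar>coeff ?p i\<bar> \<le> fact K"
      using matching_poly_coeff_bound[OF *(2)] order.trans by blast
    then have "?p \<in> ?Q" using *(2,3) degree_matching_poly matching_poly_nonzero by auto
    moreover have "complex_of_real (poly (map_poly of_int ?p) \<theta>) = 0"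
      using *(4) unfolding matching_val_cpoly poly_cpoly_of_real .
    ultimately show "\<theta> \<in> (\<Union>p\<in>?Q. {x :: real. poly (map_poly of_int p) x = 0})" by auto
  qed
qed

section \<open>Closed walks and matching measures under isomorphisms\<close>

lemma closed_walks_map:
  assumes V: "\<And>x. x \<in> V \<Longrightarrow> \<phi> x \<in> V'" and inj: "inj_on \<phi> V"
    and E: "\<And>x y. x \<in> V \<Longrightarrow> y \<in> V \<Longrightarrow> E x y \<Longrightarrow> E' (\<phi> x) (\<phi> y)"
    and ws: "length ws = Suc k" "hd ws = [u]" "last ws = [u]" "set ws \<subseteq> path_tree_verts (V, E) u"
      "\<forall>i<k. path_tree_adj (ws ! i) (ws ! Suc i)"
  shows "length (map (map \<phi>) ws) = Suc k \<and> hd (map (map \<phi>) ws) = [\<phi> u] \<and> last (map (map \<phi>) ws) = [\<phi> u] \<and>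
    set (map (map \<phi>) ws) \<subseteq> path_tree_verts (V', E') (\<phi> u) \<and>
    (\<forall>i<k. path_tree_adj (map (map \<phi>) ws ! i) (map (map \<phi>) ws ! Suc i))"
proof -
  have ne: "ws \<noteq> []" using ws(1) by auto
  have "map \<phi> p \<in> path_tree_verts (V', E') (\<phi> u)" if p: "p \<in> path_tree_verts (V, E) u" for p
  proof -
    have p': "p \<noteq> []" "hd p = u" "distinct p" "set p \<subseteq> V" "\<And>i. Suc i < length p \<Longrightarrow> E (p ! i) (p ! Suc i)"
      using p by (auto simp: path_tree_verts_def verts_def adj_def)
    have "E' (\<phi> (p ! i)) (\<phi> (p ! Suc i))" if "Suc i < length p" for i
      using that p'(4,5) by (intro E) (auto simp: subset_iff)
    moreover have "distinct (map \<phi> p)" using p' inj inj_on_subset by (auto simp: distinct_map)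
    ultimately show ?thesis
      using p' V by (auto simp: path_tree_verts_def verts_def adj_def hd_map)
  qed
  moreover have "path_tree_adj (map \<phi> p) (map \<phi> q)" if "path_tree_adj p q" for p q
    using that by (auto simp: path_tree_adj_def)
  ultimately show ?thesis using ws ne by (auto simp: hd_map last_map)
qed

lemma closed_walks_iso:
  assumes bij: "bij_betw \<phi> V V'" and E: "\<And>x y. x \<in> V \<Longrightarrow> y \<in> V \<Longrightarrow> E' (\<phi> x) (\<phi> y) \<longleftrightarrow> E x y" and u: "u \<in> V"
  shows "path_tree_closed_walks (V', E') (\<phi> u) k = path_tree_closed_walks (V, E) u k"
proof -
  let ?\<psi> = "the_inv_into V \<phi>"
  let ?W = "\<lambda>V E u. {ws. length ws = Suc k \<and> hd ws = [u] \<and> last ws = [u] \<and>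
      set ws \<subseteq> path_tree_verts (V, E) u \<and> (\<forall>i<k. path_tree_adj (ws ! i) (ws ! Suc i))}"
  have inj: "inj_on \<phi> V" and im: "\<phi> ` V = V'" using bij by (auto simp: bij_betw_def)
  have \<psi>: "?\<psi> (\<phi> x) = x" if "x \<in> V" for x using the_inv_into_f_f[OF inj that] .
  have \<phi>: "\<phi> (?\<psi> y) = y" if "y \<in> V'" for y using f_the_inv_into_f[OF inj] that im by blast
  have \<psi>V: "?\<psi> y \<in> V" if "y \<in> V'" for y using the_inv_into_into[OF inj _ subset_refl] that im by blast
  have sub: "set p \<subseteq> V" if "ws \<in> ?W V E u" "p \<in> set ws" for ws p V E u
    using that by (auto simp: path_tree_verts_def verts_def)
  have "bij_betw (map (map \<phi>)) (?W V E u) (?W V' E' (\<phi> u))"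
  proof (rule bij_betw_byWitness[where f' = "map (map ?\<psi>)"])
    have "map (map ?\<psi>) (map (map \<phi>) ws) = ws" if "ws \<in> ?W V E u" for ws
    proof -
      have "map ?\<psi> (map \<phi> p) = p" if "p \<in> set ws" for p
        using sub[OF \<open>ws \<in> ?W V E u\<close> that] \<psi> unfolding map_map by (intro map_idI) (auto simp: subset_iff)
      then show ?thesis unfolding map_map by (intro map_idI) auto
    qed
    then show "\<forall>ws\<in>?W V E u. map (map ?\<psi>) (map (map \<phi>) ws) = ws" by blast
    have "map (map \<phi>) (map (map ?\<psi>) ws) = ws" if "ws \<in> ?W V' E' (\<phi> u)" for ws
    proof -
      have "map \<phi> (map ?\<psi> p) = p" if "p \<in> set ws" for p
        using sub[OF \<open>ws \<in> ?W V' E' (\<phi> u)\<close> that] \<phi> unfolding map_map by (intro map_idI) (auto simp: subset_iff)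
      then show ?thesis unfolding map_map by (intro map_idI) auto
    qed
    then show "\<forall>ws\<in>?W V' E' (\<phi> u). map (map \<phi>) (map (map ?\<psi>) ws) = ws" by blast
    show "map (map \<phi>) ` ?W V E u \<subseteq> ?W V' E' (\<phi> u)"
    proof (rule image_subsetI)
      fix ws assume "ws \<in> ?W V E u"
      then show "map (map \<phi>) ws \<in> ?W V' E' (\<phi> u)"
        using closed_walks_map[of V \<phi> V' E E' ws k u] inj im E by blast
    qed
    show "map (map ?\<psi>) ` ?W V' E' (\<phi> u) \<subseteq> ?W V E u"
    proof (rule image_subsetI)
      fix ws assume w: "ws \<in> ?W V' E' (\<phi> u)"
      have inj': "inj_on ?\<psi> V'" using \<phi> by (metis inj_onI)
      have E': "E (?\<psi> x) (?\<psi> y)" if "x \<in> V'" "y \<in> V'" "E' x y" for x y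
        using E[OF \<psi>V[OF that(1)] \<psi>V[OF that(2)]] that \<phi> by simp
      show "map (map ?\<psi>) ws \<in> ?W V E u"
        using closed_walks_map[of V' ?\<psi> V E' E ws k "\<phi> u"] w inj' \<psi>V E' \<psi>[OF u] by simp
    qed
  qed
  then show ?thesis
    unfolding path_tree_closed_walks_def by (rule bij_betw_same_card[symmetric])
qed

lemma matching_measure_iso:
  assumes "bij_betw \<phi> V V'" "\<And>x y. x \<in> V \<Longrightarrow> y \<in> V \<Longrightarrow> E' (\<phi> x) (\<phi> y) \<longleftrightarrow> E x y" "u \<in> V"
  shows "matching_measure (V', E') (\<phi> u) = matching_measure (V, E) u"
  unfolding matching_measure_def using closed_walks_iso[where E = E and E' = E' and \<phi> = \<phi>, OF assms] by simp

section \<open>The sigma-algebra on graphs and truncated Green functions\<close>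

lemma space_graph_space [simp]: "space graph_space = UNIV"
  by (simp add: graph_space_def space_measure_of_conv)

lemma sets_graph_space: "sets graph_space = sigma_sets UNIV ({{G. x \<in> verts G} | x. True} \<union> {{G. adj G x y} | x y. True})"
  unfolding graph_space_def by (rule sets_measure_of) auto

lemma pred_verts [measurable]: "Measurable.pred graph_space (\<lambda>G. x \<in> verts G)"
  unfolding pred_def sets_graph_space by (auto intro!: sigma_sets.Basic)

lemma pred_adj [measurable]: "Measurable.pred graph_space (\<lambda>G. adj G x y)"
  unfolding pred_def sets_graph_space by (auto intro!: sigma_sets.Basic)

text \<open>A truncation takes values in a finite set with the discrete sigma-algebra, so every
  function of it is measurable; no formula for the Green function has to be analysed.\<close>

lemma measurable_truncated_graph:
  "(\<lambda>G. (verts G \<inter> {..n}, {(x, y). x \<le> n \<and> y \<le> n \<and> adj G x y})) \<in>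
    measurable graph_space (count_space (Pow {..n} \<times> Pow ({..n} \<times> {..n})))"
proof (subst measurable_count_space_eq2, simp, intro conjI ballI)
  fix a assume "a \<in> Pow {..n} \<times> Pow ({..n::nat} \<times> {..n})"
  then obtain W R where a: "a = (W, R)" "W \<subseteq> {..n}" "R \<subseteq> {..n} \<times> {..n}" by auto
  have "(\<lambda>G. (verts G \<inter> {..n}, {(x, y). x \<le> n \<and> y \<le> n \<and> adj G x y})) -` {a} \<inter> space graph_space =
    {G \<in> space graph_space. (\<forall>x\<in>{..n}. x \<in> verts G \<longleftrightarrow> x \<in> W) \<and> (\<forall>x\<in>{..n}. \<forall>y\<in>{..n}. adj G x y \<longleftrightarrow> (x, y) \<in> R)}"
    using a(2,3) unfolding a(1) by (auto simp: set_eq_iff)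
  also have "\<dots> \<in> sets graph_space" by measurable
  finally show "(\<lambda>G. (verts G \<inter> {..n}, {(x, y). x \<le> n \<and> y \<le> n \<and> adj G x y})) -` {a} \<inter> space graph_space \<in> sets graph_space" .
qed auto

lemma measurable_green:
  "(\<lambda>G. green (adj G) ((verts G - B) \<inter> {..n}) L z) \<in> borel_measurable graph_space"
proof -
  let ?r = "\<lambda>G. (verts G \<inter> {..n}, {(x, y). x \<le> n \<and> y \<le> n \<and> adj G x y})"
  let ?F = "\<lambda>(W, R). green (\<lambda>x y. (x, y) \<in> R) (W - B) L z"
  have "(\<lambda>G. ?F (?r G)) \<in> borel_measurable graph_space"
    by (rule measurable_compose[OF measurable_truncated_graph]) simp
  also have "(\<lambda>G. ?F (?r G)) = (\<lambda>G. green (adj G) ((verts G - B) \<inter> {..n}) L z)"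
  proof
    fix G
    have e: "verts G \<inter> {..n} - B = (verts G - B) \<inter> {..n}" by auto
    have "matching_val (\<lambda>x y. (x, y) \<in> {(x, y). x \<le> n \<and> y \<le> n \<and> adj G x y}) X z = matching_val (adj G) X z"
      if "X \<subseteq> {..n}" for X
      using that by (intro matching_val_cong) auto
    from this[of "(verts G - B) \<inter> {..n}"] this[of "(verts G - B) \<inter> {..n} - L"]
    show "?F (?r G) = green (adj G) ((verts G - B) \<inter> {..n}) L z"
      unfolding green_def prod.case e by auto
  qed
  finally show ?thesis .
qed

section \<open>Measurability\<close>

definition good_graph :: "nat \<Rightarrow> graph \<Rightarrow> bool" where
  "good_graph D G \<longleftrightarrow> simple_graph G \<and> max_degree_le G D"

lemma good_graph_bounded:
  assumes "good_graph D G"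
  shows "bounded_graph (adj G) D"
proof
  have *: "\<And>x y. adj G x y \<Longrightarrow> x \<in> verts G \<and> y \<in> verts G" "\<And>x y. adj G x y \<Longrightarrow> adj G y x" "\<And>x. \<not> adj G x x"
    "\<And>x. x \<in> verts G \<Longrightarrow> finite {y. adj G x y} \<and> card {y. adj G x y} \<le> D"
    using assms by (auto simp: good_graph_def simple_graph_def max_degree_le_def)
  show "adj G x y \<Longrightarrow> adj G y x" "\<not> adj G x x" for x y using * by auto
  have "finite {y. adj G x y} \<and> card {y. adj G x y} \<le> D" for x
  proof (cases "x \<in> verts G")
    case False
    then have "{y. adj G x y} = {}" using *(1) by auto
    then show ?thesis by simp
  qed (rule *(4))
  then show "finite {y. adj G x y}" "card {y. adj G x y} \<le> D" for x by auto
qed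

text \<open>Rewrites the degree bound as a condition quantified over the countably many lists of
  vertices, a form in which measurability can be read off.\<close>

lemma finite_card_le_iff:
  "finite A \<and> card A \<le> D \<longleftrightarrow> (\<forall>xs. distinct xs \<and> length xs = Suc D \<longrightarrow> \<not> set xs \<subseteq> A)"
proof
  assume A: "finite A \<and> card A \<le> D"
  show "\<forall>xs. distinct xs \<and> length xs = Suc D \<longrightarrow> \<not> set xs \<subseteq> A"
  proof (intro allI impI notI)
    fix xs assume xs: "distinct xs \<and> length xs = Suc D" "set xs \<subseteq> A"
    then have "card (set xs) \<le> card A" using A by (intro card_mono) auto
    then show False using A xs by (simp add: distinct_card)
  qed
next
  assume *: "\<forall>xs. distinct xs \<and> length xs = Suc D \<longrightarrow> \<not> set xs \<subseteq> A"
  have no: "\<not> F \<subseteq> A" if F: "finite F" "card F = Suc D" for F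
  proof -
    obtain xs where "set xs = F" "distinct xs" using finite_distinct_list[OF F(1)] by blast
    then show ?thesis using * F(2) by (metis distinct_card)
  qed
  have fin: "finite A"
    using infinite_arbitrarily_large[of A "Suc D"] no by blast
  moreover have "card A \<le> D"
  proof (rule ccontr)
    assume "\<not> card A \<le> D"
    then obtain F where "F \<subseteq> A" "card F = Suc D" by (metis not_less_eq_eq obtain_subset_with_card_n)
    then show False using no[of F] fin finite_subset by blast
  qed
  ultimately show "finite A \<and> card A \<le> D" ..
qed

lemma pred_good_graph [measurable]: "Measurable.pred graph_space (good_graph D)"
proof -
  have eq: "good_graph D = (\<lambda>G. (\<forall>x y. adj G x y \<longrightarrow> x \<in> verts G \<and> y \<in> verts G) \<and>
     (\<forall>x y. adj G x y \<longrightarrow> adj G y x) \<and> (\<forall>x. \<not> adj G x x) \<and>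
     (\<forall>x. x \<in> verts G \<longrightarrow> (\<forall>xs. distinct xs \<and> length xs = Suc D \<longrightarrow> \<not> (\<forall>y\<in>set xs. adj G x y))))"
    unfolding good_graph_def simple_graph_def max_degree_le_def finite_card_le_iff
    by (intro ext) (simp add: subset_iff Ball_def)
  show ?thesis unfolding eq by measurable
qed

text \<open>The limits are the atom at \<open>\<theta>\<close> of the matching measure of \<open>G - B\<close> at \<open>u\<close>, written so
  that measurability in \<open>G\<close> is evident.\<close>

definition mass :: "real \<Rightarrow> graph \<Rightarrow> nat set \<Rightarrow> nat \<Rightarrow> real" where
  "mass \<theta> G B u = (if u \<in> verts G - B then lim (\<lambda>j. lim (\<lambda>n.
     Re (\<i> * of_real (inverse (real (Suc j))) * green (adj G) ((verts G - B) \<inter> {..n}) {u} (Complex \<theta> (inverse (real (Suc j)))))))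
     else 0)"

lemma mass_measurable [measurable]: "(\<lambda>G. mass \<theta> G B u) \<in> borel_measurable graph_space"
proof -
  have "Measurable.pred graph_space (\<lambda>G. u \<in> verts G - B)" by (cases "u \<in> B") auto
  then show ?thesis
    unfolding mass_def using measurable_green[measurable] by measurable
qed

lemma mass_eq_atom:
  assumes "good_graph D G" "u \<in> verts G - B"
  shows "mass \<theta> G B u = measure (matching_measure (verts G - B, adj G) u) {\<theta>}"
proof -
  interpret bounded_graph "adj G" D using assms(1) by (rule good_graph_bounded)
  interpret bounded_graph_at "adj G" D \<theta> ..
  define s where "s j = inverse (real (Suc j))" for j
  have s: "s j > 0" for j by (simp add: s_def)
  let ?V = "verts G - B"
  have inner: "lim (\<lambda>n. Re (\<i> * of_real (s j) * green (adj G) (?V \<inter> {..n}) {u} (Complex \<theta> (s j)))) =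
      Re (\<i> * of_real (s j) * gl ?V {u} (s j))" for j
    unfolding gl_def using assms(2) s[of j]
    by (intro limI tendsto_intros green_tendsto) auto
  have "filterlim s (at_right 0) sequentially"
    unfolding s_def by (rule tendsto_imp_filterlim_at_right[OF LIMSEQ_inverse_real_of_nat]) (auto simp: s_def)
  with tendsto_Re[OF gl_atom[OF assms(2)]]
  have "(\<lambda>j. Re (\<i> * of_real (s j) * gl ?V {u} (s j))) \<longlonglongrightarrow> Re (of_real (atom ?V u))"
    by (rule filterlim_compose)
  then have "lim (\<lambda>j. lim (\<lambda>n. Re (\<i> * of_real (s j) * green (adj G) (?V \<inter> {..n}) {u} (Complex \<theta> (s j))))) = atom ?V u"
    unfolding inner by (intro limI) simp
  then show ?thesis
    unfolding mass_def s_def[symmetric] using assms(2) by (simp add: atom_def)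
qed

definition vsum :: "graph \<Rightarrow> (nat \<Rightarrow> ennreal) \<Rightarrow> ennreal" where
  "vsum G h = (\<integral>\<^sup>+ v. h v \<partial>count_space (verts G))"

lemma vsum_measurable [measurable (raw)]:
  assumes f [measurable]: "f \<in> measurable M graph_space" and h: "\<And>v. (\<lambda>x. h x v) \<in> borel_measurable M"
  shows "(\<lambda>x. vsum (f x) (h x)) \<in> borel_measurable M"
proof -
  note h [measurable]
  have "vsum (f x) (h x) = (\<Sum>v. h x v * (if v \<in> verts (f x) then 1 else 0))" for x
  proof -
    have "vsum (f x) (h x) = (\<integral>\<^sup>+ v. h x v * indicator (verts (f x)) v \<partial>count_space UNIV)"
      unfolding vsum_def by (rule nn_integral_count_space_indicator) simp
    then show ?thesis by (simp add: nn_integral_count_space_nat indicator_def of_bool_def)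
  qed
  moreover have "Measurable.pred M (\<lambda>x. v \<in> verts (f x))" for v
    by (rule measurable_compose[OF f pred_verts])
  ultimately show ?thesis by simp
qed

definition ess_vertex :: "real \<Rightarrow> graph \<Rightarrow> nat \<Rightarrow> bool" where
  "ess_vertex \<theta> G u \<longleftrightarrow> u \<in> verts G \<and> mass \<theta> G {} u > 0"

definition ess_edges :: "real \<Rightarrow> graph \<Rightarrow> (nat \<times> nat) set" where
  "ess_edges \<theta> G = {(x, y). ess_vertex \<theta> G x \<and> ess_vertex \<theta> G y \<and> adj G x y}"

definition ess_conn :: "real \<Rightarrow> graph \<Rightarrow> nat \<Rightarrow> nat \<Rightarrow> bool" where
  "ess_conn \<theta> G u v \<longleftrightarrow> ess_vertex \<theta> G u \<and> (u, v) \<in> (ess_edges \<theta> G)\<^sup>*"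

lemma ess_vertex_measurable [measurable]: "Measurable.pred graph_space (\<lambda>G. ess_vertex \<theta> G u)"
  unfolding ess_vertex_def by measurable

lemma ess_conn_measurable [measurable]: "Measurable.pred graph_space (\<lambda>G. ess_conn \<theta> G u v)"
proof -
  have "Measurable.pred graph_space (\<lambda>G. (u, v) \<in> ess_edges \<theta> G ^^ n)" for n
  proof (induction n arbitrary: v)
    case (Suc n)
    note Suc [measurable]
    have "(u, v) \<in> ess_edges \<theta> G ^^ Suc n \<longleftrightarrow> (\<exists>w. (u, w) \<in> ess_edges \<theta> G ^^ n \<and>
        ess_vertex \<theta> G w \<and> ess_vertex \<theta> G v \<and> adj G w v)" for G
      by (auto simp: ess_edges_def)
    then show ?case by simp
  qed simp
  then show ?thesis
    unfolding ess_conn_def rtrancl_power by measurable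
qed

lemma ess_conn_vertex: "ess_conn \<theta> G u v \<Longrightarrow> ess_vertex \<theta> G u" "ess_conn \<theta> G u v \<Longrightarrow> ess_vertex \<theta> G v"
proof -
  assume c: "ess_conn \<theta> G u v"
  then show u: "ess_vertex \<theta> G u" by (simp add: ess_conn_def)
  from c have "(u, v) \<in> (ess_edges \<theta> G)\<^sup>*" by (simp add: ess_conn_def)
  then show "ess_vertex \<theta> G v" using u by (induction rule: rtrancl_induct) (auto simp: ess_edges_def)
qed

lemma ess_conn_trans: "ess_conn \<theta> G u v \<Longrightarrow> ess_conn \<theta> G v w \<Longrightarrow> ess_conn \<theta> G u w"
  by (auto simp: ess_conn_def intro: rtrancl_trans)

lemma ess_conn_sym: "good_graph D G \<Longrightarrow> ess_conn \<theta> G u v \<Longrightarrow> ess_conn \<theta> G v u"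
proof -
  assume G: "good_graph D G" and c: "ess_conn \<theta> G u v"
  have "sym_on UNIV (ess_edges \<theta> G)"
    using G by (auto simp: sym_on_def ess_edges_def good_graph_def simple_graph_def)
  then have "(v, u) \<in> (ess_edges \<theta> G)\<^sup>*"
    using c unfolding ess_conn_def by (meson sym_rtrancl symE)
  then show ?thesis using ess_conn_vertex[OF c] by (simp add: ess_conn_def)
qed

section \<open>Component sizes and the transported masses\<close>

definition comp_size :: "real \<Rightarrow> graph \<Rightarrow> nat \<Rightarrow> ennreal" where
  "comp_size \<theta> G u = vsum G (\<lambda>v. if ess_conn \<theta> G u v then 1 else 0)"

definition heavy_count :: "real \<Rightarrow> real \<Rightarrow> graph \<Rightarrow> nat \<Rightarrow> ennreal" where
  "heavy_count \<theta> \<epsilon> G u = vsum G (\<lambda>v. if ess_conn \<theta> G u v \<and> mass \<theta> G {} v \<ge> \<epsilon> then 1 else 0)"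

definition bdry_vertex :: "real \<Rightarrow> graph \<Rightarrow> nat \<Rightarrow> nat \<Rightarrow> bool" where
  "bdry_vertex \<theta> G u a \<longleftrightarrow> \<not> ess_vertex \<theta> G a \<and> (\<exists>w. ess_conn \<theta> G u w \<and> adj G w a)"

definition flow :: "real \<Rightarrow> graph \<Rightarrow> nat \<Rightarrow> nat \<Rightarrow> ennreal" where
  "flow \<theta> G a u = ennreal (mass \<theta> G {a} u) / vsum G (\<lambda>v. if adj G a v then ennreal (mass \<theta> G {a} v) else 0)"

text \<open>The transports are set to 0 off the good graphs: \<open>unimodular\<close> asks for
  invariance on all simple graphs, whereas atoms are under control only for bounded degree.\<close>

definition heavy_transport :: "nat \<Rightarrow> real \<Rightarrow> real \<Rightarrow> graph \<Rightarrow> nat \<Rightarrow> nat \<Rightarrow> ennreal" where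
  "heavy_transport D \<theta> \<epsilon> G u v =
     (if good_graph D G \<and> ess_conn \<theta> G u v \<and> mass \<theta> G {} v \<ge> \<epsilon> then inverse (heavy_count \<theta> \<epsilon> G u) else 0)"

definition bdry_transport :: "nat \<Rightarrow> real \<Rightarrow> graph \<Rightarrow> nat \<Rightarrow> nat \<Rightarrow> ennreal" where
  "bdry_transport D \<theta> G u a =
     (if good_graph D G \<and> ess_vertex \<theta> G u \<and> bdry_vertex \<theta> G u a then inverse (comp_size \<theta> G u) else 0)"

text \<open>The flow from \<open>a\<close> into a component is spread evenly over that component,
  because the inflow bound is known for whole components and not for single vertices.\<close>

definition flow_transport :: "nat \<Rightarrow> real \<Rightarrow> graph \<Rightarrow> nat \<Rightarrow> nat \<Rightarrow> ennreal" where
  "flow_transport D \<theta> G a v =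
     (if good_graph D G \<and> \<not> ess_vertex \<theta> G a \<and> ess_vertex \<theta> G v
      then vsum G (\<lambda>u. if ess_conn \<theta> G v u \<and> adj G a u then flow \<theta> G a u else 0) * inverse (comp_size \<theta> G v) else 0)"

lemma comp_size_measurable [measurable]: "(\<lambda>G. comp_size \<theta> G u) \<in> borel_measurable graph_space"
  unfolding comp_size_def by measurable

lemma heavy_count_measurable [measurable]: "(\<lambda>G. heavy_count \<theta> \<epsilon> G u) \<in> borel_measurable graph_space"
  unfolding heavy_count_def by measurable

lemma bdry_vertex_measurable [measurable]: "Measurable.pred graph_space (\<lambda>G. bdry_vertex \<theta> G u a)"
  unfolding bdry_vertex_def by measurable

lemma flow_measurable [measurable]: "(\<lambda>G. flow \<theta> G a u) \<in> borel_measurable graph_space"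
  unfolding flow_def by measurable

lemma heavy_transport_measurable: "(\<lambda>G. heavy_transport D \<theta> \<epsilon> G u v) \<in> borel_measurable graph_space"
  unfolding heavy_transport_def by measurable

lemma bdry_transport_measurable: "(\<lambda>G. bdry_transport D \<theta> G u a) \<in> borel_measurable graph_space"
  unfolding bdry_transport_def by measurable

lemma flow_transport_measurable: "(\<lambda>G. flow_transport D \<theta> G a v) \<in> borel_measurable graph_space"
  unfolding flow_transport_def by measurable

section \<open>Isomorphism invariance\<close>

locale good_iso =
  fixes \<phi> :: "nat \<Rightarrow> nat" and G H :: graph and D :: nat
  assumes simple_H: "simple_graph H" and iso: "graph_iso \<phi> G H" and good: "good_graph D G"
begin

lemma inj: "inj_on \<phi> (verts G)" and image: "\<phi> ` verts G = verts H"
  and adj_iff: "x \<in> verts G \<Longrightarrow> y \<in> verts G \<Longrightarrow> adj H (\<phi> x) (\<phi> y) \<longleftrightarrow> adj G x y"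
  using iso by (auto simp: graph_iso_def bij_betw_def)

lemma in_verts: "x \<in> verts G \<Longrightarrow> \<phi> x \<in> verts H"
  unfolding image[symmetric] by (rule imageI)

lemma vertsE:
  assumes "y \<in> verts H"
  obtains x where "x \<in> verts G" "y = \<phi> x"
  using assms unfolding image[symmetric] by (rule imageE)

lemma good_H: "good_graph D H"
proof -
  have "finite {y'. adj H x' y'} \<and> card {y'. adj H x' y'} \<le> D" if x': "x' \<in> verts H" for x'
  proof -
    obtain x where x: "x \<in> verts G" "x' = \<phi> x" using x' by (rule vertsE)
    have H: "adj H a b \<Longrightarrow> b \<in> verts H" for a b using simple_H unfolding simple_graph_def by blast
    have G: "adj G a b \<Longrightarrow> b \<in> verts G" for a b using good unfolding good_graph_def simple_graph_def by blast
    have "{y'. adj H x' y'} = \<phi> ` {y. adj G x y}"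
    proof (intro equalityI subsetI)
      fix y' assume y': "y' \<in> {y'. adj H x' y'}"
      then have "y' \<in> verts H" using H by simp
      then obtain y where "y \<in> verts G" "y' = \<phi> y" by (rule vertsE)
      then show "y' \<in> \<phi> ` {y. adj G x y}" using y' x adj_iff by auto
    next
      fix y' assume "y' \<in> \<phi> ` {y. adj G x y}"
      then show "y' \<in> {y'. adj H x' y'}" using x adj_iff G by auto
    qed
    moreover have "finite {y. adj G x y} \<and> card {y. adj G x y} \<le> D"
      using good x(1) by (auto simp: good_graph_def max_degree_le_def)
    ultimately show ?thesis by (auto intro: order.trans[OF card_image_le])
  qed
  then show ?thesis using simple_H by (simp add: good_graph_def max_degree_le_def)
qed

lemma inverse_iso: "good_iso (the_inv_into (verts G) \<phi>) H G D"
proof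
  let ?\<psi> = "the_inv_into (verts G) \<phi>"
  show "simple_graph G" using good by (simp add: good_graph_def)
  show "good_graph D H" by (rule good_H)
  have b: "bij_betw \<phi> (verts G) (verts H)" using iso by (simp add: graph_iso_def)
  show "graph_iso ?\<psi> H G"
    unfolding graph_iso_def
  proof (intro conjI ballI)
    show "bij_betw ?\<psi> (verts H) (verts G)" by (rule bij_betw_the_inv_into[OF b])
    fix x y assume xy: "x \<in> verts H" "y \<in> verts H"
    have "?\<psi> z \<in> verts G \<and> \<phi> (?\<psi> z) = z" if "z \<in> verts H" for z
      using that image the_inv_into_into[OF inj, of z "verts G"] f_the_inv_into_f[OF inj, of z] by auto
    with xy show "adj G (?\<psi> x) (?\<psi> y) \<longleftrightarrow> adj H x y"
      using adj_iff[of "?\<psi> x" "?\<psi> y"] by simp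
  qed
qed

text \<open>An isomorphism does not respect the truncations used in \<open>mass\<close>, so the
  comparison goes through the matching measure, which is defined by closed walk counts
  alone.\<close>

lemma mass_iso:
  assumes "B \<subseteq> verts G" "u \<in> verts G"
  shows "mass \<theta> H (\<phi> ` B) (\<phi> u) = mass \<theta> G B u"
proof (cases "u \<in> B")
  case False
  have "\<phi> u \<notin> \<phi> ` B" using False assms inj by (auto dest: inj_onD)
  then have u: "\<phi> u \<in> verts H - \<phi> ` B" using in_verts assms by auto
  have "bij_betw \<phi> (verts G - B) (verts H - \<phi> ` B)"
    using inj image assms(1) by (auto simp: bij_betw_def inj_on_image_set_diff[OF inj] intro: inj_on_subset)
  then have "matching_measure (verts H - \<phi> ` B, adj H) (\<phi> u) = matching_measure (verts G - B, adj G) u"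
    using assms False by (intro matching_measure_iso) (auto simp: adj_iff)
  then show ?thesis
    using mass_eq_atom[OF good_H u] mass_eq_atom[OF good, of u B] assms False by simp
qed (simp add: mass_def)

lemma ess_vertex_iso: "u \<in> verts G \<Longrightarrow> ess_vertex \<theta> H (\<phi> u) \<longleftrightarrow> ess_vertex \<theta> G u"
  using mass_iso[of "{}" u \<theta>] by (simp add: ess_vertex_def in_verts)

lemma ess_conn_image:
  assumes "ess_conn \<theta> G u v"
  shows "ess_conn \<theta> H (\<phi> u) (\<phi> v)"
proof -
  have "(\<phi> u, \<phi> v) \<in> (ess_edges \<theta> H)\<^sup>*"
  proof -
    have "(u, v) \<in> (ess_edges \<theta> G)\<^sup>*" using assms by (simp add: ess_conn_def)
    then show ?thesis
    proof (induction rule: rtrancl_induct)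
      case (step x y)
      then have "ess_vertex \<theta> G x" "ess_vertex \<theta> G y" "adj G x y" by (auto simp: ess_edges_def)
      then have "(\<phi> x, \<phi> y) \<in> ess_edges \<theta> H"
        using ess_vertex_iso adj_iff by (auto simp: ess_edges_def ess_vertex_def)
      then show ?case using step.IH by (rule rtrancl_into_rtrancl[rotated])
    qed simp
  qed
  then show ?thesis
    using assms ess_conn_vertex(1)[OF assms] ess_vertex_iso[of u \<theta>] by (simp add: ess_conn_def ess_vertex_def)
qed

lemma ess_conn_iso:
  assumes "u \<in> verts G" "v \<in> verts G"
  shows "ess_conn \<theta> H (\<phi> u) (\<phi> v) \<longleftrightarrow> ess_conn \<theta> G u v"
proof
  interpret inv: good_iso "the_inv_into (verts G) \<phi>" H G D by (rule inverse_iso)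
  assume "ess_conn \<theta> H (\<phi> u) (\<phi> v)"
  from inv.ess_conn_image[OF this] show "ess_conn \<theta> G u v"
    using assms by (simp add: the_inv_into_f_f[OF inj])
qed (rule ess_conn_image)

lemma vsum_iso:
  assumes "\<And>x. x \<in> verts G \<Longrightarrow> h' (\<phi> x) = h x"
  shows "vsum H h' = vsum G h"
proof -
  have "vsum H h' = (\<integral>\<^sup>+ x. h' (\<phi> x) \<partial>count_space (verts G))"
    unfolding vsum_def using iso by (intro nn_integral_bij_count_space[symmetric]) (simp add: graph_iso_def)
  also have "\<dots> = vsum G h" unfolding vsum_def using assms by (intro nn_integral_cong) simp
  finally show ?thesis .
qed

lemma comp_size_iso: "u \<in> verts G \<Longrightarrow> comp_size \<theta> H (\<phi> u) = comp_size \<theta> G u"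
  unfolding comp_size_def by (rule vsum_iso) (simp add: ess_conn_iso)

lemma mass_iso_single: "a \<in> verts G \<Longrightarrow> u \<in> verts G \<Longrightarrow> mass \<theta> H {\<phi> a} (\<phi> u) = mass \<theta> G {a} u"
  using mass_iso[of "{a}" u \<theta>] by simp

lemma mass_iso_empty: "u \<in> verts G \<Longrightarrow> mass \<theta> H {} (\<phi> u) = mass \<theta> G {} u"
  using mass_iso[of "{}" u \<theta>] by simp

lemma heavy_count_iso: "u \<in> verts G \<Longrightarrow> heavy_count \<theta> \<epsilon> H (\<phi> u) = heavy_count \<theta> \<epsilon> G u"
  unfolding heavy_count_def by (rule vsum_iso) (simp add: ess_conn_iso mass_iso_empty)

lemma flow_iso: "a \<in> verts G \<Longrightarrow> u \<in> verts G \<Longrightarrow> flow \<theta> H (\<phi> a) (\<phi> u) = flow \<theta> G a u"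
  unfolding flow_def
  by (intro arg_cong2[where f = "(/)"] vsum_iso) (simp_all add: mass_iso_single adj_iff)

lemma bdry_vertex_iso:
  assumes "u \<in> verts G" "a \<in> verts G"
  shows "bdry_vertex \<theta> H (\<phi> u) (\<phi> a) \<longleftrightarrow> bdry_vertex \<theta> G u a"
proof -
  have *: "ess_conn \<theta> G' x w \<Longrightarrow> w \<in> verts G'" for G' x w using ess_conn_vertex(2) by (auto simp: ess_vertex_def)
  have "(\<exists>w'. ess_conn \<theta> H (\<phi> u) w' \<and> adj H w' (\<phi> a)) \<longleftrightarrow> (\<exists>w. ess_conn \<theta> G u w \<and> adj G w a)"
  proof
    assume "\<exists>w'. ess_conn \<theta> H (\<phi> u) w' \<and> adj H w' (\<phi> a)"
    then obtain w' where w': "ess_conn \<theta> H (\<phi> u) w'" "adj H w' (\<phi> a)" by blast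
    obtain w where "w \<in> verts G" "w' = \<phi> w" using *[OF w'(1)] by (rule vertsE)
    then show "\<exists>w. ess_conn \<theta> G u w \<and> adj G w a" using w' assms by (auto simp: ess_conn_iso adj_iff)
  next
    assume "\<exists>w. ess_conn \<theta> G u w \<and> adj G w a"
    then obtain w where w: "ess_conn \<theta> G u w" "adj G w a" by blast
    have "w \<in> verts G" using *[OF w(1)] .
    then have "ess_conn \<theta> H (\<phi> u) (\<phi> w) \<and> adj H (\<phi> w) (\<phi> a)"
      using w assms by (simp add: ess_conn_iso adj_iff)
    then show "\<exists>w'. ess_conn \<theta> H (\<phi> u) w' \<and> adj H w' (\<phi> a)" by blast
  qed
  then show ?thesis unfolding bdry_vertex_def using assms by (simp add: ess_vertex_iso)
qed

lemma heavy_transport_iso: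
  "u \<in> verts G \<Longrightarrow> v \<in> verts G \<Longrightarrow> heavy_transport D \<theta> \<epsilon> H (\<phi> u) (\<phi> v) = heavy_transport D \<theta> \<epsilon> G u v"
  unfolding heavy_transport_def by (simp add: good good_H ess_conn_iso mass_iso_empty heavy_count_iso)

lemma bdry_transport_iso:
  "u \<in> verts G \<Longrightarrow> v \<in> verts G \<Longrightarrow> bdry_transport D \<theta> H (\<phi> u) (\<phi> v) = bdry_transport D \<theta> G u v"
  unfolding bdry_transport_def by (simp add: good good_H ess_vertex_iso bdry_vertex_iso comp_size_iso)

lemma flow_transport_iso:
  assumes "a \<in> verts G" "v \<in> verts G"
  shows "flow_transport D \<theta> H (\<phi> a) (\<phi> v) = flow_transport D \<theta> G a v"
proof -
  have "vsum H (\<lambda>u. if ess_conn \<theta> H (\<phi> v) u \<and> adj H (\<phi> a) u then flow \<theta> H (\<phi> a) u else 0) =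
      vsum G (\<lambda>u. if ess_conn \<theta> G v u \<and> adj G a u then flow \<theta> G a u else 0)"
    using assms by (intro vsum_iso) (simp add: ess_conn_iso adj_iff flow_iso)
  then show ?thesis
    unfolding flow_transport_def using assms by (simp add: good good_H ess_vertex_iso comp_size_iso)
qed

end

text \<open>Being good is itself invariant, by \<open>good_H\<close> applied to the inverse
  isomorphism, so outside the good graphs both sides are 0.\<close>

lemma iso_invariantI:
  assumes "\<And>\<phi> G H a b. good_iso \<phi> G H D \<Longrightarrow> a \<in> verts G \<Longrightarrow> b \<in> verts G \<Longrightarrow> f H (\<phi> a) (\<phi> b) = f G a b"
    and "\<And>G a b. \<not> good_graph D G \<Longrightarrow> f G a b = 0"
  shows "iso_invariant (\<lambda>(G, a, b). f G a b)"
  unfolding iso_invariant_def prod.case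
proof (intro allI impI)
  fix G H \<phi> a b
  assume *: "simple_graph G \<and> simple_graph H \<and> graph_iso \<phi> G H \<and> a \<in> verts G \<and> b \<in> verts G"
  show "f H (\<phi> a) (\<phi> b) = f G a b"
  proof (cases "good_graph D G")
    case True
    then have "good_iso \<phi> G H D" using * by (simp add: good_iso_def)
    then show ?thesis using assms(1) * by blast
  next
    case False
    have "\<not> good_graph D H"
    proof
      assume H: "good_graph D H"
      let ?\<psi> = "the_inv_into (verts G) \<phi>"
      have b: "bij_betw \<phi> (verts G) (verts H)" and inj: "inj_on \<phi> (verts G)" and im: "\<phi> ` verts G = verts H"
        using * by (auto simp: graph_iso_def bij_betw_def)
      have "graph_iso ?\<psi> H G"
        unfolding graph_iso_def
      proof (intro conjI ballI)
        show "bij_betw ?\<psi> (verts H) (verts G)" by (rule bij_betw_the_inv_into[OF b])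
        fix x y assume xy: "x \<in> verts H" "y \<in> verts H"
        have "?\<psi> z \<in> verts G \<and> \<phi> (?\<psi> z) = z" if "z \<in> verts H" for z
          using that im the_inv_into_into[OF inj, of z "verts G"] f_the_inv_into_f[OF inj, of z] by auto
        with xy show "adj G (?\<psi> x) (?\<psi> y) \<longleftrightarrow> adj H x y"
          using * unfolding graph_iso_def by metis
      qed
      then have "good_iso ?\<psi> H G D" using * H by (simp add: good_iso_def)
      then show False using good_iso.good_H False by blast
    qed
    then show ?thesis using False assms(2) by simp
  qed
qed

text \<open>There are only countably many choices of the two roots, so fixing both of them is
  enough.\<close>

lemma birooted_measurableI:
  assumes "\<And>a b. (\<lambda>G. f G a b) \<in> borel_measurable graph_space"
  shows "(\<lambda>(G, a, b). f G a b) \<in> borel_measurable birooted_space"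
proof -
  have "(\<lambda>x. f (fst x) (fst (snd x)) (snd (snd x))) \<in> borel_measurable birooted_space"
  proof (rule measurable_compose_countable[where g = "\<lambda>x. fst (snd x)"])
    show "(\<lambda>x. fst (snd x)) \<in> measurable birooted_space (count_space UNIV)"
      unfolding birooted_space_def by measurable
    fix a :: nat
    show "(\<lambda>x. f (fst x) a (snd (snd x))) \<in> borel_measurable birooted_space"
    proof (rule measurable_compose_countable[where g = "\<lambda>x. snd (snd x)"])
      show "(\<lambda>x. snd (snd x)) \<in> measurable birooted_space (count_space UNIV)"
        unfolding birooted_space_def by measurable
      fix b :: nat
      have "fst \<in> measurable birooted_space graph_space" unfolding birooted_space_def by measurable
      then show "(\<lambda>x. f (fst x) a b) \<in> borel_measurable birooted_space"
        using assms by (rule measurable_compose)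
    qed
  qed
  then show ?thesis by (simp add: case_prod_unfold)
qed

lemma mass_transport:
  assumes "unimodular M G rt" "\<And>a b. (\<lambda>G. f G a b) \<in> borel_measurable graph_space"
    and "\<And>\<phi> G H a b. good_iso \<phi> G H D \<Longrightarrow> a \<in> verts G \<Longrightarrow> b \<in> verts G \<Longrightarrow> f H (\<phi> a) (\<phi> b) = f G a b"
    and "\<And>G a b. \<not> good_graph D G \<Longrightarrow> f G a b = 0"
  shows "(\<integral>\<^sup>+ \<omega>. vsum (G \<omega>) (\<lambda>v. f (G \<omega>) (rt \<omega>) v) \<partial>M) = (\<integral>\<^sup>+ \<omega>. vsum (G \<omega>) (\<lambda>v. f (G \<omega>) v (rt \<omega>)) \<partial>M)"
  using assms(1) birooted_measurableI[of f, OF assms(2)] iso_invariantI[of D f, OF assms(3,4)]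
  unfolding unimodular_def vsum_def by auto

section \<open>Bounds on transported mass\<close>

locale good_at =
  fixes G :: graph and D :: nat and \<theta> :: real
  assumes good: "good_graph D G"

sublocale good_at \<subseteq> bounded_graph_at "adj G" D \<theta>
  using good_graph_bounded[OF good] by (simp add: bounded_graph_at_def)

context good_at
begin

abbreviation "V \<equiv> verts G"

lemma mass_atom: "u \<in> V - B \<Longrightarrow> mass \<theta> G B u = atom (V - B) u"
  using mass_eq_atom[OF good, of u B \<theta>] by (simp add: atom_def)

lemma ess_vertex_iff: "ess_vertex \<theta> G u \<longleftrightarrow> u \<in> ess V"
  using mass_atom[of u "{}"] by (auto simp: ess_vertex_def ess_def)

lemma ess_edges_eq: "ess_edges \<theta> G = ess_rel V"
  by (auto simp: ess_edges_def ess_rel_def ess_vertex_iff)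

lemma ess_conn_iff: "ess_conn \<theta> G u v \<longleftrightarrow> u \<in> ess V \<and> v \<in> component V u"
  by (simp add: ess_conn_def ess_vertex_iff ess_edges_eq component_def)

lemma adj_verts: "adj G u v \<Longrightarrow> u \<in> V" "adj G u v \<Longrightarrow> v \<in> V"
  using good unfolding good_graph_def simple_graph_def by blast+

lemma component_subset: "u \<in> ess V \<Longrightarrow> component V u \<subseteq> ess V"
  unfolding component_def using ess_rel_ess by auto

lemma ess_subset: "ess V \<subseteq> V"
  by (auto simp: ess_def)

lemma vsum_finite: "finite A \<Longrightarrow> A \<subseteq> V \<Longrightarrow> (\<And>v. v \<in> V \<Longrightarrow> v \<notin> A \<Longrightarrow> h v = 0) \<Longrightarrow> vsum G h = (\<Sum>v\<in>A. h v)"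
  unfolding vsum_def by (rule nn_integral_count_space')

lemma vsum_indicator: "A \<subseteq> V \<Longrightarrow> vsum G (\<lambda>v. if v \<in> A then 1 else 0) = emeasure (count_space V) A"
proof -
  assume A: "A \<subseteq> V"
  have "vsum G (\<lambda>v. if v \<in> A then 1 else 0) = (\<integral>\<^sup>+ v. indicator A v \<partial>count_space V)"
    unfolding vsum_def by (intro nn_integral_cong) (simp add: indicator_def)
  then show ?thesis using A by simp
qed

lemma vsum_cmult: "vsum G (\<lambda>v. c * h v) = c * vsum G h"
  unfolding vsum_def by (rule nn_integral_cmult) simp

lemma vsum_cong: "(\<And>v. v \<in> V \<Longrightarrow> h v = h' v) \<Longrightarrow> vsum G h = vsum G h'"
  unfolding vsum_def by (rule nn_integral_cong) simp

lemma vsum_mono: "(\<And>v. v \<in> V \<Longrightarrow> h v \<le> h' v) \<Longrightarrow> vsum G h \<le> vsum G h'"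
  unfolding vsum_def by (rule nn_integral_mono) simp

lemma vsum_swap: "vsum G (\<lambda>u. vsum G (\<lambda>v. h u v)) = vsum G (\<lambda>v. vsum G (\<lambda>u. h u v))"
  unfolding vsum_def by (rule nn_integral_count_space_nn_integral) auto

lemma comp_size_eq: "u \<in> ess V \<Longrightarrow> comp_size \<theta> G u = emeasure (count_space V) (component V u)"
  using component_subset ess_subset unfolding comp_size_def ess_conn_iff
  by (subst vsum_indicator[symmetric]) auto

lemma comp_size_finite_iff: "u \<in> ess V \<Longrightarrow> comp_size \<theta> G u < \<infinity> \<longleftrightarrow> finite (component V u)"
  using component_subset[of u] ess_subset by (auto simp: comp_size_eq emeasure_count_space of_nat_less_top)

lemma comp_size_card: "u \<in> ess V \<Longrightarrow> finite (component V u) \<Longrightarrow> comp_size \<theta> G u = of_nat (card (component V u))"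
  using component_subset[of u] ess_subset by (auto simp: comp_size_eq emeasure_count_space)

lemma component_refl: "u \<in> component V u"
  by (simp add: component_def)

lemma comp_size_nonzero: "u \<in> ess V \<Longrightarrow> comp_size \<theta> G u \<noteq> 0"
  using component_refl[of u] component_subset[of u] ess_subset by (auto simp: comp_size_eq emeasure_count_space)

lemma component_eq: "v \<in> component V u \<Longrightarrow> component V v = component V u"
  using ess_rel_sym by (auto simp: component_def intro: rtrancl_trans)

lemma ess_conn_commute: "ess_conn \<theta> G u v \<longleftrightarrow> ess_conn \<theta> G v u"
  using ess_conn_sym[OF good] by blast

lemma comp_size_conn: "ess_conn \<theta> G u v \<Longrightarrow> comp_size \<theta> G v = comp_size \<theta> G u"
  using component_subset[of u] by (auto simp: ess_conn_iff comp_size_eq component_eq)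

text \<open>The atoms of a component sum to at most 1, so at most \<open>1 / \<epsilon>\<close> of
  them reach \<open>\<epsilon>\<close>.\<close>

lemma heavy_count_finite:
  assumes "u \<in> ess V" "\<epsilon> > 0"
  shows "heavy_count \<theta> \<epsilon> G u < \<infinity>"
proof -
  let ?A = "{v \<in> component V u. mass \<theta> G {} v \<ge> \<epsilon>}"
  have sub: "?A \<subseteq> V" using component_subset[OF assms(1)] ess_subset by auto
  have bound: "card F \<le> nat \<lceil>1 / \<epsilon>\<rceil>" if F: "F \<subseteq> ?A" "finite F" for F
  proof -
    have "\<epsilon> * real (card F) = (\<Sum>v\<in>F. \<epsilon>)" by simp
    also have "\<dots> \<le> (\<Sum>v\<in>F. atom V v)"
      using F sub mass_atom[of _ "{}"] by (intro sum_mono) force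
    also have "\<dots> \<le> 1"
      using F assms(1) by (intro component_atom_sum_le) (auto simp: component_def)
    finally have "real (card F) \<le> 1 / \<epsilon>" using assms(2) by (simp add: field_simps)
    then show ?thesis by linarith
  qed
  have "finite ?A"
  proof (rule ccontr)
    assume "infinite ?A"
    then obtain F where "F \<subseteq> ?A" "finite F" "card F = Suc (nat \<lceil>1 / \<epsilon>\<rceil>)"
      using infinite_arbitrarily_large by blast
    then show False using bound[of F] by simp
  qed
  moreover have "heavy_count \<theta> \<epsilon> G u = emeasure (count_space V) ?A"
    unfolding heavy_count_def ess_conn_iff vsum_indicator[OF sub, symmetric] using assms(1)
    by (intro vsum_cong) auto
  ultimately show ?thesis using sub by (simp add: emeasure_count_space of_nat_less_top)
qed

lemma mult_inverse_eq_1: "a \<noteq> 0 \<Longrightarrow> a < \<infinity> \<Longrightarrow> a * inverse a = (1 :: ennreal)"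
  using ennreal_divide_self[of a] by (simp add: divide_ennreal_def)

text \<open>At 0 and at infinity the product is 0 by the conventions of
  \<open>ennreal\<close>.\<close>

lemma mult_inverse_le_1: "a * inverse a \<le> (1 :: ennreal)"
  using mult_inverse_eq_1[of a] by (cases "a = 0 \<or> a = \<infinity>") (auto simp: less_top)

text \<open>Only an inequality, since a component need not contain any heavy vertex.\<close>

lemma heavy_out: "vsum G (\<lambda>v. heavy_transport D \<theta> \<epsilon> G u v) \<le> 1"
proof -
  have "vsum G (\<lambda>v. heavy_transport D \<theta> \<epsilon> G u v) = inverse (heavy_count \<theta> \<epsilon> G u) * heavy_count \<theta> \<epsilon> G u"
    unfolding heavy_transport_def heavy_count_def vsum_cmult[symmetric] using good by (intro vsum_cong) simp
  then show ?thesis using mult_inverse_le_1 by (simp add: mult.commute)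
qed

lemma heavy_count_conn: "ess_conn \<theta> G u v \<Longrightarrow> heavy_count \<theta> \<epsilon> G v = heavy_count \<theta> \<epsilon> G u"
  unfolding heavy_count_def
  by (intro vsum_cong if_cong refl conj_cong) (auto intro: ess_conn_trans simp: ess_conn_commute)

text \<open>Every one of the infinitely many vertices of the component sends the same amount, which
  is positive because there are finitely many heavy vertices.\<close>

lemma heavy_in:
  assumes "u \<in> ess V" "\<epsilon> > 0" "mass \<theta> G {} u \<ge> \<epsilon>" "comp_size \<theta> G u = \<infinity>"
  shows "vsum G (\<lambda>v. heavy_transport D \<theta> \<epsilon> G v u) = \<infinity>"
proof -
  have "vsum G (\<lambda>v. heavy_transport D \<theta> \<epsilon> G v u) = inverse (heavy_count \<theta> \<epsilon> G u) * comp_size \<theta> G u"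
    unfolding comp_size_def vsum_cmult[symmetric]
    using good assms(3) heavy_count_conn ess_conn_commute[of u]
    by (intro vsum_cong) (auto simp: heavy_transport_def)
  moreover have "inverse (heavy_count \<theta> \<epsilon> G u) \<noteq> 0"
    using heavy_count_finite[OF assms(1,2)] by (auto simp: ennreal_inverse_eq_0_iff)
  ultimately show ?thesis using assms(4) by (simp add: ennreal_mult_top)
qed

lemma flow_eq:
  assumes "nbr_mass V a > 0" "u \<in> V - {a}"
  shows "flow \<theta> G a u = ennreal (transport V a u)"
proof -
  let ?N = "{v \<in> V - {a}. adj G a v}"
  have "vsum G (\<lambda>v. if adj G a v then ennreal (mass \<theta> G {a} v) else 0) = (\<Sum>v\<in>?N. ennreal (atom (V - {a}) v))"
  proof (subst vsum_finite[of ?N])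
    show "finite ?N" by (rule finite_nbrs_in)
    show "(\<Sum>v\<in>?N. if adj G a v then ennreal (mass \<theta> G {a} v) else 0) = (\<Sum>v\<in>?N. ennreal (atom (V - {a}) v))"
      by (intro sum.cong refl) (simp add: mass_atom)
  qed (use irrefl in auto)
  also have "\<dots> = ennreal (nbr_mass V a)" by (simp add: nbr_mass_def)
  finally show ?thesis
    unfolding flow_def transport_def using assms by (simp add: mass_atom divide_ennreal)
qed

text \<open>The class usually called A in the Gallai--Edmonds decomposition.\<close>

definition special :: "nat \<Rightarrow> bool" where
  "special a \<longleftrightarrow> a \<notin> ess V \<and> (\<exists>w\<in>ess V. adj G a w)"

lemma special_facts:
  assumes "special a"
  shows "a \<in> V" "atom V a = 0" "nbr_mass V a > 0"
proof -
  obtain w where w: "w \<in> ess V" "adj G a w" using assms by (auto simp: special_def)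
  show a: "a \<in> V" using adj_verts w by blast
  show "atom V a = 0" using assms a atom_nonneg[of V a] by (auto simp: special_def ess_def)
  then show "nbr_mass V a > 0" using special_nbr_mass_pos[OF a _ w(2,1)] by simp
qed

text \<open>Exchanging the sums, the even spreading over a component is undone by summing over its
  vertices, which needs the sizes to be finite. The total is then the sum in
  \<open>transport_sum\<close>.\<close>

lemma flow_out:
  assumes "special a" "\<And>u. u \<in> ess V \<Longrightarrow> comp_size \<theta> G u < \<infinity>"
  shows "vsum G (\<lambda>v. flow_transport D \<theta> G a v) = 1"
proof -
  obtain w where w: "w \<in> ess V" "adj G a w" using assms(1) by (auto simp: special_def)
  note a = special_facts[OF assms(1)]
  have na: "a \<notin> ess V" using assms(1) by (simp add: special_def)
  have "vsum G (\<lambda>v. flow_transport D \<theta> G a v) =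
      vsum G (\<lambda>v. vsum G (\<lambda>u. if ess_conn \<theta> G v u \<and> adj G a u then inverse (comp_size \<theta> G v) * flow \<theta> G a u else 0))"
  proof (rule vsum_cong)
    fix v assume "v \<in> V"
    show "flow_transport D \<theta> G a v = vsum G (\<lambda>u. if ess_conn \<theta> G v u \<and> adj G a u then inverse (comp_size \<theta> G v) * flow \<theta> G a u else 0)"
    proof (cases "ess_vertex \<theta> G v")
      case True
      then have "flow_transport D \<theta> G a v = inverse (comp_size \<theta> G v) * vsum G (\<lambda>u. if ess_conn \<theta> G v u \<and> adj G a u then flow \<theta> G a u else 0)"
        using good na by (simp add: flow_transport_def ess_vertex_iff mult.commute)
      then show ?thesis unfolding vsum_cmult[symmetric] by (auto intro: vsum_cong)
    next
      case False
      then have "\<not> ess_conn \<theta> G v u" for u using ess_conn_vertex(1) by blast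
      then show ?thesis using False by (simp add: flow_transport_def vsum_def)
    qed
  qed
  also have "\<dots> = vsum G (\<lambda>u. vsum G (\<lambda>v. if ess_conn \<theta> G v u \<and> adj G a u then inverse (comp_size \<theta> G v) * flow \<theta> G a u else 0))"
    by (rule vsum_swap)
  also have "\<dots> = vsum G (\<lambda>u. if u \<in> ess V \<and> adj G a u then flow \<theta> G a u else 0)"
  proof (rule vsum_cong)
    fix u assume "u \<in> V"
    have "vsum G (\<lambda>v. if ess_conn \<theta> G v u \<and> adj G a u then inverse (comp_size \<theta> G v) * flow \<theta> G a u else 0) =
      vsum G (\<lambda>v. (if adj G a u then inverse (comp_size \<theta> G u) * flow \<theta> G a u else 0) * (if ess_conn \<theta> G u v then 1 else 0))"
      by (intro vsum_cong) (auto simp: ess_conn_commute[of u] dest: comp_size_conn)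
    also have "\<dots> = (if adj G a u then inverse (comp_size \<theta> G u) * flow \<theta> G a u else 0) * comp_size \<theta> G u"
      unfolding vsum_cmult comp_size_def ..
    also have "\<dots> = (if u \<in> ess V \<and> adj G a u then flow \<theta> G a u else 0)"
    proof (cases "u \<in> ess V")
      case True
      have "inverse (comp_size \<theta> G u) * comp_size \<theta> G u = 1"
        using mult_inverse_eq_1[OF comp_size_nonzero[OF True] assms(2)[OF True]] by (simp add: mult.commute)
      then show ?thesis using True by (auto simp: mult_ac) (metis mult.assoc mult.commute mult.right_neutral)
    next
      case False
      then have "comp_size \<theta> G u = 0" by (simp add: comp_size_def ess_conn_iff vsum_def)
      then show ?thesis using False by simp
    qed
    finally show "vsum G (\<lambda>v. if ess_conn \<theta> G v u \<and> adj G a u then inverse (comp_size \<theta> G v) * flow \<theta> G a u else 0) =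
        (if u \<in> ess V \<and> adj G a u then flow \<theta> G a u else 0)" .
  qed
  also have "\<dots> = (\<Sum>u\<in>{u \<in> ess V. adj G a u}. ennreal (transport V a u))"
  proof (subst vsum_finite[of "{u \<in> ess V. adj G a u}"])
    show "(\<Sum>u\<in>{u \<in> ess V. adj G a u}. if u \<in> ess V \<and> adj G a u then flow \<theta> G a u else 0) =
        (\<Sum>u\<in>{u \<in> ess V. adj G a u}. ennreal (transport V a u))"
      using a(3) na ess_subset by (intro sum.cong refl) (auto intro!: flow_eq)
  qed (use ess_subset in auto)
  also have "\<dots> = ennreal (\<Sum>u\<in>{u \<in> ess V. adj G a u}. transport V a u)"
    by (rule sum_ennreal) (rule transport_nonneg)
  also have "\<dots> = 1" using transport_sum[OF a(1,2) w(2,1)] by simp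
  finally show ?thesis .
qed

text \<open>\<open>component_inflow\<close> for the whole component, shared equally among its
  vertices.\<close>

lemma flow_in:
  assumes "v \<in> ess V" "finite (component V v)"
  shows "vsum G (\<lambda>a. flow_transport D \<theta> G a v) \<le> inverse (comp_size \<theta> G v)"
proof -
  let ?S = "component V v"
  let ?N = "\<lambda>u. {a \<in> V - ?S. adj G u a}"
  have SV: "?S \<subseteq> V" "?S \<subseteq> ess V" using component_subset[OF assms(1)] ess_subset by auto
  \<comment> \<open>This makes the condition "not essential" in the transport agree with "outside
    the component" in \<open>component_inflow\<close>.\<close>
  have out: "a \<notin> ess V \<longleftrightarrow> a \<notin> ?S" if "u \<in> ?S" "adj G u a" for u a
  proof -
    have "a \<in> ?S" if "a \<in> ess V"
      using \<open>u \<in> ?S\<close> \<open>adj G u a\<close> that SV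
      by (auto simp: component_def ess_rel_def intro: rtrancl_into_rtrancl)
    then show ?thesis using SV by blast
  qed
  have "vsum G (\<lambda>a. flow_transport D \<theta> G a v) = inverse (comp_size \<theta> G v) *
      vsum G (\<lambda>a. vsum G (\<lambda>u. if a \<notin> ess V \<and> u \<in> ?S \<and> adj G a u then flow \<theta> G a u else 0))"
  proof (subst vsum_cmult[symmetric], rule vsum_cong)
    fix a assume "a \<in> V"
    show "flow_transport D \<theta> G a v = inverse (comp_size \<theta> G v) * vsum G (\<lambda>u. if a \<notin> ess V \<and> u \<in> ?S \<and> adj G a u then flow \<theta> G a u else 0)"
    proof (cases "a \<in> ess V")
      case False
      then show ?thesis
        using assms(1) good by (simp add: flow_transport_def ess_vertex_iff ess_conn_iff mult.commute)
    qed (simp add: flow_transport_def ess_vertex_iff vsum_def)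
  qed
  also have "vsum G (\<lambda>a. vsum G (\<lambda>u. if a \<notin> ess V \<and> u \<in> ?S \<and> adj G a u then flow \<theta> G a u else 0)) =
      vsum G (\<lambda>u. vsum G (\<lambda>a. if a \<notin> ess V \<and> u \<in> ?S \<and> adj G a u then flow \<theta> G a u else 0))"
    by (rule vsum_swap)
  also have "\<dots> = (\<Sum>u\<in>?S. vsum G (\<lambda>a. if a \<notin> ess V \<and> u \<in> ?S \<and> adj G a u then flow \<theta> G a u else 0))"
    using assms(2) SV by (intro vsum_finite) (auto simp: vsum_def)
  also have "\<dots> = (\<Sum>u\<in>?S. \<Sum>a\<in>?N u. ennreal (transport V a u))"
  proof (rule sum.cong[OF refl])
    fix u assume u: "u \<in> ?S"
    have "vsum G (\<lambda>a. if a \<notin> ess V \<and> u \<in> ?S \<and> adj G a u then flow \<theta> G a u else 0) =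
        (\<Sum>a\<in>?N u. if a \<notin> ess V \<and> u \<in> ?S \<and> adj G a u then flow \<theta> G a u else 0)"
    proof (rule vsum_finite)
      show "finite (?N u)" by (rule finite_nbrs_in)
      show "(if a \<notin> ess V \<and> u \<in> ?S \<and> adj G a u then flow \<theta> G a u else 0) = 0" if "a \<in> V" "a \<notin> ?N u" for a
        using that out[OF u, of a] sym[of a u] by auto
    qed auto
    also have "\<dots> = (\<Sum>a\<in>?N u. ennreal (transport V a u))"
    proof (rule sum.cong[OF refl])
      fix a assume a: "a \<in> ?N u"
      have "u \<in> ess V" "adj G a u" "a \<notin> ess V" using a u SV out[OF u, of a] sym[of u a] by auto
      then have "special a" unfolding special_def by blast
      then have "flow \<theta> G a u = ennreal (transport V a u)"
        using special_facts(3) a u SV by (intro flow_eq) auto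
      then show "(if a \<notin> ess V \<and> u \<in> ?S \<and> adj G a u then flow \<theta> G a u else 0) = ennreal (transport V a u)"
        using a u out[OF u] sym by auto
    qed
    finally show "vsum G (\<lambda>a. if a \<notin> ess V \<and> u \<in> ?S \<and> adj G a u then flow \<theta> G a u else 0) =
        (\<Sum>a\<in>?N u. ennreal (transport V a u))" .
  qed
  also have "\<dots> = ennreal (\<Sum>u\<in>?S. \<Sum>a\<in>?N u. transport V a u)"
    by (simp add: sum_ennreal transport_nonneg sum_nonneg)
  also have "inverse (comp_size \<theta> G v) * \<dots> \<le> inverse (comp_size \<theta> G v) * 1"
    using component_inflow[OF assms(1) refl assms(2)] by (intro mult_left_mono) (auto simp: ennreal_le_1)
  finally show ?thesis by simp
qed

lemma bdry_vertex_iff: "u \<in> ess V \<Longrightarrow> bdry_vertex \<theta> G u a \<longleftrightarrow> a \<in> vboundary G (component V u)"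
proof -
  assume u: "u \<in> ess V"
  have SV: "component V u \<subseteq> ess V" by (rule component_subset[OF u])
  have "a \<in> component V u" if "w \<in> component V u" "adj G w a" "a \<in> ess V" for w
    using that SV by (auto simp: component_def ess_rel_def intro: rtrancl_into_rtrancl)
  then show ?thesis
    using SV adj_verts(2) u by (auto simp: bdry_vertex_def ess_conn_iff ess_vertex_iff vboundary_def)
qed

text \<open>The only place where expansion enters: at least \<open>h |S|\<close> boundary vertices
  receive \<open>1 / |S|\<close> each.\<close>

lemma bdry_out:
  assumes u: "u \<in> ess V" and fin: "finite (component V u)" and h: "isoperimetric_const G \<ge> h" "h > 0"
  shows "vsum G (\<lambda>a. bdry_transport D \<theta> G u a) \<ge> ennreal h"
proof -
  let ?S = "component V u"
  have SV: "?S \<subseteq> V" using component_subset[OF u] ess_subset by auto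
  have finB: "finite (vboundary G ?S)"
  proof (rule finite_subset)
    show "finite (\<Union>w\<in>?S. {y. adj G w y})" using fin finite_nbrs by auto
  qed (auto simp: vboundary_def)
  have ne: "?S \<noteq> {}" using component_refl by blast
  have "isoperimetric_const G \<le> real (card (vboundary G ?S)) / real (card ?S)"
    unfolding isoperimetric_const_def
    by (rule cINF_lower) (use SV fin ne in \<open>auto intro!: bdd_belowI2[where m = 0]\<close>)
  with h have hle: "h \<le> real (card (vboundary G ?S)) / real (card ?S)" by linarith
  have cpos: "real (card ?S) > 0" using fin ne by (simp add: card_gt_0_iff)
  have "vsum G (\<lambda>a. bdry_transport D \<theta> G u a) = inverse (comp_size \<theta> G u) * vsum G (\<lambda>a. if a \<in> vboundary G ?S then 1 else 0)"
    unfolding vsum_cmult[symmetric] using u good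
    by (intro vsum_cong) (simp add: bdry_transport_def bdry_vertex_iff ess_vertex_iff)
  also have "\<dots> = inverse (of_nat (card ?S)) * of_nat (card (vboundary G ?S))"
    using finB unfolding comp_size_card[OF u fin]
    by (subst vsum_indicator) (auto simp: vboundary_def emeasure_count_space)
  also have "\<dots> = ennreal (real (card (vboundary G ?S)) / real (card ?S))"
    using cpos by (simp add: ennreal_of_nat_eq_real_of_nat inverse_ennreal ennreal_mult'[symmetric] divide_inverse mult.commute)
  finally show ?thesis using hle by (simp add: ennreal_leI)
qed

text \<open>Every component that borders on \<open>a\<close> contains one of its at most
  \<open>D\<close> essential neighbours, and all vertices of one component together send at most
  1.\<close>

lemma bdry_in: "vsum G (\<lambda>u. bdry_transport D \<theta> G u a) \<le> (if special a then of_nat D else 0)"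
proof (cases "special a")
  case False
  have "bdry_transport D \<theta> G u a = 0" for u
  proof -
    have "\<not> bdry_vertex \<theta> G u a"
    proof
      assume "bdry_vertex \<theta> G u a"
      then obtain w where w: "a \<notin> ess V" "ess_conn \<theta> G u w" "adj G w a"
        by (auto simp: bdry_vertex_def ess_vertex_iff)
      have "w \<in> ess V" using ess_conn_vertex(2)[OF w(2)] by (simp add: ess_vertex_iff)
      then show False using False w sym by (auto simp: special_def)
    qed
    then show ?thesis by (simp add: bdry_transport_def)
  qed
  then show ?thesis by (simp add: vsum_def)
next
  case True
  let ?N = "{w \<in> ess V. adj G a w}"
  have "bdry_transport D \<theta> G u a \<le> (\<Sum>w\<in>?N. inverse (comp_size \<theta> G w) * (if ess_conn \<theta> G w u then 1 else 0))" for u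
  proof (cases "ess_vertex \<theta> G u \<and> bdry_vertex \<theta> G u a")
    case True
    then obtain w where w: "ess_conn \<theta> G u w" "adj G w a" by (auto simp: bdry_vertex_def)
    have wN: "w \<in> ?N" using w ess_conn_vertex(2)[OF w(1)] sym by (auto simp: ess_vertex_iff)
    have "bdry_transport D \<theta> G u a = inverse (comp_size \<theta> G w) * (if ess_conn \<theta> G w u then 1 else 0)"
      using True w(1) comp_size_conn[OF w(1)] ess_conn_commute[of u w] good by (simp add: bdry_transport_def)
    also have "\<dots> \<le> (\<Sum>w\<in>?N. inverse (comp_size \<theta> G w) * (if ess_conn \<theta> G w u then 1 else 0))"
      using wN by (intro member_le_sum) auto
    finally show ?thesis .
  qed (auto simp: bdry_transport_def)
  then have "vsum G (\<lambda>u. bdry_transport D \<theta> G u a) \<le>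
      vsum G (\<lambda>u. \<Sum>w\<in>?N. inverse (comp_size \<theta> G w) * (if ess_conn \<theta> G w u then 1 else 0))"
    by (intro vsum_mono)
  also have "\<dots> = (\<Sum>w\<in>?N. inverse (comp_size \<theta> G w) * comp_size \<theta> G w)"
    unfolding comp_size_def vsum_cmult[symmetric] unfolding vsum_def by (rule nn_integral_sum) simp
  also have "\<dots> \<le> (\<Sum>w\<in>?N. 1)"
    by (intro sum_mono) (simp add: mult.commute mult_inverse_le_1)
  also have "\<dots> = of_nat (card ?N)" by simp
  also have "\<dots> \<le> of_nat D" using card_nbrs_in[of "ess V" a] by (rule of_nat_mono)
  finally show ?thesis using True by simp
qed

end

section \<open>Mass transport in unimodular graphs\<close>

definition infinite_transport :: "nat \<Rightarrow> real \<Rightarrow> graph \<Rightarrow> nat \<Rightarrow> nat \<Rightarrow> ennreal" where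
  "infinite_transport D \<theta> G u v =
     (if good_graph D G \<and> ess_vertex \<theta> G v \<and> comp_size \<theta> G v = \<infinity> then 1 else 0)"

lemma infinite_transport_measurable: "(\<lambda>G. infinite_transport D \<theta> G u v) \<in> borel_measurable graph_space"
  unfolding infinite_transport_def by measurable

lemma (in good_iso) infinite_transport_iso:
  "u \<in> verts G \<Longrightarrow> v \<in> verts G \<Longrightarrow> infinite_transport D \<theta> H (\<phi> u) (\<phi> v) = infinite_transport D \<theta> G u v"
  unfolding infinite_transport_def by (simp add: good good_H ess_vertex_iso comp_size_iso)

lemma ennreal_inverse_antimono: "a \<le> b \<Longrightarrow> inverse b \<le> inverse (a :: ennreal)"
  including ennreal.lifting by transfer (rule ereal_inverse_antimono)

locale unimodular_graph = prob_space M for M :: "'w measure" +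
  fixes G :: "'w \<Rightarrow> graph" and rt :: "'w \<Rightarrow> nat" and D :: nat
  assumes G_rt: "(\<lambda>\<omega>. (G \<omega>, rt \<omega>)) \<in> measurable M (graph_space \<Otimes>\<^sub>M count_space UNIV)"
    and rooted: "AE \<omega> in M. rooted_graph (G \<omega>) (rt \<omega>)"
    and unimod: "unimodular M G rt"
    and degree: "AE \<omega> in M. max_degree_le (G \<omega>) D"
begin

lemma G_measurable: "G \<in> measurable M graph_space" and rt_measurable: "rt \<in> measurable M (count_space UNIV)"
  using measurable_compose[OF G_rt measurable_fst] measurable_compose[OF G_rt measurable_snd] by simp_all

lemma rooted_measurable:
  assumes "\<And>u. (\<lambda>G. F G u) \<in> borel_measurable graph_space"
  shows "(\<lambda>\<omega>. F (G \<omega>) (rt \<omega>)) \<in> borel_measurable M"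
  by (rule measurable_compose_countable[OF _ rt_measurable]) (rule measurable_compose[OF G_measurable assms])

lemma AE_good: "AE \<omega> in M. good_graph D (G \<omega>) \<and> rt \<omega> \<in> verts (G \<omega>)"
  using rooted degree by eventually_elim (simp add: good_graph_def rooted_graph_def)

lemma vsum_out_measurable:
  assumes "\<And>a b. (\<lambda>G. f G a b) \<in> borel_measurable graph_space"
  shows "(\<lambda>\<omega>. vsum (G \<omega>) (\<lambda>v. f (G \<omega>) (rt \<omega>) v)) \<in> borel_measurable M"
  by (rule rooted_measurable[where F = "\<lambda>G u. vsum G (\<lambda>v. f G u v)"]) (intro vsum_measurable measurable_ident_sets refl assms)

lemma vsum_in_measurable:
  assumes "\<And>a b. (\<lambda>G. f G a b) \<in> borel_measurable graph_space"
  shows "(\<lambda>\<omega>. vsum (G \<omega>) (\<lambda>v. f (G \<omega>) v (rt \<omega>))) \<in> borel_measurable M"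
  by (rule rooted_measurable[where F = "\<lambda>G u. vsum G (\<lambda>v. f G v u)"]) (intro vsum_measurable measurable_ident_sets refl assms)

text \<open>A component has total mass at most 1, hence finitely many vertices of mass at least
  \<open>\<epsilon>\<close>. If it is infinite, sending mass 1 from each vertex uniformly to these violates the mass
  transport principle.\<close>

lemma AE_root_component_finite:
  "AE \<omega> in M. ess_vertex \<theta> (G \<omega>) (rt \<omega>) \<longrightarrow> comp_size \<theta> (G \<omega>) (rt \<omega>) < \<infinity>"
proof -
  \<comment> \<open>The thresholds \<open>1 / (j + 1)\<close> reach below any positive atom and keep
    the number of exceptional null sets countable.\<close>
  have "AE \<omega> in M. vsum (G \<omega>) (\<lambda>v. heavy_transport D \<theta> (inverse (real (Suc j))) (G \<omega>) v (rt \<omega>)) \<noteq> \<infinity>" for j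
  proof (rule nn_integral_PInf_AE)
    let ?f = "heavy_transport D \<theta> (inverse (real (Suc j)))"
    show "(\<lambda>\<omega>. vsum (G \<omega>) (\<lambda>v. ?f (G \<omega>) v (rt \<omega>))) \<in> borel_measurable M"
      by (intro vsum_in_measurable heavy_transport_measurable)
    have "(\<integral>\<^sup>+ \<omega>. vsum (G \<omega>) (\<lambda>v. ?f (G \<omega>) v (rt \<omega>)) \<partial>M) = (\<integral>\<^sup>+ \<omega>. vsum (G \<omega>) (\<lambda>v. ?f (G \<omega>) (rt \<omega>) v) \<partial>M)"
      by (rule mass_transport[symmetric, where D = D, OF unimod heavy_transport_measurable good_iso.heavy_transport_iso])
         (simp_all add: heavy_transport_def)
    also have "\<dots> \<le> (\<integral>\<^sup>+ \<omega>. 1 \<partial>M)"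
    proof (rule nn_integral_mono_AE, goal_cases)
      case 1
      from AE_good show ?case by eventually_elim (simp add: good_at.heavy_out good_at_def)
    qed
    also have "\<dots> = 1" using emeasure_space_1 by simp
    finally show "(\<integral>\<^sup>+ \<omega>. vsum (G \<omega>) (\<lambda>v. ?f (G \<omega>) v (rt \<omega>)) \<partial>M) \<noteq> \<infinity>"
      by (metis ennreal_one_neq_top infinity_ennreal_def neq_top_trans)
  qed
  then have "AE \<omega> in M. \<forall>j. vsum (G \<omega>) (\<lambda>v. heavy_transport D \<theta> (inverse (real (Suc j))) (G \<omega>) v (rt \<omega>)) \<noteq> \<infinity>"
    by (simp add: AE_all_countable)
  with AE_good show ?thesis
  proof eventually_elim
    case (elim \<omega>)
    interpret good_at "G \<omega>" D \<theta> using elim by (simp add: good_at_def)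
    show ?case
    proof (intro impI, rule ccontr)
      assume e: "ess_vertex \<theta> (G \<omega>) (rt \<omega>)" "\<not> comp_size \<theta> (G \<omega>) (rt \<omega>) < \<infinity>"
      then have "mass \<theta> (G \<omega>) {} (rt \<omega>) > 0" by (simp add: ess_vertex_def)
      then obtain j where "inverse (real (Suc j)) < mass \<theta> (G \<omega>) {} (rt \<omega>)"
        using reals_Archimedean by blast
      moreover have "comp_size \<theta> (G \<omega>) (rt \<omega>) = \<infinity>"
        using e(2) by (metis infinity_ennreal_def less_top)
      ultimately have "vsum (G \<omega>) (\<lambda>v. heavy_transport D \<theta> (inverse (real (Suc j))) (G \<omega>) v (rt \<omega>)) = \<infinity>"
        using e(1) by (intro heavy_in) (auto simp: ess_vertex_iff)
      then show False using elim by blast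
    qed
  qed
qed

text \<open>Passes from the root to all vertices: every vertex sends 1 to each vertex of an infinite
  component. The root almost surely receives nothing, so it almost surely sends nothing. The flow
  out of a special root needs this, as it runs into components that do not contain the root.\<close>

lemma AE_components_finite:
  "AE \<omega> in M. \<forall>v\<in>verts (G \<omega>). ess_vertex \<theta> (G \<omega>) v \<longrightarrow> comp_size \<theta> (G \<omega>) v < \<infinity>"
proof -
  let ?f = "infinite_transport D \<theta>"
  have "(\<integral>\<^sup>+ \<omega>. vsum (G \<omega>) (\<lambda>v. ?f (G \<omega>) (rt \<omega>) v) \<partial>M) = (\<integral>\<^sup>+ \<omega>. vsum (G \<omega>) (\<lambda>v. ?f (G \<omega>) v (rt \<omega>)) \<partial>M)"
    by (rule mass_transport[where D = D, OF unimod infinite_transport_measurable good_iso.infinite_transport_iso])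
       (simp_all add: infinite_transport_def)
  also have "\<dots> = (\<integral>\<^sup>+ \<omega>. 0 \<partial>M)"
  proof (rule nn_integral_cong_AE, goal_cases)
    case 1
    from AE_root_component_finite[of \<theta>] show ?case
      by eventually_elim (auto simp: infinite_transport_def vsum_def)
  qed
  finally have "(\<integral>\<^sup>+ \<omega>. vsum (G \<omega>) (\<lambda>v. ?f (G \<omega>) (rt \<omega>) v) \<partial>M) = 0" by simp
  then have "AE \<omega> in M. vsum (G \<omega>) (\<lambda>v. ?f (G \<omega>) (rt \<omega>) v) = 0"
    by (subst (asm) nn_integral_0_iff_AE) (intro vsum_out_measurable infinite_transport_measurable, simp)
  with AE_good show ?thesis
  proof eventually_elim
    case (elim \<omega>)
    have "\<forall>v\<in>verts (G \<omega>). ?f (G \<omega>) (rt \<omega>) v = 0"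
      using elim unfolding vsum_def by (subst (asm) nn_integral_0_iff_AE) (auto simp: AE_count_space)
    then show ?case using elim by (auto simp: infinite_transport_def less_top split: if_splits)
  qed
qed

text \<open>Two transports joined at special vertices. Unimodularity moves the boundary mass from
  its senders to its receivers; a special root receives at most \<open>D\<close> of it while sending
  out exactly 1 of flow; unimodularity then moves the flow to the essential vertices.\<close>

lemma mass_transport_inequality:
  assumes "h > 0" "AE \<omega> in M. isoperimetric_const (G \<omega>) \<ge> h"
  shows "ennreal h * (\<integral>\<^sup>+ \<omega>. (if ess_vertex \<theta> (G \<omega>) (rt \<omega>) then 1 else 0) \<partial>M) \<le>
    of_nat D * (\<integral>\<^sup>+ \<omega>. (if ess_vertex \<theta> (G \<omega>) (rt \<omega>) then inverse (comp_size \<theta> (G \<omega>) (rt \<omega>)) else 0) \<partial>M)"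
proof -
  let ?b = "bdry_transport D \<theta>" and ?f = "flow_transport D \<theta>"
  have "(\<lambda>\<omega>. if ess_vertex \<theta> (G \<omega>) (rt \<omega>) then 1 else 0 :: ennreal) \<in> borel_measurable M"
    by (rule rooted_measurable) measurable
  then have "ennreal h * (\<integral>\<^sup>+ \<omega>. (if ess_vertex \<theta> (G \<omega>) (rt \<omega>) then 1 else 0) \<partial>M) =
      (\<integral>\<^sup>+ \<omega>. ennreal h * (if ess_vertex \<theta> (G \<omega>) (rt \<omega>) then 1 else 0) \<partial>M)"
    by (rule nn_integral_cmult[symmetric])
  also have "\<dots> \<le> (\<integral>\<^sup>+ \<omega>. vsum (G \<omega>) (\<lambda>v. ?b (G \<omega>) (rt \<omega>) v) \<partial>M)"
  proof (rule nn_integral_mono_AE, goal_cases)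
    case 1
    from AE_good AE_components_finite[of \<theta>] assms(2) show ?case
    proof eventually_elim
    case (elim \<omega>)
    interpret good_at "G \<omega>" D \<theta> using elim by (simp add: good_at_def)
    show ?case
    proof (cases "ess_vertex \<theta> (G \<omega>) (rt \<omega>)")
      case True
      then have "rt \<omega> \<in> ess (verts (G \<omega>))" "finite (component (verts (G \<omega>)) (rt \<omega>))"
        using elim comp_size_finite_iff[of "rt \<omega>"] by (auto simp: ess_vertex_iff)
      then show ?thesis using True bdry_out[of "rt \<omega>" h] elim assms(1) by simp
    qed simp
    qed
  qed
  also have "\<dots> = (\<integral>\<^sup>+ \<omega>. vsum (G \<omega>) (\<lambda>v. ?b (G \<omega>) v (rt \<omega>)) \<partial>M)"
    by (rule mass_transport[where D = D, OF unimod bdry_transport_measurable good_iso.bdry_transport_iso])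
       (simp_all add: bdry_transport_def)
  also have "\<dots> \<le> (\<integral>\<^sup>+ \<omega>. of_nat D * vsum (G \<omega>) (\<lambda>v. ?f (G \<omega>) (rt \<omega>) v) \<partial>M)"
  proof (rule nn_integral_mono_AE, goal_cases)
    case 1
    from AE_good AE_components_finite[of \<theta>] show ?case
    proof eventually_elim
    case (elim \<omega>)
    interpret good_at "G \<omega>" D \<theta> using elim by (simp add: good_at_def)
    have fin: "comp_size \<theta> (G \<omega>) u < \<infinity>" if "u \<in> ess (verts (G \<omega>))" for u
      using elim that ess_subset by (auto simp: ess_vertex_iff)
    show ?case
    proof (cases "special (rt \<omega>)")
      case True
      then show ?thesis using bdry_in[of "rt \<omega>"] flow_out[OF True fin] by simp
    next
      case False
      then show ?thesis using bdry_in[of "rt \<omega>"] by simp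
    qed
    qed
  qed
  also have "\<dots> = of_nat D * (\<integral>\<^sup>+ \<omega>. vsum (G \<omega>) (\<lambda>v. ?f (G \<omega>) (rt \<omega>) v) \<partial>M)"
    by (intro nn_integral_cmult vsum_out_measurable flow_transport_measurable)
  also have "(\<integral>\<^sup>+ \<omega>. vsum (G \<omega>) (\<lambda>v. ?f (G \<omega>) (rt \<omega>) v) \<partial>M) = (\<integral>\<^sup>+ \<omega>. vsum (G \<omega>) (\<lambda>v. ?f (G \<omega>) v (rt \<omega>)) \<partial>M)"
    by (rule mass_transport[where D = D, OF unimod flow_transport_measurable good_iso.flow_transport_iso])
       (simp_all add: flow_transport_def)
  also have "of_nat D * \<dots> \<le> of_nat D * (\<integral>\<^sup>+ \<omega>. (if ess_vertex \<theta> (G \<omega>) (rt \<omega>) then inverse (comp_size \<theta> (G \<omega>) (rt \<omega>)) else 0) \<partial>M)"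
  proof (rule mult_left_mono)
    show "(\<integral>\<^sup>+ \<omega>. vsum (G \<omega>) (\<lambda>v. ?f (G \<omega>) v (rt \<omega>)) \<partial>M) \<le>
        (\<integral>\<^sup>+ \<omega>. (if ess_vertex \<theta> (G \<omega>) (rt \<omega>) then inverse (comp_size \<theta> (G \<omega>) (rt \<omega>)) else 0) \<partial>M)"
    proof (rule nn_integral_mono_AE, goal_cases)
      case 1
      from AE_good AE_components_finite[of \<theta>] show ?case
      proof eventually_elim
      case (elim \<omega>)
      interpret good_at "G \<omega>" D \<theta> using elim by (simp add: good_at_def)
      show ?case
      proof (cases "ess_vertex \<theta> (G \<omega>) (rt \<omega>)")
        case True
        then have "rt \<omega> \<in> ess (verts (G \<omega>))" "finite (component (verts (G \<omega>)) (rt \<omega>))"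
          using elim comp_size_finite_iff[of "rt \<omega>"] by (auto simp: ess_vertex_iff)
        then show ?thesis using True flow_in[of "rt \<omega>"] by simp
      next
        case False
        then show ?thesis by (simp add: flow_transport_def vsum_def)
      qed
      qed
    qed
  qed simp
  finally show ?thesis .
qed

lemma small_component:
  assumes "h > 0" "AE \<omega> in M. isoperimetric_const (G \<omega>) \<ge> h"
    and atom: "(\<integral>\<^sup>+ \<omega>. emeasure (matching_measure (G \<omega>) (rt \<omega>)) {\<theta>} \<partial>M) > 0"
    and K: "real D < h * real K"
  shows "\<exists>E S. bounded_graph E D \<and> finite S \<and> card S < K \<and> matching_val E S (of_real \<theta>) = 0"
proof -
  let ?p = "\<integral>\<^sup>+ \<omega>. (if ess_vertex \<theta> (G \<omega>) (rt \<omega>) then 1 else 0) \<partial>M"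
  have meas: "(\<lambda>\<omega>. if ess_vertex \<theta> (G \<omega>) (rt \<omega>) then 1 else 0 :: ennreal) \<in> borel_measurable M"
    by (rule rooted_measurable) measurable
  have p1: "?p \<le> 1"
  proof -
    have "?p \<le> (\<integral>\<^sup>+ \<omega>. 1 \<partial>M)" by (intro nn_integral_mono) simp
    then show ?thesis using emeasure_space_1 by simp
  qed
  \<comment> \<open>If the root were almost never essential, its matching measure would almost
    surely have no atom at \<open>\<theta>\<close>, contrary to the positive expectation.\<close>
  have p0: "?p \<noteq> 0"
  proof
    assume "?p = 0"
    then have "AE \<omega> in M. (if ess_vertex \<theta> (G \<omega>) (rt \<omega>) then 1 else 0 :: ennreal) = 0"
      using nn_integral_0_iff_AE[OF meas] by simp
    with AE_good have "AE \<omega> in M. emeasure (matching_measure (G \<omega>) (rt \<omega>)) {\<theta>} = 0"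
    proof eventually_elim
      case (elim \<omega>)
      interpret good_at "G \<omega>" D \<theta> using elim by (simp add: good_at_def)
      have r: "rt \<omega> \<in> verts (G \<omega>)" "\<not> ess_vertex \<theta> (G \<omega>) (rt \<omega>)" using elim by (auto split: if_splits)
      have e: "(verts (G \<omega>), adj (G \<omega>)) = G \<omega>" by (simp add: verts_def adj_def)
      interpret mm: real_distribution "matching_measure (G \<omega>) (rt \<omega>)"
        using matching_measure_spectral(1)[OF r(1)] unfolding e .
      have "atom (verts (G \<omega>)) (rt \<omega>) = 0"
        using r atom_nonneg[of "verts (G \<omega>)" "rt \<omega>"] by (auto simp: ess_vertex_iff ess_def)
      then show ?case unfolding atom_def e by (simp add: mm.emeasure_eq_measure)
    qed
    then have "(\<integral>\<^sup>+ \<omega>. emeasure (matching_measure (G \<omega>) (rt \<omega>)) {\<theta>} \<partial>M) = (\<integral>\<^sup>+ \<omega>. 0 \<partial>M)"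
      by (rule nn_integral_cong_AE)
    then show False using atom by simp
  qed
  \<comment> \<open>If all components of the root had at least \<open>K\<close> vertices, the right
    side of the transport inequality would be at most \<open>D / K\<close> times the probability of
    an essential root, which is less than \<open>h\<close> times it.\<close>
  have not_large: "\<not> (AE \<omega> in M. ess_vertex \<theta> (G \<omega>) (rt \<omega>) \<longrightarrow> of_nat K \<le> comp_size \<theta> (G \<omega>) (rt \<omega>))"
  proof
    assume large: "AE \<omega> in M. ess_vertex \<theta> (G \<omega>) (rt \<omega>) \<longrightarrow> of_nat K \<le> comp_size \<theta> (G \<omega>) (rt \<omega>)"
    have Kpos: "real K > 0" using K assms(1) by (metis le_less_trans of_nat_0_le_iff zero_less_mult_pos)
    have "(\<integral>\<^sup>+ \<omega>. (if ess_vertex \<theta> (G \<omega>) (rt \<omega>) then inverse (comp_size \<theta> (G \<omega>) (rt \<omega>)) else 0) \<partial>M) \<le>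
        (\<integral>\<^sup>+ \<omega>. inverse (of_nat K) * (if ess_vertex \<theta> (G \<omega>) (rt \<omega>) then 1 else 0) \<partial>M)"
    proof (rule nn_integral_mono_AE, goal_cases)
      case 1
      from large show ?case by eventually_elim (auto intro: ennreal_inverse_antimono)
    qed
    also have "\<dots> = inverse (of_nat K) * ?p" by (rule nn_integral_cmult[OF meas])
    finally have "of_nat D * (\<integral>\<^sup>+ \<omega>. (if ess_vertex \<theta> (G \<omega>) (rt \<omega>) then inverse (comp_size \<theta> (G \<omega>) (rt \<omega>)) else 0) \<partial>M) \<le>
        of_nat D * (inverse (of_nat K) * ?p)"
      by (rule mult_left_mono) simp
    with mass_transport_inequality[OF assms(1,2), of \<theta>]
    have le: "ennreal h * ?p \<le> of_nat D * (inverse (of_nat K) * ?p)" by (rule order.trans)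
    have "?p < \<top>" using p1 by (metis ennreal_one_less_top le_less_trans)
    \<comment> \<open>Finite and nonzero, so that it can be cancelled from both sides.\<close>
    then obtain q where q: "?p = ennreal q" "q \<ge> 0" by (cases ?p) auto
    have "q > 0" using q p0 by (simp add: order_less_le)
    have "ennreal (h * q) \<le> ennreal (real D * (inverse (real K) * q))"
      using le assms(1) Kpos q(2) unfolding q(1)
      by (simp add: ennreal_mult ennreal_of_nat_eq_real_of_nat inverse_ennreal)
    then have "h * q \<le> real D * (inverse (real K) * q)"
      using q(2) by (subst (asm) ennreal_le_iff) auto
    then have "q * h \<le> q * (real D / real K)" by (simp add: mult_ac divide_inverse)
    then have "h \<le> real D / real K" using \<open>q > 0\<close> by (simp only: mult_le_cancel_left_pos)
    then show False using K Kpos by (simp add: field_simps)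
  qed
  \<comment> \<open>One outcome outside all null sets is enough, since being a root of a small
    matching polynomial is a deterministic property of \<open>\<theta>\<close>.\<close>
  have "\<exists>\<omega>. good_graph D (G \<omega>) \<and> ess_vertex \<theta> (G \<omega>) (rt \<omega>) \<and>
    comp_size \<theta> (G \<omega>) (rt \<omega>) < \<infinity> \<and> \<not> of_nat K \<le> comp_size \<theta> (G \<omega>) (rt \<omega>)"
  proof (rule ccontr)
    assume none: "\<not> ?thesis"
    from AE_good AE_root_component_finite[of \<theta>]
    have "AE \<omega> in M. ess_vertex \<theta> (G \<omega>) (rt \<omega>) \<longrightarrow> of_nat K \<le> comp_size \<theta> (G \<omega>) (rt \<omega>)"
      by eventually_elim (use none in blast)
    then show False using not_large by blast
  qed
  then obtain \<omega> where \<omega>: "good_graph D (G \<omega>)" "ess_vertex \<theta> (G \<omega>) (rt \<omega>)"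
    "comp_size \<theta> (G \<omega>) (rt \<omega>) < \<infinity>" "\<not> of_nat K \<le> comp_size \<theta> (G \<omega>) (rt \<omega>)"
    by blast
  interpret good_at "G \<omega>" D \<theta> using \<omega> by (simp add: good_at_def)
  let ?S = "component (verts (G \<omega>)) (rt \<omega>)"
  have r: "rt \<omega> \<in> ess (verts (G \<omega>))" using \<omega>(2) by (simp add: ess_vertex_iff)
  have fin: "finite ?S" using \<omega>(3) comp_size_finite_iff[OF r] by simp
  have "card ?S < K" using \<omega>(4) unfolding comp_size_card[OF r fin] by (simp add: not_le)
  moreover have "matching_val (adj (G \<omega>)) ?S (of_real \<theta>) = 0" by (rule component_root[OF r refl fin])
  ultimately show ?thesis using fin bounded_graph_axioms by blast
qed

end

theorem theorem6p6:
  fixes M :: "'w measure" and G :: "'w \<Rightarrow> graph" and rt :: "'w \<Rightarrow> nat"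
    and D :: nat and h :: real
  assumes "prob_space M"
    and "(\<lambda>\<omega>. (G \<omega>, rt \<omega>)) \<in> measurable M (graph_space \<Otimes>\<^sub>M count_space UNIV)"
    and "AE \<omega> in M. rooted_graph (G \<omega>) (rt \<omega>)"
    and "unimodular M G rt"
    and "AE \<omega> in M. max_degree_le (G \<omega>) D"
    and "h > 0"
    and "AE \<omega> in M. isoperimetric_const (G \<omega>) \<ge> h"
  shows "finite {x::real. (\<integral>\<^sup>+ \<omega>. emeasure (matching_measure (G \<omega>) (rt \<omega>)) {x} \<partial>M) > 0}"
proof -
  interpret unimodular_graph M G rt D
    using assms by (simp add: unimodular_graph_def unimodular_graph_axioms_def)
  \<comment> \<open>\<open>K\<close> depends on \<open>D\<close> and \<open>h\<close> but not on the
    atom, so one finite set of roots contains all atoms.\<close>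
  obtain K where K: "real D < h * real K"
    using reals_Archimedean3[OF assms(6)] by (metis mult.commute)
  show ?thesis
  proof (rule finite_subset[OF _ finite_small_matching_roots[of K]], rule subsetI)
    fix \<theta> :: real
    assume "\<theta> \<in> {x. (\<integral>\<^sup>+ \<omega>. emeasure (matching_measure (G \<omega>) (rt \<omega>)) {x} \<partial>M) > 0}"
    then show "\<theta> \<in> {\<theta>. \<exists>E D S. bounded_graph E D \<and> finite S \<and> card S < K \<and> matching_val E S (of_real \<theta>) = 0}"
      using small_component[OF assms(6,7) _ K, of \<theta>] by blast
  qed
qed

end
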